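(* Let $G$ be a finite group acting smoothly from the right on a manifold $M$ and let $(g_{i,j},\tau_i,\sigma)_{i,j}\in(G\wr\Sigma_m)\wr\Sigma_n$ ($1\le i\le n$, $1\le j\le m$, $g_{i,j}\in G$, $\tau_i\in\Sigma_m$, $\sigma\in\Sigma_n$). Then the following diagram commutes: $$\begin{array}{ccc} \mathcal L_{(g_{i,j},\tau_i,\sigma)_{i,j}}(M^m)^n&\longrightarrow&\prod\limits_l\prod\limits_{(i_1,\dots,i_l)}{}_l\mathcal L_{(g_j,\tau)_j}M^m\\ \|&&\downarrow\\ \mathcal L_{(g_{i,j},\iota(\tau_i,\sigma))_{i,j}}M^{mn}&\longrightarrow&\prod\limits_{l,(i_1,\dots,i_l)}\ \prod\limits_{k,(j_1,\dots,j_k)}{}_{kl}\mathcal L_{g_{j_k}\cdots g_{j_1}}M \end{array}$$ Here $(i_1,\dots,i_l)$ runs over all $l$-cycles of $\sigma$; for each such cycle, $(g_j,\tau)_j:=(g_{i_l,j},\tau_{i_l})_j\cdots(g_{i_1,j},\tau_{i_1})_j\in G\wr\Sigma_m$; and $(j_1,\dots,j_k)$ runs over all $k$-cycles of (this) $\tau$, so that the product in the lower right entry runs over all cycles of $(\underline\tau,\sigma)$. The upper horizontal map is $F_{((\underline g,\underline\tau),\sigma)}$ (for the group $G\wr\Sigma_m$ acting on $M^m$), the right vertical map is the product over the cycles $(i_1,\dots,i_l)$ of the maps $F_{(g_j,\tau)_j}$ for loops of length $l$, the left map is the identification induced by $\iota$, and the bottom map is $F_{(\underline g,\iota(\underline\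tau,\sigma))}$.
   Context: Loop spaces. For $g\in G$ and natural $k$, ${}_k\mathcal L_gM=\{\gamma\colon[0,k]\to M\mid\gamma(k)=\gamma(0)g\}$ (piecewise smooth paths), extended to $\mathbb R$ by $\gamma(t+k)=\gamma(t)g$. $k=1$ is dropped from the notation; $*$ is concatenation of paths. Wreath products. $G\wr\Sigma_n$ has elements $(\underline g,\sigma)\in G^n\times\Sigma_n$, $(\underline g,\sigma)(\underline h,\tau)=(g_1h_{\sigma^{-1}(1)},\dots,g_nh_{\sigma^{-1}(n)},\sigma\tau)$, acting on the right on $M^n$ by $\underline x\cdot(\underline g,\sigma)=(x_{\sigma(1)}g_{\sigma(1)},\dots,x_{\sigma(n)}g_{\sigma(n)})$. The map $F$. For $(\underline g,\sigma)\in G\wr\Sigma_n$ and each cycle of $\sigma$ written as $(i_1,\dots,i_k)$ with a chosen first element, a path $(\gamma_1,\dots,\gamma_n)\in{}_l\mathcal L_{(\underline g,\sigma)}M^n$ (so $\gamma_i(l)=\gamma_{\sigma(i)}(0)g_{\sigma(i)}$) is sent to the family of paths $$\gamma_{i_k}*\gamma_{i_1}g_{i_1}*\gamma_{i_2}g_{i_2}g_{i_1}*\dots*\gamma_{i_{k-1}}g_{i_{k-1}}\cdots g_{i_1}\in{}_{kl}\mathcal L_{g_{i_k}\cdots g_{i_1}}M,$$ one for each cycle. This is a homeomorphism $F_{(\underline g,\sigma)}\colon{}_l\mathcal L_{(\underline g,\sigma)}M^n\cong\prod_k\prod_{(i_1,\dots,i_k)}{}_{kl}\mathcal L_{g_{i_k}\cdots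 g_{i_1}}M$. The inclusion $\iota$. $(\underline\tau,\sigma)=(\tau_1,\dots,\tau_n,\sigma)\in\Sigma_m\wr\Sigma_n$ acts on pairs $(i,j)$, $1\le i\le n$, $1\le j\le m$, by $(\underline\tau,\sigma)(i,j)=(\sigma(i),\tau_{\sigma(i)}(j))$; via the bijection $(i,j)\mapsto i+(j-1)n$ onto $\{1,\dots,nm\}$ this gives an inclusion $\iota\colon\Sigma_m\wr\Sigma_n\to\Sigma_{nm}$, and the identification $(M^m)^n=M^{mn}$ uses the same bijection. Cycles: for an $l$-cycle $(i_1,\dots,i_l)$ of $\sigma$ with $\tau=\tau_{i_l}\cdots\tau_{i_1}$, a $k$-cycle $(j_1,\dots,j_k)$ of $\tau$ corresponds to the $lk$-cycle of $(\underline\tau,\sigma)$ $$\big((i_1,\tau_{i_1}(j_k)),(i_2,\tau_{i_2}\tau_{i_1}(j_k)),\dots,(i_l,j_1),(i_1,\tau_{i_1}(j_1)),\dots,(i_l,j_2),\dots,(i_l,j_k)\big),$$ and the bottom map is formed with this choice of first elements. In the lower right entry the $g_j$ are the components of $(g_j,\tau)_j$. *)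

theory Defs
  imports "HOL-Analysis.Analysis" "HOL-Algebra.Group" "HOL-Combinatorics.Permutations"
begin

section \<open>Smooth manifolds\<close>

text \<open>
  Since the powers of a manifold are needed for varying exponents, the model space \<open>\<real>\<^sup>d\<close> is the
  topology \<^term>\<open>Euclidean_space d\<close> on functions \<open>nat \<Rightarrow> real\<close> that vanish at all indices \<open>\<ge> d\<close>.
\<close>

text \<open>
  A function on an open subset \<open>U\<close> of \<open>\<real>\<^sup>d\<close> is smooth if all its iterated partial derivatives
  exist and are continuous on \<open>U\<close>; \<open>D [i\<^sub>1, \<dots>, i\<^sub>r]\<close> is the partial derivative
  \<open>\<partial>\<^sub>i\<^sub>1 \<dots> \<partial>\<^sub>i\<^sub>r f\<close>.
\<close>

definition smooth_fun_on :: "nat \<Rightarrow> (nat \<Rightarrow> real) set \<Rightarrow> ((nat \<Rightarrow> real) \<Rightarrow> real) \<Rightarrow> bool" where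
  "smooth_fun_on d U f \<longleftrightarrow>
     (\<exists>D :: nat list \<Rightarrow> (nat \<Rightarrow> real) \<Rightarrow> real.
        (\<forall>x\<in>U. D [] x = f x) \<and>
        (\<forall>is. set is \<subseteq> {..<d} \<longrightarrow>
           continuous_map (subtopology (Euclidean_space d) U) euclideanreal (D is) \<and>
           (\<forall>i<d. \<forall>x\<in>U.
              ((\<lambda>t. D is (x(i := t))) has_real_derivative D (i # is) x) (at (x i)))))"

text \<open>
  A chart is a pair \<open>(U, \<phi>)\<close>; the values of \<open>\<phi>\<close> outside \<open>U\<close> are irrelevant.
\<close>

record 'a manifold =
  mtop :: "'a topology"
  mdim :: nat
  atlas :: "('a set \<times> ('a \<Rightarrow> nat \<Rightarrow> real)) set"

definition smooth_manifold :: "'a manifold \<Rightarrow> bool" where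
  "smooth_manifold M \<longleftrightarrow>
     Hausdorff_space (mtop M) \<and> second_countable (mtop M) \<and>
     topspace (mtop M) = (\<Union>(U, \<phi>)\<in>atlas M. U) \<and>
     (\<forall>(U, \<phi>)\<in>atlas M.
        openin (mtop M) U \<and> openin (Euclidean_space (mdim M)) (\<phi> ` U) \<and>
        homeomorphic_map (subtopology (mtop M) U)
          (subtopology (Euclidean_space (mdim M)) (\<phi> ` U)) \<phi>) \<and>
     (\<forall>(U, \<phi>)\<in>atlas M. \<forall>(V, \<psi>)\<in>atlas M. \<forall>i<mdim M.
        smooth_fun_on (mdim M) (\<phi> ` (U \<inter> V)) (\<lambda>x. \<psi> (inv_into U \<phi> x) i))"

definition smooth_map :: "'a manifold \<Rightarrow> 'b manifold \<Rightarrow> ('a \<Rightarrow> 'b) \<Rightarrow> bool" where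
  "smooth_map M N h \<longleftrightarrow>
     continuous_map (mtop M) (mtop N) h \<and>
     (\<forall>(U, \<phi>)\<in>atlas M. \<forall>(V, \<psi>)\<in>atlas N. \<forall>i<mdim N.
        smooth_fun_on (mdim M) (\<phi> ` {x\<in>U. h x \<in> V}) (\<lambda>y. \<psi> (h (inv_into U \<phi> y)) i))"

text \<open>
  The \<open>n\<close>-th power \<open>M\<^sup>n\<close>, with points \<open>(x\<^sub>1, \<dots>, x\<^sub>n)\<close> and the atlas of all products of
  charts of \<open>M\<close>. With \<open>d = dim M\<close>, the coordinates of the \<open>i\<close>-th factor occupy the positions
  \<open>(i - 1)d, \<dots>, id - 1\<close>.
\<close>

definition power_manifold :: "nat \<Rightarrow> 'a manifold \<Rightarrow> (nat \<Rightarrow> 'a) manifold" where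
  "power_manifold n M =
     \<lparr> mtop = product_topology (\<lambda>_. mtop M) {1..n},
       mdim = n * mdim M,
       atlas =
         {(\<Pi>\<^sub>E i\<in>{1..n}. fst (c i),
           \<lambda>x q. if q < n * mdim M
                 then snd (c (q div mdim M + 1)) (x (q div mdim M + 1)) (q mod mdim M)
                 else 0) | c. \<forall>i\<in>{1..n}. c i \<in> atlas M} \<rparr>"

text \<open>As \<open>G\<close> is discrete, the action is smooth iff every group element acts smoothly.\<close>

definition smooth_right_action ::
  "('g, 'r) monoid_scheme \<Rightarrow> 'a manifold \<Rightarrow> ('a \<Rightarrow> 'g \<Rightarrow> 'a) \<Rightarrow> bool" where
  "smooth_right_action G M act \<longleftrightarrow>
     (\<forall>g\<in>carrier G. smooth_map M M (\<lambda>x. act x g)) \<and>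
     (\<forall>x\<in>topspace (mtop M). act x \<one>\<^bsub>G\<^esub> = x) \<and>
     (\<forall>x\<in>topspace (mtop M). \<forall>g\<in>carrier G. \<forall>h\<in>carrier G.
        act (act x g) h = act x (g \<otimes>\<^bsub>G\<^esub> h))"


section \<open>Paths and loop spaces\<close>

text \<open>
  Smoothness on \<open>T\<close> with one-sided derivatives at boundary points; \<open>T\<close> will be a relatively open
  subset of a nondegenerate compact interval.
\<close>

definition smooth_real_on :: "real set \<Rightarrow> (real \<Rightarrow> real) \<Rightarrow> bool" where
  "smooth_real_on T f \<longleftrightarrow>
     (\<exists>D :: nat \<Rightarrow> real \<Rightarrow> real.
        (\<forall>t\<in>T. D 0 t = f t) \<and>
        (\<forall>r. \<forall>t\<in>T. (D r has_real_derivative D (Suc r) t) (at t within T)))"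

definition smooth_curve_on :: "'a manifold \<Rightarrow> real \<Rightarrow> real \<Rightarrow> (real \<Rightarrow> 'a) \<Rightarrow> bool" where
  "smooth_curve_on M a b \<gamma> \<longleftrightarrow>
     continuous_map (top_of_set {a..b}) (mtop M) \<gamma> \<and>
     (\<forall>(U, \<phi>)\<in>atlas M. \<forall>i<mdim M.
        smooth_real_on {t\<in>{a..b}. \<gamma> t \<in> U} (\<lambda>t. \<phi> (\<gamma> t) i))"

text \<open>Here \<open>S\<close> is the set of break points of a subdivision of \<open>[0, r]\<close>.\<close>

definition piecewise_smooth_path :: "'a manifold \<Rightarrow> real \<Rightarrow> (real \<Rightarrow> 'a) \<Rightarrow> bool" where
  "piecewise_smooth_path M r \<gamma> \<longleftrightarrow>
     continuous_map (top_of_set {0..r}) (mtop M) \<gamma> \<and>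
     (\<exists>S. finite S \<and>
        (\<forall>a b. 0 \<le> a \<and> a < b \<and> b \<le> r \<and> {a<..<b} \<inter> S = {} \<longrightarrow> smooth_curve_on M a b \<gamma>))"

text \<open>
  The space \<open>\<^sub>k\<L>\<^sub>g M\<close>. Paths of length \<open>k\<close> are functions on \<open>[0, k]\<close>, made extensional so that
  equality of paths is equality of functions.
\<close>

definition loops :: "nat \<Rightarrow> 'a manifold \<Rightarrow> ('a \<Rightarrow> 'g \<Rightarrow> 'a) \<Rightarrow> 'g \<Rightarrow> (real \<Rightarrow> 'a) set" where
  "loops k M act g =
     {\<gamma> \<in> extensional {0..real k}.
        piecewise_smooth_path M (real k) \<gamma> \<and> \<gamma> (real k) = act (\<gamma> 0) g}"

text \<open>\<open>path_join l l' \<gamma> \<delta>\<close> is \<open>\<gamma> * \<delta>\<close> for paths of lengths \<open>l\<close> and \<open>l'\<close>, without rescaling.\<close>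

definition path_join :: "nat \<Rightarrow> nat \<Rightarrow> (real \<Rightarrow> 'a) \<Rightarrow> (real \<Rightarrow> 'a) \<Rightarrow> real \<Rightarrow> 'a" where
  "path_join l l' \<gamma> \<delta> =
     (\<lambda>t\<in>{0..real (l + l')}. if t \<le> real l then \<gamma> t else \<delta> (t - real l))"

fun path_concat :: "nat \<Rightarrow> (real \<Rightarrow> 'a) list \<Rightarrow> real \<Rightarrow> 'a" where
  "path_concat l [] = (\<lambda>_. undefined)"
| "path_concat l [\<gamma>] = \<gamma>"
| "path_concat l (\<gamma> # \<delta> # \<gamma>s) =
     path_join l (length (\<delta> # \<gamma>s) * l) \<gamma> (path_concat l (\<delta> # \<gamma>s))"

definition path_act :: "nat \<Rightarrow> ('a \<Rightarrow> 'g \<Rightarrow> 'a) \<Rightarrow> (real \<Rightarrow> 'a) \<Rightarrow> 'g \<Rightarrow> real \<Rightarrow> 'a" where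
  "path_act l act \<gamma> g = (\<lambda>t\<in>{0..real l}. act (\<gamma> t) g)"


section \<open>Wreath products\<close>

definition wreath :: "('g, 'r) monoid_scheme \<Rightarrow> nat \<Rightarrow> ((nat \<Rightarrow> 'g) \<times> (nat \<Rightarrow> nat)) monoid" where
  "wreath G n =
     \<lparr> carrier = ({1..n} \<rightarrow>\<^sub>E carrier G) \<times> {\<sigma>. \<sigma> permutes {1..n}},
       monoid.mult = (\<lambda>(g, \<sigma>) (h, \<tau>).
         (\<lambda>i\<in>{1..n}. g i \<otimes>\<^bsub>G\<^esub> h (inv_into UNIV \<sigma> i), \<sigma> \<circ> \<tau>)),
       one = (\<lambda>i\<in>{1..n}. \<one>\<^bsub>G\<^esub>, id) \<rparr>"

definition wreath_act ::
  "nat \<Rightarrow> ('a \<Rightarrow> 'g \<Rightarrow> 'a) \<Rightarrow> (nat \<Rightarrow> 'a) \<Rightarrow> (nat \<Rightarrow> 'g) \<times> (nat \<Rightarrow> nat) \<Rightarrow> nat \<Rightarrow> 'a" where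
  "wreath_act n act x = (\<lambda>(g, \<sigma>). \<lambda>i\<in>{1..n}. act (x (\<sigma> i)) (g (\<sigma> i)))"


section \<open>Cycles and the map \<open>F\<close>\<close>

text \<open>
  A cycle with a chosen first element is the list \<open>[i\<^sub>1, \<dots>, i\<^sub>k]\<close> with \<open>\<sigma>(i\<^sub>p) = i\<^sub>p\<^sub>+\<^sub>1\<close> and
  \<open>\<sigma>(i\<^sub>k) = i\<^sub>1\<close>. Fixed points are cycles of length 1.
\<close>

definition is_cycle :: "(nat \<Rightarrow> nat) \<Rightarrow> nat list \<Rightarrow> bool" where
  "is_cycle \<sigma> c \<longleftrightarrow>
     c \<noteq> [] \<and> distinct c \<and> (\<forall>p<length c. \<sigma> (c ! p) = c ! (Suc p mod length c))"

text \<open>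
  \<open>C\<close> contains every cycle of the permutation \<open>\<sigma>\<close> of \<open>{1, \<dots>, n}\<close> exactly once, i.e. with
  exactly one choice of first element.
\<close>

definition cycle_system :: "nat \<Rightarrow> (nat \<Rightarrow> nat) \<Rightarrow> nat list set \<Rightarrow> bool" where
  "cycle_system n \<sigma> C \<longleftrightarrow>
     (\<forall>c\<in>C. is_cycle \<sigma> c \<and> set c \<subseteq> {1..n}) \<and> (\<forall>i\<in>{1..n}. \<exists>!c. c \<in> C \<and> i \<in> set c)"

text \<open>\<open>cycle_prod G g [i\<^sub>1, \<dots>, i\<^sub>p]\<close> is \<open>g\<^sub>i\<^sub>p \<cdots> g\<^sub>i\<^sub>1\<close>.\<close>

definition cycle_prod :: "('g, 'r) monoid_scheme \<Rightarrow> (nat \<Rightarrow> 'g) \<Rightarrow> nat list \<Rightarrow> 'g" where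
  "cycle_prod G g c = foldr (\<otimes>\<^bsub>G\<^esub>) (map g (rev c)) \<one>\<^bsub>G\<^esub>"

text \<open>
  The component at the cycle \<open>c = [i\<^sub>1, \<dots>, i\<^sub>k]\<close> of the map \<open>F\<close> for paths \<open>\<gamma>\<close> of length \<open>l\<close>:
  the concatenation of \<open>\<gamma>\<^sub>i\<^sub>k\<close> and the \<open>\<gamma>\<^sub>i\<^sub>p g\<^sub>i\<^sub>p \<cdots> g\<^sub>i\<^sub>1\<close> for \<open>1 \<le> p < k\<close>. (List
  positions start at 0.)
\<close>

definition F_cycle ::
  "('g, 'r) monoid_scheme \<Rightarrow> ('a \<Rightarrow> 'g \<Rightarrow> 'a) \<Rightarrow> nat \<Rightarrow> (nat \<Rightarrow> 'g)
     \<Rightarrow> (real \<Rightarrow> nat \<Rightarrow> 'a) \<Rightarrow> nat list \<Rightarrow> real \<Rightarrow> 'a" where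
  "F_cycle G act l g \<gamma> c =
     (let \<gamma>' = (\<lambda>i. \<lambda>t\<in>{0..real l}. \<gamma> t i) in
      path_concat l
        (\<gamma>' (last c) #
         map (\<lambda>p. path_act l act (\<gamma>' (c ! (p - 1))) (cycle_prod G g (take p c)))
             [1..<length c]))"

text \<open>The permutation enters the formula for \<open>F\<^bsub>(g,\<sigma>)\<^esub>\<close> only through its system \<open>C\<close> of cycles.\<close>

definition F_map ::
  "('g, 'r) monoid_scheme \<Rightarrow> ('a \<Rightarrow> 'g \<Rightarrow> 'a) \<Rightarrow> nat \<Rightarrow> (nat \<Rightarrow> 'g) \<Rightarrow> nat list set
     \<Rightarrow> (real \<Rightarrow> nat \<Rightarrow> 'a) \<Rightarrow> nat list \<Rightarrow> real \<Rightarrow> 'a" where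
  "F_map G act l g C \<gamma> = (\<lambda>c\<in>C. F_cycle G act l g \<gamma> c)"


section \<open>The inclusion \<open>\<iota>\<close>\<close>

definition pair_index :: "nat \<Rightarrow> nat \<times> nat \<Rightarrow> nat" where
  "pair_index n = (\<lambda>(i, j). i + (j - 1) * n)"

definition index_pair :: "nat \<Rightarrow> nat \<Rightarrow> nat \<Rightarrow> nat \<times> nat" where
  "index_pair n m = inv_into ({1..n} \<times> {1..m}) (pair_index n)"

definition iota :: "nat \<Rightarrow> nat \<Rightarrow> (nat \<Rightarrow> nat \<Rightarrow> nat) \<Rightarrow> (nat \<Rightarrow> nat) \<Rightarrow> nat \<Rightarrow> nat" where
  "iota n m \<tau> \<sigma> q =
     (if q \<in> {1..n * m}
      then case index_pair n m q of (i, j) \<Rightarrow> pair_index n (\<sigma> i, \<tau> (\<sigma> i) j)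
      else q)"

text \<open>The identification of families \<open>(x\<^sub>i\<^sub>,\<^sub>j)\<close> with tuples indexed by \<open>{1, \<dots>, nm}\<close>.\<close>

definition flatten :: "nat \<Rightarrow> nat \<Rightarrow> (nat \<Rightarrow> nat \<Rightarrow> 'a) \<Rightarrow> nat \<Rightarrow> 'a" where
  "flatten n m x = (\<lambda>q\<in>{1..n * m}. case index_pair n m q of (i, j) \<Rightarrow> x i j)"

definition flatten_path :: "nat \<Rightarrow> nat \<Rightarrow> nat \<Rightarrow> (real \<Rightarrow> nat \<Rightarrow> nat \<Rightarrow> 'a) \<Rightarrow> real \<Rightarrow> nat \<Rightarrow> 'a" where
  "flatten_path l n m \<gamma> = (\<lambda>t\<in>{0..real l}. flatten n m (\<gamma> t))"

text \<open>
  The cycle of \<open>\<iota>(\<tau>, \<sigma>)\<close> attached to the cycle \<open>c = [i\<^sub>1, \<dots>, i\<^sub>l]\<close> of \<open>\<sigma>\<close> and the cycle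
  \<open>d = [j\<^sub>1, \<dots>, j\<^sub>k]\<close> of \<open>\<tau>\<^sub>i\<^sub>l \<cdots> \<tau>\<^sub>i\<^sub>1\<close>. It consists of one block for each
  \<open>j = j\<^sub>k, j\<^sub>1, \<dots>, j\<^sub>k\<^sub>-\<^sub>1\<close>, namely \<open>(i\<^sub>1, \<tau>\<^sub>i\<^sub>1(j)), (i\<^sub>2, \<tau>\<^sub>i\<^sub>2 \<tau>\<^sub>i\<^sub>1(j)), \<dots>,
  (i\<^sub>l, \<tau>\<^sub>i\<^sub>l \<cdots> \<tau>\<^sub>i\<^sub>1(j))\<close>.
\<close>

definition iota_cycle :: "nat \<Rightarrow> (nat \<Rightarrow> nat \<Rightarrow> nat) \<Rightarrow> nat list \<Rightarrow> nat list \<Rightarrow> nat list" where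
  "iota_cycle n \<tau> c d =
     concat (map
       (\<lambda>j. map (\<lambda>p. pair_index n (c ! p, fold \<tau> (take (Suc p) c) j)) [0..<length c])
       (last d # butlast d))"


section \<open>Commutative squares\<close>

definition commuting_square ::
  "'a set \<Rightarrow> 'b set \<Rightarrow> 'c set \<Rightarrow> 'd set
     \<Rightarrow> ('a \<Rightarrow> 'b) \<Rightarrow> ('b \<Rightarrow> 'd) \<Rightarrow> ('a \<Rightarrow> 'c) \<Rightarrow> ('c \<Rightarrow> 'd) \<Rightarrow> bool" where
  "commuting_square A B C D t r l b \<longleftrightarrow>
     t \<in> A \<rightarrow> B \<and> r \<in> B \<rightarrow> D \<and> l \<in> A \<rightarrow> C \<and> b \<in> C \<rightarrow> D \<and>
     (\<forall>x\<in>A. r (t x) = b (l x))"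

end

theory Submission
  imports Defs
begin

text \<open>
  Let a cycle \<open>c = [i\<^sub>1, \<dots>, i\<^sub>k]\<close> of \<open>\<sigma>\<close> be rotated back by one step to
  \<open>[i\<^sub>k, i\<^sub>1, \<dots>, i\<^sub>k\<^sub>-\<^sub>1]\<close>, which is \<open>rotate_back c\<close>. Then \<open>\<sigma>\<close> sends each entry of the rotated list
  to the entry of \<open>c\<close> in the same position, and the component of \<open>F\<close> at \<open>c\<close> is the concatenation,
  over the positions \<open>p = 0, \<dots>, k - 1\<close>, of the path in position \<open>p\<close> of the rotated list, acted on
  by the product of the group elements at the first \<open>p\<close> entries of \<open>c\<close> (lemma \<open>F_cycle_eq\<close>). The
  first piece, which carries no group element, is no longer exceptional, since the empty product
  acts trivially.

  Now let \<open>c\<close> be a cycle of \<open>\<sigma>\<close> of length \<open>L\<close> and \<open>d\<close> a cycle of \<open>\<tau>\<^sub>i\<^sub>L \<cdots> \<tau>\<^sub>i\<^sub>1\<close>. The composite of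
  the upper and the right map concatenates, for every position \<open>p\<close> in \<open>d\<close>, a component of a path
  that is itself a concatenation of \<open>L\<close> pieces. Taking components and acting by a group element
  commute with concatenation (\<open>path_concat_map\<close>), and concatenation is associative
  (\<open>path_concat_concat\<close>). So both ways around the square give a concatenation of
  \<open>length d * L\<close> pieces of length 1, and it remains to compare the pieces in position \<open>p * L + q\<close>.
  They are paths in the same component of the given loop, by \<open>nth_rotate_back_iota_cycle\<close>, and they
  are acted on by the same group element, by \<open>cycle_prod_take_iota_cycle\<close>: the product over the
  first \<open>p * L + q\<close> entries of the long cycle splits into \<open>p\<close> full blocks, which multiply to the
  product over the first \<open>p\<close> entries of \<open>d\<close>, and the beginning of one more block, which is a
  component of the product over the first \<open>q\<close> entries of \<open>c\<close> in the wreath product. This is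
  \<open>F_cycle_iota_cycle\<close>.

  The first of these two facts also shows that the long lists are cycles of \<open>\<iota>(\<tau>, \<sigma>)\<close>. They form a
  complete system because the pair \<open>(i, j)\<close> determines first \<open>c\<close> and the position of \<open>i\<close> in it, then
  the element \<open>j'\<close> at which the block containing \<open>(i, j)\<close> starts, and finally \<open>d\<close>.

  It must also be shown that the maps end in spaces of piecewise smooth loops. For the upper and the
  right map this follows from one lemma about \<open>F\<close> (\<open>F_cycle_loops\<close>), which holds for any action that
  preserves piecewise smooth paths. A smooth action does so by the chain rule, and then so does the
  wreath product on a power, because a path in a power is piecewise smooth exactly if its components
  are (\<open>piecewise_smooth_path_power\<close>). The same criterion makes the left map a bijection, and
  therefore the bottom map inherits its codomain from the other way around the square.
\<close>

section \<open>Smooth functions on subsets of the line\<close>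

text \<open>
  Products and compositions have no convenient formula for their higher derivatives, but a
  differentiability class of finite order is closed under them by induction on the order.
\<close>

primrec times_differentiable :: "nat \<Rightarrow> real set \<Rightarrow> (real \<Rightarrow> real) \<Rightarrow> bool" where
  "times_differentiable 0 T f = True"
| "times_differentiable (Suc k) T f =
     (\<exists>f'. (\<forall>t\<in>T. (f has_real_derivative f' t) (at t within T)) \<and> times_differentiable k T f')"

lemma has_real_derivative_cong_on:
  assumes "\<And>t. t \<in> T \<Longrightarrow> f t = g t" "t \<in> T"
  shows "(f has_real_derivative d) (at t within T) \<longleftrightarrow> (g has_real_derivative d) (at t within T)"
  by (rule has_field_derivative_cong_eventually) (auto simp: eventually_at_filter assms)

lemma at_within_inter_open:
  assumes "open W" "t \<in> W"
  shows "at t within (T \<inter> W) = at t within T"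
  by (rule at_within_nhd[OF assms(2,1)]) auto

lemma times_differentiable_cong:
  assumes "\<And>t. t \<in> T \<Longrightarrow> f t = g t"
  shows "times_differentiable k T f \<longleftrightarrow> times_differentiable k T g"
  using has_real_derivative_cong_on[OF assms] by (cases k) auto

lemma times_differentiable_SucD: "times_differentiable (Suc k) T f \<Longrightarrow> times_differentiable k T f"
proof (induction k arbitrary: f)
  case (Suc k)
  then show ?case by (metis times_differentiable.simps(2))
qed simp

lemma times_differentiable_const: "times_differentiable k T (\<lambda>_. c)"
proof (induction k arbitrary: c)
  case (Suc k)
  show ?case using Suc[of 0] by (auto intro!: exI[of _ "\<lambda>_. 0"])
qed simp

lemma times_differentiable_add: "times_differentiable k T f \<Longrightarrow> times_differentiable k T g \<Longrightarrow> times_differentiable k T (\<lambda>t. f t + g t)"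
proof (induction k arbitrary: f g)
  case (Suc k)
  then obtain f' g' where
    "\<forall>t\<in>T. (f has_real_derivative f' t) (at t within T)" "times_differentiable k T f'"
    "\<forall>t\<in>T. (g has_real_derivative g' t) (at t within T)" "times_differentiable k T g'" by auto
  then show ?case using Suc.IH[of f' g']
    by (auto intro!: exI[of _ "\<lambda>t. f' t + g' t"] DERIV_add)
qed simp

lemma times_differentiable_sum:
  "finite A \<Longrightarrow> (\<And>i. i \<in> A \<Longrightarrow> times_differentiable k T (f i)) \<Longrightarrow> times_differentiable k T (\<lambda>t. \<Sum>i\<in>A. f i t)"
  by (induction A rule: finite_induct) (auto intro: times_differentiable_const times_differentiable_add)

text \<open>
  The derivative \<open>f' g + g' f\<close> is as often differentiable as the four functions in it, and \<open>f\<close> and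
  \<open>g\<close> themselves are so because they are differentiable once more.
\<close>

lemma times_differentiable_mult: "times_differentiable k T f \<Longrightarrow> times_differentiable k T g \<Longrightarrow> times_differentiable k T (\<lambda>t. f t * g t)"
proof (induction k arbitrary: f g)
  case (Suc k)
  then obtain f' g' where d:
    "\<forall>t\<in>T. (f has_real_derivative f' t) (at t within T)" "times_differentiable k T f'"
    "\<forall>t\<in>T. (g has_real_derivative g' t) (at t within T)" "times_differentiable k T g'" by auto
  have "times_differentiable k T (\<lambda>t. f' t * g t + g' t * f t)"
    using d times_differentiable_SucD[OF Suc.prems(1)] times_differentiable_SucD[OF Suc.prems(2)] by (intro times_differentiable_add Suc.IH)
  moreover have "\<forall>t\<in>T. ((\<lambda>t. f t * g t) has_real_derivative f' t * g t + g' t * f t) (at t within T)"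
    using d(1,3) DERIV_mult by blast
  ultimately show ?case
    unfolding times_differentiable.simps by (intro exI[of _ "\<lambda>t. f' t * g t + g' t * f t"] conjI)
qed simp

definition nth_deriv :: "real set \<Rightarrow> nat \<Rightarrow> (real \<Rightarrow> real) \<Rightarrow> real \<Rightarrow> real" where
  "nth_deriv T r = (\<lambda>h t. SOME d. (h has_real_derivative d) (at t within T)) ^^ r"

lemma nth_deriv_Suc:
  "nth_deriv T (Suc r) f t = (SOME d. (nth_deriv T r f has_real_derivative d) (at t within T))"
  by (simp add: nth_deriv_def)

text \<open>
  At limit points of \<open>T\<close> derivatives within \<open>T\<close> are unique, so any derivative agrees on \<open>T\<close> with the
  chosen one. This makes derivatives chosen on overlapping pieces, or for different orders, fit
  together.
\<close>

lemma times_differentiable_Suc_some: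
  assumes "\<forall>t\<in>T. t islimpt T"
  shows "times_differentiable (Suc k) T f \<longleftrightarrow>
    (\<forall>t\<in>T. (f has_real_derivative nth_deriv T 1 f t) (at t within T)) \<and> times_differentiable k T (nth_deriv T 1 f)"
proof
  assume "times_differentiable (Suc k) T f"
  then obtain f' where f': "\<forall>t\<in>T. (f has_real_derivative f' t) (at t within T)" "times_differentiable k T f'"
    by auto
  have e: "(f has_real_derivative nth_deriv T 1 f t) (at t within T)" if "t \<in> T" for t
    using f' that unfolding nth_deriv_def by (auto intro: someI)
  have "nth_deriv T 1 f t = f' t" if "t \<in> T" for t
    using has_field_derivative_unique[OF e[OF that]] f' that assms
    by (simp add: trivial_limit_within)
  then have "times_differentiable k T (nth_deriv T 1 f)" using f'(2) times_differentiable_cong by metis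
  with e show "(\<forall>t\<in>T. (f has_real_derivative nth_deriv T 1 f t) (at t within T))
      \<and> times_differentiable k T (nth_deriv T 1 f)" by blast
qed auto

lemma smooth_real_on_iff_times_differentiable:
  assumes "\<forall>t\<in>T. t islimpt T"
  shows "smooth_real_on T f \<longleftrightarrow> (\<forall>k. times_differentiable k T f)"
proof
  assume "smooth_real_on T f"
  then obtain D where D: "\<forall>t\<in>T. D 0 t = f t"
    "\<And>r t. t\<in>T \<Longrightarrow> (D r has_real_derivative D (Suc r) t) (at t within T)"
    unfolding smooth_real_on_def by blast
  have "times_differentiable k T (D r)" for k r
  proof (induction k arbitrary: r)
    case (Suc k)
    then show ?case using D(2) by auto
  qed simp
  then show "\<forall>k. times_differentiable k T f" using times_differentiable_cong[of T "D 0" f] D(1) by metis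
next
  assume k: "\<forall>k. times_differentiable k T f"
  have nd: "times_differentiable k T (nth_deriv T r f)" for r k
  proof (induction r arbitrary: k)
    case 0
    then show ?case using k by (simp add: nth_deriv_def)
  next
    case (Suc r)
    have "nth_deriv T (Suc r) f = nth_deriv T 1 (nth_deriv T r f)"
      by (simp add: nth_deriv_def fun_eq_iff)
    with Suc[of "Suc k"] show ?case using times_differentiable_Suc_some[OF assms] by metis
  qed
  have "(nth_deriv T r f has_real_derivative nth_deriv T (Suc r) f t) (at t within T)"
    if "t \<in> T" for r t
    unfolding nth_deriv_Suc using nd[of "Suc 0" r] that by (auto intro: someI)
  then show "smooth_real_on T f" unfolding smooth_real_on_def
    by (intro exI[of _ "\<lambda>r. nth_deriv T r f"]) (simp add: nth_deriv_def)
qed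

text \<open>
  The derivative chosen on all of \<open>T\<close> agrees near each point with a local one, hence is locally
  differentiable as often as needed, and the induction hypothesis applies to it.
\<close>

lemma times_differentiable_local:
  assumes lp: "\<forall>t\<in>T. t islimpt T"
    and loc: "\<And>t. t \<in> T \<Longrightarrow> \<exists>W. open W \<and> t \<in> W \<and> times_differentiable k (T \<inter> W) f"
  shows "times_differentiable k T f"
  using loc
proof (induction k arbitrary: f)
  case (Suc k)
  have *: "\<exists>W f'. open W \<and> t \<in> W \<and> times_differentiable k (T \<inter> W) f' \<and>
       (\<forall>s\<in>T \<inter> W. (f has_real_derivative f' s) (at s within T))" if "t \<in> T" for t
  proof -
    obtain W f' where W: "open W" "t \<in> W" "times_differentiable k (T \<inter> W) f'"
       "\<forall>s\<in>T \<inter> W. (f has_real_derivative f' s) (at s within (T \<inter> W))"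
      using Suc.prems[OF \<open>t \<in> T\<close>] by auto
    then show ?thesis using at_within_inter_open[OF W(1)] by (metis IntD2)
  qed
  have d: "(f has_real_derivative nth_deriv T 1 f t) (at t within T)" if "t \<in> T" for t
    using *[OF that] that unfolding nth_deriv_def by (auto intro: someI)
  have "times_differentiable k T (nth_deriv T 1 f)"
  proof (rule Suc.IH)
    fix t assume "t \<in> T"
    then obtain W f' where W: "open W" "t \<in> W" "times_differentiable k (T \<inter> W) f'"
       "\<forall>s\<in>T \<inter> W. (f has_real_derivative f' s) (at s within T)" using * by blast
    have "nth_deriv T 1 f s = f' s" if "s \<in> T \<inter> W" for s
    proof -
      have "at s within T \<noteq> bot" using lp that by (simp add: trivial_limit_within)
      then show ?thesis using has_field_derivative_unique[OF d[of s]] W(4) that by blast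
    qed
    then have "times_differentiable k (T \<inter> W) (nth_deriv T 1 f)" using W(3) times_differentiable_cong by metis
    with W(1,2) show "\<exists>W. open W \<and> t \<in> W \<and> times_differentiable k (T \<inter> W) (nth_deriv T 1 f)" by blast
  qed
  with d show ?case unfolding times_differentiable.simps by (intro exI[of _ "nth_deriv T 1 f"] conjI ballI)
qed simp

lemma islimpt_inter_open:
  fixes t :: real
  assumes "open W" "t \<in> W" "t islimpt T"
  shows "t islimpt (T \<inter> W)"
proof -
  have "at t within T \<noteq> bot" using assms(3) by (simp add: trivial_limit_within)
  then have "at t within (T \<inter> W) \<noteq> bot" by (simp add: at_within_inter_open[OF assms(1,2)])
  then show ?thesis by (simp add: trivial_limit_within)
qed

lemma smooth_real_on_local:
  assumes lp: "\<forall>t\<in>T. t islimpt T"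
    and loc: "\<And>t. t \<in> T \<Longrightarrow> \<exists>W. open W \<and> t \<in> W \<and> smooth_real_on (T \<inter> W) f"
  shows "smooth_real_on T f"
  unfolding smooth_real_on_iff_times_differentiable[OF lp]
proof (rule allI, rule times_differentiable_local[OF lp])
  fix t k assume "t \<in> T"
  then obtain W where W: "open W" "t \<in> W" "smooth_real_on (T \<inter> W) f" using loc by blast
  then have "times_differentiable k (T \<inter> W) f"
    using smooth_real_on_iff_times_differentiable[of "T \<inter> W" f] lp islimpt_inter_open[OF W(1)] by auto
  with W show "\<exists>W. open W \<and> t \<in> W \<and> times_differentiable k (T \<inter> W) f" by blast
qed

lemma smooth_real_on_subset:
  assumes "smooth_real_on T f" "S \<subseteq> T"
  shows "smooth_real_on S f"
proof -
  obtain D where D: "\<forall>t\<in>T. D 0 t = f t"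
    "\<And>r t. t\<in>T \<Longrightarrow> (D r has_real_derivative D (Suc r) t) (at t within T)"
    using assms(1) unfolding smooth_real_on_def by blast
  have "(D r has_real_derivative D (Suc r) t) (at t within S)" if "t \<in> S" for r t
    using D(2) that assms(2) by (blast intro: DERIV_subset)
  then show ?thesis unfolding smooth_real_on_def using D(1) assms(2) by blast
qed

lemma smooth_real_on_cong:
  "(\<And>t. t \<in> T \<Longrightarrow> f t = g t) \<Longrightarrow> smooth_real_on T f \<longleftrightarrow> smooth_real_on T g"
  unfolding smooth_real_on_def by simp

lemma smooth_real_on_shift:
  assumes "smooth_real_on T f"
  shows "smooth_real_on ((\<lambda>t. t + c) ` T) (\<lambda>t. f (t - c))"
proof -
  obtain D where D: "\<forall>t\<in>T. D 0 t = f t"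
    "\<And>r t. t\<in>T \<Longrightarrow> (D r has_real_derivative D (Suc r) t) (at t within T)"
    using assms unfolding smooth_real_on_def by blast
  have "((\<lambda>t. D r (t - c)) has_real_derivative D (Suc r) (s - c))
          (at s within ((\<lambda>t. t + c) ` T))" if "s \<in> (\<lambda>t. t + c) ` T" for s r
  proof -
    have img: "(\<lambda>t. t - c) ` (\<lambda>t. t + c) ` T = T" by (simp add: image_image)
    have "(D r has_real_derivative D (Suc r) (s - c)) (at (s - c) within (\<lambda>t. t - c) ` (\<lambda>t. t + c) ` T)"
      unfolding img using that D(2) by auto
    moreover have "((\<lambda>t. t - c) has_real_derivative 1) (at s within ((\<lambda>t. t + c) ` T))"
      by (auto intro!: derivative_eq_intros)
    ultimately have "(D r \<circ> (\<lambda>t. t - c) has_real_derivative D (Suc r) (s - c) * 1)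
          (at s within ((\<lambda>t. t + c) ` T))" by (rule DERIV_image_chain)
    then show ?thesis by (simp add: o_def)
  qed
  then show ?thesis unfolding smooth_real_on_def using D(1)
    by (intro exI[of _ "\<lambda>r t. D r (t - c)"]) auto
qed

section \<open>The chain rule for continuous partial derivatives\<close>

lemma openin_Euclidean_space_box:
  assumes "openin (Euclidean_space d) U" "x \<in> U"
  shows "\<exists>\<delta>>0. \<forall>y\<in>topspace (Euclidean_space d). (\<forall>i<d. \<bar>y i - x i\<bar> < \<delta>) \<longrightarrow> y \<in> U"
proof -
  obtain T where T: "openin (powertop_real UNIV) T" "U = T \<inter> {x. \<forall>i\<ge>d. x i = 0}"
    using assms(1) unfolding Euclidean_space_def openin_subtopology by blast
  have "x \<in> T" using T assms(2) by blast
  then have "\<exists>X. (\<forall>i. open (X i)) \<and> x \<in> Pi\<^sub>E UNIV X \<and> Pi\<^sub>E UNIV X \<subseteq> T"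
    using T(1) unfolding openin_product_topology_alt by (metis UNIV_I open_openin)
  then obtain X where X: "\<And>i. open (X i)" "x \<in> Pi\<^sub>E UNIV X" "Pi\<^sub>E UNIV X \<subseteq> T"
    by metis
  have "\<exists>\<delta>>0. \<forall>z. \<bar>z - x i\<bar> < \<delta> \<longrightarrow> z \<in> X i" for i
    using X(1)[of i] X(2) unfolding open_dist dist_real_def by (auto simp: PiE_iff)
  then obtain \<delta> where \<delta>: "\<And>i. \<delta> i > 0" "\<And>i z. \<bar>z - x i\<bar> < \<delta> i \<Longrightarrow> z \<in> X i" by metis
  define e where "e = Min (insert 1 (\<delta> ` {..<d}))"
  have e: "e > 0" "\<And>i. i < d \<Longrightarrow> e \<le> \<delta> i" unfolding e_def using \<delta>(1) by auto
  have "y \<in> U" if y: "y \<in> topspace (Euclidean_space d)" "\<forall>i<d. \<bar>y i - x i\<bar> < e" for y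
  proof -
    have "y i \<in> X i" for i
    proof (cases "i < d")
      case True
      then show ?thesis using \<delta>(2) e(2) y(2) by force
    next
      case False
      then have "y i = x i" using y(1) assms(2) T(2) by (simp add: topspace_Euclidean_space)
      then show ?thesis using X(2) by (auto simp: PiE_iff)
    qed
    then show ?thesis using X(3) T(2) y(1) by (auto simp: topspace_Euclidean_space PiE_iff)
  qed
  with e(1) show ?thesis by blast
qed

lemma continuous_map_Euclidean_box:
  assumes U: "openin (Euclidean_space d) U" "x \<in> U"
    and c: "continuous_map (subtopology (Euclidean_space d) U) euclideanreal P" and "\<epsilon> > 0"
  shows "\<exists>\<delta>>0. \<forall>y\<in>topspace (Euclidean_space d). (\<forall>i<d. \<bar>y i - x i\<bar> < \<delta>) \<longrightarrow>
     y \<in> U \<and> \<bar>P y - P x\<bar> < \<epsilon>"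
proof -
  let ?W = "{y \<in> topspace (subtopology (Euclidean_space d) U). P y \<in> ball (P x) \<epsilon>}"
  have "openin (subtopology (Euclidean_space d) U) ?W"
    using c by (rule openin_continuous_map_preimage) auto
  then have "openin (Euclidean_space d) ?W" using U(1) by (meson openin_trans_full)
  moreover have "x \<in> ?W" using U openin_subset[OF U(1)] assms(4) by auto
  ultimately obtain \<delta> where "\<delta> > 0"
    "\<forall>y\<in>topspace (Euclidean_space d). (\<forall>i<d. \<bar>y i - x i\<bar> < \<delta>) \<longrightarrow> y \<in> ?W"
    using openin_Euclidean_space_box by meson
  then show ?thesis by (auto simp: dist_real_def abs_minus_commute intro!: exI[of _ \<delta>])
qed

lemma mean_value_between:
  fixes h :: "real \<Rightarrow> real"
  assumes "\<And>s. min a b \<le> s \<Longrightarrow> s \<le> max a b \<Longrightarrow> (h has_real_derivative h' s) (at s)" "a \<noteq> b"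
  shows "\<exists>s. min a b \<le> s \<and> s \<le> max a b \<and> h b - h a = h' s * (b - a)"
proof (cases "a < b")
  case True
  then obtain z where "a < z" "z < b" "h b - h a = (b - a) * h' z"
    using MVT2[of a b h h'] assms(1) by force
  then show ?thesis by (intro exI[of _ z]) auto
next
  case False
  then have "b < a" using assms(2) by simp
  then obtain z where "b < z" "z < a" "h a - h b = (a - b) * h' z"
    using MVT2[of b a h h'] assms(1) by force
  then show ?thesis by (intro exI[of _ z]) (auto simp: algebra_simps)
qed

text \<open>
  Changing the coordinates from \<open>x t\<^sub>0\<close> to \<open>x t\<close> one at a time writes the increment of \<open>f\<close> as a sum
  of \<open>d\<close> increments along coordinate lines. By the mean value theorem, the \<open>j\<close>-th one is the
  increment of \<open>x\<^sub>j\<close> times a value of the partial derivative \<open>P j\<close> at a point that tends to \<open>x t\<^sub>0\<close>.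
\<close>

lemma chain_rule_Euclidean_space:
  assumes U: "openin (Euclidean_space d) U"
    and x: "\<And>t. t \<in> T \<Longrightarrow> x t \<in> U" and t0: "t0 \<in> T"
    and dx: "\<And>j. j < d \<Longrightarrow> ((\<lambda>t. x t j) has_real_derivative x' j) (at t0 within T)"
    and df: "\<And>j y. j < d \<Longrightarrow> y \<in> U \<Longrightarrow> ((\<lambda>s. f (y(j := s))) has_real_derivative P j y) (at (y j))"
    and cP: "\<And>j. j < d \<Longrightarrow> continuous_map (subtopology (Euclidean_space d) U) euclideanreal (P j)"
  shows "((\<lambda>t. f (x t)) has_real_derivative (\<Sum>j<d. P j (x t0) * x' j)) (at t0 within T)"
proof -
  define z where "z j t = (\<lambda>i. if i < j then x t i else x t0 i)" for j :: nat and t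
  have top: "x t i = 0" if "t \<in> T" "i \<ge> d" for t i
    using x[OF that(1)] that(2) openin_subset[OF U] by (auto simp: topspace_Euclidean_space)
  have ev: "eventually (\<lambda>t. \<forall>i<d. \<bar>x t i - x t0 i\<bar> < \<delta>) (at t0 within T)" if "\<delta> > 0" for \<delta>
  proof -
    have "eventually (\<lambda>t. \<forall>i\<in>{..<d}. \<bar>x t i - x t0 i\<bar> < \<delta>) (at t0 within T)"
    proof (rule eventually_ball_finite, simp, rule ballI)
      fix i assume "i \<in> {..<d}"
      then have "((\<lambda>t. x t i) \<longlongrightarrow> x t0 i) (at t0 within T)"
        using dx DERIV_continuous continuous_within by blast
      from tendstoD[OF this that]
      show "eventually (\<lambda>t. \<bar>x t i - x t0 i\<bar> < \<delta>) (at t0 within T)"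
        by (simp add: dist_real_def)
    qed
    then show ?thesis by (simp add: Ball_def)
  qed
  have "((\<lambda>t. f (z j t)) has_real_derivative (\<Sum>i<j. P i (x t0) * x' i)) (at t0 within T)"
    if "j \<le> d" for j
    using that
  proof (induction j)
    case 0
    then show ?case by (simp add: z_def)
  next
    case (Suc j)
    then have j: "j < d" by simp
    \<comment> \<open>The value at \<open>x t j = x t0 j\<close> makes \<open>q\<close> tend to \<open>P j (x t0)\<close> without a case distinction.\<close>
    define q where "q t = (if x t j = x t0 j then P j (x t0)
        else (f (z (Suc j) t) - f (z j t)) / (x t j - x t0 j))" for t
    have zupd: "z (Suc j) t = (z j t)(j := x t j)" "z j t = (z j t)(j := x t0 j)" for t
      by (auto simp: z_def fun_eq_iff)
    have qeq: "f (z (Suc j) t) - f (z j t) = q t * (x t j - x t0 j)" for t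
      unfolding q_def using zupd[of t] by (auto simp: divide_simps)
    have "((\<lambda>t. q t) \<longlongrightarrow> P j (x t0)) (at t0 within T)"
    proof (rule tendstoI)
      fix \<epsilon> :: real assume \<epsilon>: "\<epsilon> > 0"
      obtain \<delta> where \<delta>: "\<delta> > 0" "\<And>y. y \<in> topspace (Euclidean_space d) \<Longrightarrow>
         (\<And>i. i < d \<Longrightarrow> \<bar>y i - x t0 i\<bar> < \<delta>) \<Longrightarrow> y \<in> U \<and> \<bar>P j y - P j (x t0)\<bar> < \<epsilon>"
        using continuous_map_Euclidean_box[OF U x[OF t0] cP[OF j] \<epsilon>] by metis
      have "eventually (\<lambda>t. t \<in> T) (at t0 within T)" by (simp add: eventually_at_filter)
      with ev[OF \<delta>(1)] show "eventually (\<lambda>t. dist (q t) (P j (x t0)) < \<epsilon>) (at t0 within T)"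
      proof eventually_elim
        case (elim t)
        show ?case
        proof (cases "x t j = x t0 j")
          case True
          then show ?thesis using \<epsilon> by (simp add: q_def)
        next
          case False
          have box: "(z j t)(j := s) \<in> U \<and> \<bar>P j ((z j t)(j := s)) - P j (x t0)\<bar> < \<epsilon>"
            if "min (x t0 j) (x t j) \<le> s" "s \<le> max (x t0 j) (x t j)" for s
          proof (rule \<delta>(2))
            show "(z j t)(j := s) \<in> topspace (Euclidean_space d)"
              using top elim(2) t0 j by (auto simp: topspace_Euclidean_space z_def)
            fix i assume i: "i < d"
            have "\<bar>s - x t0 j\<bar> \<le> \<bar>x t j - x t0 j\<bar>" using that by linarith
            then show "\<bar>((z j t)(j := s)) i - x t0 i\<bar> < \<delta>"
              using elim(1) i \<delta>(1) j by (auto simp: z_def le_less_trans)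
          qed
          have "((\<lambda>s. f ((z j t)(j := s))) has_real_derivative P j ((z j t)(j := s))) (at s)"
            if "min (x t0 j) (x t j) \<le> s" "s \<le> max (x t0 j) (x t j)" for s
            using df[OF j, of "(z j t)(j := s)"] box[OF that] by simp
          then obtain s where s: "min (x t0 j) (x t j) \<le> s" "s \<le> max (x t0 j) (x t j)"
            "f ((z j t)(j := x t j)) - f ((z j t)(j := x t0 j))
               = P j ((z j t)(j := s)) * (x t j - x t0 j)"
            using mean_value_between[of "x t0 j" "x t j" "\<lambda>s. f ((z j t)(j := s))"
                "\<lambda>s. P j ((z j t)(j := s))"] False by metis
          then have "q t = P j ((z j t)(j := s))"
            using False zupd[of t] by (simp add: q_def)
          then show ?thesis using box[OF s(1,2)] by (simp add: dist_real_def)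
        qed
      qed
    qed
    moreover have "((\<lambda>t. (x t j - x t0 j) / (t - t0)) \<longlongrightarrow> x' j) (at t0 within T)"
      using dx[OF j] by (simp add: has_field_derivative_iff)
    ultimately have "((\<lambda>t. q t * ((x t j - x t0 j) / (t - t0))) \<longlongrightarrow> P j (x t0) * x' j) (at t0 within T)"
      by (rule tendsto_mult)
    moreover have "f (z (Suc j) t0) = f (z j t0)" using qeq[of t0] by simp
    ultimately have "((\<lambda>t. f (z (Suc j) t) - f (z j t)) has_real_derivative P j (x t0) * x' j) (at t0 within T)"
      by (simp add: has_field_derivative_iff qeq)
    from DERIV_add[OF Suc.IH this] Suc.prems show ?case by simp
  qed
  from this[of d] have "((\<lambda>t. f (z d t)) has_real_derivative (\<Sum>j<d. P j (x t0) * x' j)) (at t0 within T)"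
    by simp
  moreover have "z d t = x t" if "t \<in> T" for t
    using top[OF that] top[OF t0] by (auto simp: z_def fun_eq_iff not_less)
  ultimately show ?thesis using has_real_derivative_cong_on[of T "\<lambda>t. f (z d t)" "\<lambda>t. f (x t)"] t0
    by simp
qed

text \<open>
  By the chain rule the derivative is a sum of products of a partial derivative along \<open>x\<close> with a
  coordinate derivative, so the induction has to run over all iterated partial derivatives at once.
\<close>

lemma times_differentiable_smooth_fun_compose:
  assumes sm: "smooth_fun_on d U f" and U: "openin (Euclidean_space d) U"
    and x: "\<And>t. t \<in> T \<Longrightarrow> x t \<in> U"
    and dx: "\<And>j k. j < d \<Longrightarrow> times_differentiable k T (\<lambda>t. x t j)"
  shows "times_differentiable k T (\<lambda>t. f (x t))"
proof -
  obtain D :: "nat list \<Rightarrow> (nat \<Rightarrow> real) \<Rightarrow> real" where D: "\<forall>x\<in>U. D [] x = f x"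
    "\<forall>is. set is \<subseteq> {..<d} \<longrightarrow>
       continuous_map (subtopology (Euclidean_space d) U) euclideanreal (D is) \<and>
       (\<forall>i<d. \<forall>x\<in>U. ((\<lambda>t. D is (x(i := t))) has_real_derivative D (i # is) x) (at (x i)))"
    using sm unfolding smooth_fun_on_def by (elim exE conjE)
  have Dc: "continuous_map (subtopology (Euclidean_space d) U) euclideanreal (D is)"
    if "set is \<subseteq> {..<d}" for "is"
    by (rule D(2)[THEN spec, THEN mp, OF that, THEN conjunct1])
  have Dd: "((\<lambda>t. D is (x(i := t))) has_real_derivative D (i # is) x) (at (x i))"
    if "set is \<subseteq> {..<d}" "i < d" "x \<in> U" for "is" i x
    by (rule D(2)[THEN spec, THEN mp, OF that(1), THEN conjunct2, THEN spec, THEN mp, OF that(2),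
        THEN bspec, OF that(3)])
  have dx': "\<exists>x'. \<forall>j<d. (\<forall>t\<in>T. ((\<lambda>t. x t j) has_real_derivative x' j t) (at t within T)) \<and>
      times_differentiable k T (x' j)" for k
  proof -
    have "\<forall>j. \<exists>x'. j < d \<longrightarrow>
        (\<forall>t\<in>T. ((\<lambda>t. x t j) has_real_derivative x' t) (at t within T)) \<and> times_differentiable k T x'"
    proof
      fix j
      show "\<exists>x'. j < d \<longrightarrow>
          (\<forall>t\<in>T. ((\<lambda>t. x t j) has_real_derivative x' t) (at t within T)) \<and> times_differentiable k T x'"
      proof (cases "j < d")
        case True
        obtain x' where
          "(\<forall>t\<in>T. ((\<lambda>t. x t j) has_real_derivative x' t) (at t within T)) \<and> times_differentiable k T x'"
          using dx[OF True, of "Suc k"] unfolding times_differentiable.simps by (elim exE)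
        then show ?thesis by (intro exI[of _ x'] impI)
      qed simp
    qed
    from choice[OF this] show ?thesis .
  qed
  have "times_differentiable k T (\<lambda>t. D is (x t))" if "set is \<subseteq> {..<d}" for "is"
    using that
  proof (induction k arbitrary: "is")
    case (Suc k)
    obtain x' where x'0: "\<forall>j<d. (\<forall>t\<in>T. ((\<lambda>t. x t j) has_real_derivative x' j t) (at t within T)) \<and>
      times_differentiable k T (x' j)" using dx'[of k] by (elim exE)
    have x': "((\<lambda>t. x t j) has_real_derivative x' j t) (at t within T)" if "j < d" "t \<in> T" for j t
      using x'0[THEN spec[of _ j], THEN mp, OF that(1), THEN conjunct1] that(2) by blast
    have ndx': "times_differentiable k T (x' j)" if "j < d" for j
      using x'0[THEN spec[of _ j], THEN mp, OF that, THEN conjunct2] .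
    have "((\<lambda>t. D is (x t)) has_real_derivative (\<Sum>j<d. D (j # is) (x t) * x' j t)) (at t within T)"
      if "t \<in> T" for t
    proof (rule chain_rule_Euclidean_space[OF U x that])
      show "((\<lambda>t. x t j) has_real_derivative x' j t) (at t within T)" if "j < d" for j
        by (rule x'[OF that \<open>t \<in> T\<close>])
      fix j assume j: "j < d"
      show "((\<lambda>s. D is (y(j := s))) has_real_derivative D (j # is) y) (at (y j))" if "y \<in> U" for y
        by (rule Dd[OF Suc.prems j that])
      have "set (j # is) \<subseteq> {..<d}" using Suc.prems j by simp
      then show "continuous_map (subtopology (Euclidean_space d) U) euclideanreal (D (j # is))"
        by (rule Dc)
    qed
    moreover have "times_differentiable k T (\<lambda>t. D (j # is) (x t) * x' j t)" if "j < d" for j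
    proof (rule times_differentiable_mult[OF Suc.IH ndx'[OF that]])
      show "set (j # is) \<subseteq> {..<d}" using Suc.prems that by simp
    qed
    then have "times_differentiable k T (\<lambda>t. \<Sum>j<d. D (j # is) (x t) * x' j t)"
      by (intro times_differentiable_sum) auto
    ultimately show ?case unfolding times_differentiable.simps
      by (intro exI[of _ "\<lambda>t. \<Sum>j<d. D (j # is) (x t) * x' j t"] conjI ballI)
  qed simp
  from this[of "[]"] have nd: "times_differentiable k T (\<lambda>t. D [] (x t))" by simp
  have eq: "D [] (x t) = f (x t)" if "t \<in> T" for t
    by (rule D(1)[THEN bspec, OF x[OF that]])
  show ?thesis
    by (rule times_differentiable_cong[of T "\<lambda>t. D [] (x t)" "\<lambda>t. f (x t)", OF eq, THEN iffD1, OF _ nd])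
qed

section \<open>Piecewise smooth paths in manifolds and their powers\<close>

text \<open>
  What it takes to cut a path into pieces that lie in charts. Unlike the smoothness of the chart
  changes, this passes to powers by topology alone.
\<close>

definition charts_cover :: "'a manifold \<Rightarrow> bool" where
  "charts_cover M \<longleftrightarrow> topspace (mtop M) = (\<Union>(U, \<phi>)\<in>atlas M. U) \<and>
     (\<forall>(U, \<phi>)\<in>atlas M. openin (mtop M) U)"

lemma charts_cover_openin: "charts_cover M \<Longrightarrow> (U, \<phi>) \<in> atlas M \<Longrightarrow> openin (mtop M) U"
  unfolding charts_cover_def by blast

lemma charts_cover_chart_at:
  assumes "charts_cover M" "x \<in> topspace (mtop M)"
  obtains U \<phi> where "(U, \<phi>) \<in> atlas M" "x \<in> U"
  using assms unfolding charts_cover_def by blast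

lemma charts_cover_charts_at:
  assumes M: "charts_cover M" and x: "\<forall>i\<in>{1..n}. x i \<in> topspace (mtop M)"
  obtains c where "\<forall>i\<in>{1..n}. c i \<in> atlas M \<and> x i \<in> fst (c i)"
proof -
  have "\<forall>i\<in>{1..n}. \<exists>c. c \<in> atlas M \<and> x i \<in> fst c"
  proof
    fix i assume "i \<in> {1..n}"
    then obtain U \<phi> where "(U, \<phi>) \<in> atlas M" "x i \<in> U"
      using charts_cover_chart_at[OF M] x by metis
    then show "\<exists>c. c \<in> atlas M \<and> x i \<in> fst c" by (intro exI[of _ "(U, \<phi>)"]) simp
  qed
  from bchoice[OF this] show thesis using that by blast
qed

lemma smooth_manifold_charts_cover: "smooth_manifold M \<Longrightarrow> charts_cover M"
  unfolding smooth_manifold_def charts_cover_def by blast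

lemma topspace_power_manifold:
  "topspace (mtop (power_manifold n M)) = ({1..n} \<rightarrow>\<^sub>E topspace (mtop M))"
  by (simp add: power_manifold_def)

definition power_chart ::
  "nat \<Rightarrow> nat \<Rightarrow> (nat \<Rightarrow> 'a set \<times> ('a \<Rightarrow> nat \<Rightarrow> real)) \<Rightarrow> (nat \<Rightarrow> 'a) set \<times> ((nat \<Rightarrow> 'a) \<Rightarrow> nat \<Rightarrow> real)" where
  "power_chart n d c = (\<Pi>\<^sub>E i\<in>{1..n}. fst (c i),
     \<lambda>x q. if q < n * d then snd (c (q div d + 1)) (x (q div d + 1)) (q mod d) else 0)"

lemma atlas_power_manifold:
  "atlas (power_manifold n M) = {power_chart n (mdim M) c | c. \<forall>i\<in>{1..n}. c i \<in> atlas M}"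
  by (simp add: power_manifold_def power_chart_def)

lemma charts_cover_power:
  assumes M: "charts_cover M"
  shows "charts_cover (power_manifold n M)"
proof -
  let ?P = "power_manifold n M"
  have op: "openin (mtop ?P) U" if "(U, \<phi>) \<in> atlas ?P" for U \<phi>
  proof -
    obtain c where c: "\<forall>i\<in>{1..n}. c i \<in> atlas M" "U = (\<Pi>\<^sub>E i\<in>{1..n}. fst (c i))"
      using \<open>(U, \<phi>) \<in> atlas ?P\<close> unfolding atlas_power_manifold power_chart_def by blast
    have "openin (mtop M) (fst (c i))" if "i \<in> {1..n}" for i
      using charts_cover_openin[OF M, of "fst (c i)" "snd (c i)"] c(1) that by simp
    then show ?thesis
      unfolding c(2) power_manifold_def by (simp add: openin_PiE)
  qed
  have "\<exists>(U, \<phi>)\<in>atlas ?P. x \<in> U" if "x \<in> topspace (mtop ?P)" for x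
  proof -
    have "\<forall>i\<in>{1..n}. x i \<in> topspace (mtop M)"
      using that by (simp add: topspace_power_manifold PiE_iff)
    then obtain c where c: "\<forall>i\<in>{1..n}. c i \<in> atlas M \<and> x i \<in> fst (c i)"
      by (rule charts_cover_charts_at[OF M])
    then have "power_chart n (mdim M) c \<in> atlas ?P" unfolding atlas_power_manifold by blast
    moreover have "x \<in> fst (power_chart n (mdim M) c)"
      using c that by (auto simp: power_chart_def topspace_power_manifold PiE_iff)
    ultimately show ?thesis by (intro bexI[of _ "power_chart n (mdim M) c"]) (auto simp: case_prod_beta)
  qed
  then have "topspace (mtop ?P) \<subseteq> (\<Union>(U, \<phi>)\<in>atlas ?P. U)" by blast
  moreover have "(\<Union>(U, \<phi>)\<in>atlas ?P. U) \<subseteq> topspace (mtop ?P)"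
    using openin_subset[OF op] by blast
  ultimately show ?thesis unfolding charts_cover_def using op by blast
qed

lemma islimpt_openin_Icc:
  assumes "a < b" "openin (top_of_set {a..b}) T"
  shows "\<forall>t\<in>T. (t::real) islimpt T"
proof
  fix t assume t: "t \<in> T"
  obtain W where W: "open W" "T = {a..b} \<inter> W"
    using assms(2) by (auto simp: openin_open)
  with t have "t islimpt {a..b}" using assms(1) by simp
  with W t show "t islimpt T" using islimpt_inter_open by blast
qed

lemma smooth_curve_on_chart_domain:
  assumes "continuous_map (top_of_set {a..b}) (mtop M) \<gamma>" "openin (mtop M) U"
  shows "openin (top_of_set {a..b}) {t\<in>{a..b}. \<gamma> t \<in> U}"
  using openin_continuous_map_preimage[OF assms] by simp

lemma smooth_curve_on_cong:
  assumes "\<And>t. t \<in> {a..b} \<Longrightarrow> \<gamma> t = \<delta> t"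
  shows "smooth_curve_on M a b \<gamma> \<longleftrightarrow> smooth_curve_on M a b \<delta>"
proof -
  have "smooth_curve_on M a b \<delta>" if "smooth_curve_on M a b \<gamma>" "\<And>t. t \<in> {a..b} \<Longrightarrow> \<gamma> t = \<delta> t"
    for \<gamma> \<delta>
  proof -
    have c: "continuous_map (top_of_set {a..b}) (mtop M) \<delta>"
      using that by (intro continuous_map_eq[of _ _ \<gamma> \<delta>]) (auto simp: smooth_curve_on_def)
    have "smooth_real_on {t\<in>{a..b}. \<delta> t \<in> U} (\<lambda>t. \<phi> (\<delta> t) i)" if "(U, \<phi>) \<in> atlas M" "i < mdim M" for U \<phi> i
    proof -
      have "smooth_real_on {t\<in>{a..b}. \<gamma> t \<in> U} (\<lambda>t. \<phi> (\<gamma> t) i)"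
        using \<open>smooth_curve_on M a b \<gamma>\<close> that unfolding smooth_curve_on_def by blast
      moreover have "{t\<in>{a..b}. \<gamma> t \<in> U} = {t\<in>{a..b}. \<delta> t \<in> U}"
        using \<open>\<And>t. t \<in> {a..b} \<Longrightarrow> \<gamma> t = \<delta> t\<close> by auto
      ultimately show ?thesis using smooth_real_on_cong[of "{t\<in>{a..b}. \<delta> t \<in> U}" "\<lambda>t. \<phi> (\<gamma> t) i" "\<lambda>t. \<phi> (\<delta> t) i"]
          \<open>\<And>t. t \<in> {a..b} \<Longrightarrow> \<gamma> t = \<delta> t\<close> by simp
    qed
    with c show ?thesis unfolding smooth_curve_on_def by blast
  qed
  from this[of \<gamma> \<delta>] this[of \<delta> \<gamma>] assms show ?thesis by auto
qed

text \<open>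
  From left to right, smoothness of a component in a chart has to be checked near each parameter
  only, and there the chart can be completed to a product chart around the point of the curve. From
  right to left, the coordinates in a product chart are coordinates of the components.
\<close>

lemma smooth_curve_on_power:
  assumes M: "charts_cover M" and ab: "a < b"
  shows "smooth_curve_on (power_manifold n M) a b \<gamma> \<longleftrightarrow>
     (\<forall>t\<in>{a..b}. \<gamma> t \<in> extensional {1..n}) \<and> (\<forall>i\<in>{1..n}. smooth_curve_on M a b (\<lambda>t. \<gamma> t i))"
    (is "?L \<longleftrightarrow> ?R")
proof -
  let ?P = "power_manifold n M" and ?d = "mdim M"
  have cont: "continuous_map (top_of_set {a..b}) (mtop ?P) \<gamma> \<longleftrightarrow>
     (\<forall>t\<in>{a..b}. \<gamma> t \<in> extensional {1..n}) \<and>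
     (\<forall>i\<in>{1..n}. continuous_map (top_of_set {a..b}) (mtop M) (\<lambda>t. \<gamma> t i))"
    by (auto simp: power_manifold_def continuous_map_componentwise)
  show ?thesis
  proof
    assume L: ?L
    then have cP: "continuous_map (top_of_set {a..b}) (mtop ?P) \<gamma>" by (simp add: smooth_curve_on_def)
    have c: "\<forall>t\<in>{a..b}. \<gamma> t \<in> extensional {1..n}"
      "\<And>i. i \<in> {1..n} \<Longrightarrow> continuous_map (top_of_set {a..b}) (mtop M) (\<lambda>t. \<gamma> t i)"
      using cont cP by auto
    have "smooth_real_on {t\<in>{a..b}. \<gamma> t i \<in> U} (\<lambda>t. \<phi> (\<gamma> t i) j)"
      if i: "i \<in> {1..n}" and U: "(U, \<phi>) \<in> atlas M" and j: "j < ?d" for i U \<phi> j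
    proof (rule smooth_real_on_local)
      have "openin (top_of_set {a..b}) {t\<in>{a..b}. \<gamma> t i \<in> U}"
        using smooth_curve_on_chart_domain[OF c(2)[OF i] charts_cover_openin[OF M U]] .
      then show "\<forall>t\<in>{t\<in>{a..b}. \<gamma> t i \<in> U}. t islimpt {t\<in>{a..b}. \<gamma> t i \<in> U}"
        using islimpt_openin_Icc[OF ab] by blast
      fix t assume t: "t \<in> {t\<in>{a..b}. \<gamma> t i \<in> U}"
      then have "\<gamma> t \<in> topspace (mtop ?P)" using cP continuous_map_image_subset_topspace by fastforce
      then have "\<forall>k\<in>{1..n}. \<gamma> t k \<in> topspace (mtop M)"
        by (simp add: topspace_power_manifold PiE_iff)
      then obtain c0 where c0: "\<forall>k\<in>{1..n}. c0 k \<in> atlas M \<and> \<gamma> t k \<in> fst (c0 k)"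
        by (rule charts_cover_charts_at[OF M])
      \<comment> \<open>The given chart in position \<open>i\<close>, and any charts around \<open>\<gamma> t k\<close> elsewhere.\<close>
      define ch where "ch = c0(i := (U, \<phi>))"
      have ch: "\<forall>k\<in>{1..n}. ch k \<in> atlas M" "\<forall>k\<in>{1..n}. \<gamma> t k \<in> fst (ch k)" "ch i = (U, \<phi>)"
        using c0 U t by (auto simp: ch_def)
      obtain V \<psi> where V: "power_chart n ?d ch = (V, \<psi>)" by fastforce
      have at: "(V, \<psi>) \<in> atlas ?P" unfolding V[symmetric] atlas_power_manifold using ch(1) by blast
      have Vdef: "V = (\<Pi>\<^sub>E k\<in>{1..n}. fst (ch k))" using V by (simp add: power_chart_def)
      have "openin (top_of_set {a..b}) {t\<in>{a..b}. \<gamma> t \<in> V}"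
        using smooth_curve_on_chart_domain[OF cP charts_cover_openin[OF charts_cover_power[OF M] at]] .
      then obtain W where W: "open W" "{t\<in>{a..b}. \<gamma> t \<in> V} = {a..b} \<inter> W"
        by (auto simp: openin_open)
      \<comment> \<open>The position of the \<open>j\<close>-th coordinate of the \<open>i\<close>-th factor.\<close>
      let ?q = "(i - 1) * ?d + j"
      have q: "?q < n * ?d"
      proof -
        have "?q < (i - 1) * ?d + ?d" using j by simp
        also have "\<dots> = i * ?d" using i by (cases i) auto
        also have "\<dots> \<le> n * ?d" using i by simp
        finally show ?thesis .
      qed
      have "mdim ?P = n * ?d" by (simp add: power_manifold_def)
      then have "smooth_real_on {t\<in>{a..b}. \<gamma> t \<in> V} (\<lambda>t. \<psi> (\<gamma> t) ?q)"
        using L at q unfolding smooth_curve_on_def by fastforce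
      moreover have "\<psi> x ?q = \<phi> (x i) j" for x
      proof -
        have "\<psi> x ?q = snd (ch (?q div ?d + 1)) (x (?q div ?d + 1)) (?q mod ?d)"
          using V q by (auto simp: power_chart_def)
        moreover have "?q div ?d + 1 = i" "?q mod ?d = j" using j i by auto
        ultimately show ?thesis using ch(3) by simp
      qed
      ultimately have "smooth_real_on {t\<in>{a..b}. \<gamma> t \<in> V} (\<lambda>t. \<phi> (\<gamma> t i) j)" by simp
      moreover have "\<gamma> s i \<in> U" if "\<gamma> s \<in> V" for s
        using PiE_mem[OF that[unfolded Vdef] i] ch(3) by simp
      then have "{t\<in>{a..b}. \<gamma> t \<in> V} \<subseteq> {t\<in>{a..b}. \<gamma> t i \<in> U}"
        by blast
      ultimately have "smooth_real_on ({t\<in>{a..b}. \<gamma> t i \<in> U} \<inter> W) (\<lambda>t. \<phi> (\<gamma> t i) j)"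
        by (elim smooth_real_on_subset) (use W(2) in blast)
      moreover have "\<gamma> t \<in> V" using t ch(2) c(1) unfolding Vdef by (simp add: PiE_iff)
      then have "t \<in> W" using W(2) t by blast
      ultimately show "\<exists>W. open W \<and> t \<in> W \<and>
          smooth_real_on ({t\<in>{a..b}. \<gamma> t i \<in> U} \<inter> W) (\<lambda>t. \<phi> (\<gamma> t i) j)"
        using W(1) by blast
    qed
    then show ?R using c unfolding smooth_curve_on_def by blast
  next
    assume R: ?R
    then have "continuous_map (top_of_set {a..b}) (mtop ?P) \<gamma>"
      unfolding cont smooth_curve_on_def by blast
    moreover have "smooth_real_on {t\<in>{a..b}. \<gamma> t \<in> U} (\<lambda>t. \<phi> (\<gamma> t) q)"
      if U: "(U, \<phi>) \<in> atlas ?P" and q: "q < mdim ?P" for U \<phi> q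
    proof -
      obtain c where c: "\<forall>i\<in>{1..n}. c i \<in> atlas M" "power_chart n ?d c = (U, \<phi>)"
        using U unfolding atlas_power_manifold by force
      have q': "q < n * ?d" using q by (simp add: power_manifold_def)
      then have d: "?d > 0" by (cases "?d") auto
      define i where "i = q div ?d + 1"
      have i: "i \<in> {1..n}" using q' d unfolding i_def
        by (simp add: Suc_leI less_mult_imp_div_less)
      have "smooth_curve_on M a b (\<lambda>t. \<gamma> t i)" using R i by blast
      moreover obtain V \<psi> where V: "c i = (V, \<psi>)" by fastforce
      moreover have "q mod ?d < ?d" using d by simp
      ultimately have "smooth_real_on {t\<in>{a..b}. \<gamma> t i \<in> V} (\<lambda>t. \<psi> (\<gamma> t i) (q mod ?d))"
        using c(1) i unfolding smooth_curve_on_def by fastforce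
      moreover have "\<gamma> s i \<in> V" if "\<gamma> s \<in> U" for s
      proof -
        have "\<gamma> s \<in> (\<Pi>\<^sub>E i\<in>{1..n}. fst (c i))" using that c(2) by (simp add: power_chart_def)
        from PiE_mem[OF this i] show ?thesis using V by simp
      qed
      then have "{t\<in>{a..b}. \<gamma> t \<in> U} \<subseteq> {t\<in>{a..b}. \<gamma> t i \<in> V}" by blast
      ultimately have "smooth_real_on {t\<in>{a..b}. \<gamma> t \<in> U} (\<lambda>t. \<psi> (\<gamma> t i) (q mod ?d))"
        by (rule smooth_real_on_subset)
      moreover have "\<phi> x q = \<psi> (x i) (q mod ?d)" for x
        using c(2) q' V by (auto simp: power_chart_def i_def)
      ultimately show ?thesis by simp
    qed
    ultimately show ?L unfolding smooth_curve_on_def by blast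
  qed
qed

lemma piecewise_smooth_path_cong:
  assumes "\<And>t. t \<in> {0..r} \<Longrightarrow> \<gamma> t = \<delta> t"
  shows "piecewise_smooth_path M r \<gamma> \<longleftrightarrow> piecewise_smooth_path M r \<delta>"
proof -
  have "continuous_map (top_of_set {0..r}) (mtop M) \<gamma> \<longleftrightarrow> continuous_map (top_of_set {0..r}) (mtop M) \<delta>"
    using continuous_map_eq[of "top_of_set {0..r}" "mtop M" \<gamma> \<delta>]
      continuous_map_eq[of "top_of_set {0..r}" "mtop M" \<delta> \<gamma>] assms by auto
  moreover have "smooth_curve_on M a b \<gamma> \<longleftrightarrow> smooth_curve_on M a b \<delta>" if "0 \<le> a" "b \<le> r" for a b
    by (rule smooth_curve_on_cong) (use assms that in auto)
  ultimately show ?thesis unfolding piecewise_smooth_path_def by meson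
qed

text \<open>
  The union of the break points of the finitely many components serves for the path in the power.
\<close>

lemma piecewise_smooth_path_power:
  assumes M: "charts_cover M"
  shows "piecewise_smooth_path (power_manifold n M) r \<gamma> \<longleftrightarrow>
     (\<forall>t\<in>{0..r}. \<gamma> t \<in> extensional {1..n}) \<and>
     (\<forall>i\<in>{1..n}. piecewise_smooth_path M r (\<lambda>t. \<gamma> t i))" (is "?L \<longleftrightarrow> ?R")
proof -
  let ?P = "power_manifold n M"
  have cont: "continuous_map (top_of_set {0..r}) (mtop ?P) \<gamma> \<longleftrightarrow>
     (\<forall>t\<in>{0..r}. \<gamma> t \<in> extensional {1..n}) \<and>
     (\<forall>i\<in>{1..n}. continuous_map (top_of_set {0..r}) (mtop M) (\<lambda>t. \<gamma> t i))"
    by (auto simp: power_manifold_def continuous_map_componentwise)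
  show ?thesis
  proof
    assume L: ?L
    then obtain S where S: "finite S" "\<And>a b. 0 \<le> a \<Longrightarrow> a < b \<Longrightarrow> b \<le> r \<Longrightarrow> {a<..<b} \<inter> S = {} \<Longrightarrow> smooth_curve_on ?P a b \<gamma>"
      unfolding piecewise_smooth_path_def by blast
    have "smooth_curve_on M a b (\<lambda>t. \<gamma> t i)"
      if "0 \<le> a" "a < b" "b \<le> r" "{a<..<b} \<inter> S = {}" "i \<in> {1..n}" for a b i
      using S(2)[OF that(1-4)] that(5) unfolding smooth_curve_on_power[OF M that(2)] by blast
    then show ?R using L S(1) cont unfolding piecewise_smooth_path_def by blast
  next
    assume R: ?R
    let ?breaks = "\<lambda>i S. finite S \<and>
        (\<forall>a b. 0 \<le> a \<and> a < b \<and> b \<le> r \<and> {a<..<b} \<inter> S = {} \<longrightarrow> smooth_curve_on M a b (\<lambda>t. \<gamma> t i))"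
    define S where "S i = (SOME S. ?breaks i S)" for i
    have S0: "?breaks i (S i)" if "i \<in> {1..n}" for i
      unfolding S_def by (rule someI_ex) (use R that in \<open>simp add: piecewise_smooth_path_def\<close>)
    then have S: "\<And>i. i \<in> {1..n} \<Longrightarrow> finite (S i)"
      "\<And>i a b. i \<in> {1..n} \<Longrightarrow> 0 \<le> a \<Longrightarrow> a < b \<Longrightarrow> b \<le> r \<Longrightarrow> {a<..<b} \<inter> S i = {} \<Longrightarrow> smooth_curve_on M a b (\<lambda>t. \<gamma> t i)"
      by simp_all
    have "smooth_curve_on ?P a b \<gamma>"
      if "0 \<le> a" "a < b" "b \<le> r" "{a<..<b} \<inter> (\<Union>i\<in>{1..n}. S i) = {}" for a b
      unfolding smooth_curve_on_power[OF M that(2)]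
    proof (intro conjI ballI)
      show "\<gamma> t \<in> extensional {1..n}" if "t \<in> {a..b}" for t
        using that R \<open>0 \<le> a\<close> \<open>b \<le> r\<close> by simp
      show "smooth_curve_on M a b (\<lambda>t. \<gamma> t i)" if "i \<in> {1..n}" for i
        by (rule S(2)[OF that \<open>0 \<le> a\<close> \<open>a < b\<close> \<open>b \<le> r\<close>])
          (use that \<open>{a<..<b} \<inter> (\<Union>i\<in>{1..n}. S i) = {}\<close> in blast)
    qed
    moreover have "finite (\<Union>i\<in>{1..n}. S i)" using S(1) by simp
    ultimately show ?L using R cont unfolding piecewise_smooth_path_def by blast
  qed
qed

lemma piecewise_smooth_path_topspace:
  "piecewise_smooth_path M r \<gamma> \<Longrightarrow> t \<in> {0..r} \<Longrightarrow> \<gamma> t \<in> topspace (mtop M)"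
  unfolding piecewise_smooth_path_def using continuous_map_image_subset_topspace by fastforce

section \<open>Images of paths under smooth maps\<close>

text \<open>
  Near a given parameter the curve stays in one chart of \<open>M\<close>, where the coordinates of the image
  are smooth functions of the coordinates of the curve.
\<close>

lemma smooth_curve_on_compose:
  assumes M: "smooth_manifold M" and N: "charts_cover N" and h: "smooth_map M N h"
    and ab: "a < b" and \<gamma>: "smooth_curve_on M a b \<gamma>"
  shows "smooth_curve_on N a b (\<lambda>t. h (\<gamma> t))"
proof -
  have c\<gamma>: "continuous_map (top_of_set {a..b}) (mtop M) \<gamma>" using \<gamma> by (simp add: smooth_curve_on_def)
  have ch: "continuous_map (mtop M) (mtop N) h" using h by (simp add: smooth_map_def)
  have c: "continuous_map (top_of_set {a..b}) (mtop N) (\<lambda>t. h (\<gamma> t))"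
    using continuous_map_compose[OF c\<gamma> ch] by (simp add: o_def)
  have "smooth_real_on {t\<in>{a..b}. h (\<gamma> t) \<in> V} (\<lambda>t. \<psi> (h (\<gamma> t)) i)"
    if V: "(V, \<psi>) \<in> atlas N" and i: "i < mdim N" for V \<psi> i
  proof (rule smooth_real_on_local)
    let ?T = "{t\<in>{a..b}. h (\<gamma> t) \<in> V}"
    have opT: "openin (top_of_set {a..b}) ?T"
      using smooth_curve_on_chart_domain[OF c charts_cover_openin[OF N V]] .
    then show lpT: "\<forall>t\<in>?T. t islimpt ?T" using islimpt_openin_Icc[OF ab] by blast
    fix t assume t: "t \<in> ?T"
    then have "\<gamma> t \<in> topspace (mtop M)" using c\<gamma> continuous_map_image_subset_topspace by fastforce
    then obtain U \<phi> where U: "(U, \<phi>) \<in> atlas M" "\<gamma> t \<in> U"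
      using charts_cover_chart_at[OF smooth_manifold_charts_cover[OF M]] by metis
    have opU: "openin (mtop M) U" using M U(1) unfolding smooth_manifold_def by blast
    have op\<phi>U: "openin (Euclidean_space (mdim M)) (\<phi> ` U)" using M U(1) unfolding smooth_manifold_def by blast
    have hom: "homeomorphic_map (subtopology (mtop M) U) (subtopology (Euclidean_space (mdim M)) (\<phi> ` U)) \<phi>"
      using M U(1) unfolding smooth_manifold_def by blast
    have topU: "topspace (subtopology (mtop M) U) = U" using opU openin_subset by fastforce
    have inj: "inj_on \<phi> U" using homeomorphic_imp_injective_map[OF hom] topU by simp
    let ?U' = "{x\<in>U. h x \<in> V}"
    have "openin (mtop M) {x\<in>topspace (mtop M). h x \<in> V}"
      using openin_continuous_map_preimage[OF ch charts_cover_openin[OF N V]] .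
    then have "openin (mtop M) (U \<inter> {x\<in>topspace (mtop M). h x \<in> V})" using opU by blast
    moreover have "U \<inter> {x\<in>topspace (mtop M). h x \<in> V} = ?U'" using openin_subset[OF opU] by blast
    ultimately have "openin (mtop M) ?U'" by simp
    then have "openin (subtopology (mtop M) U) ?U'" by (simp add: openin_open_subtopology[OF opU] Collect_conj_eq)
    then have "openin (subtopology (Euclidean_space (mdim M)) (\<phi> ` U)) (\<phi> ` ?U')"
      using homeomorphic_imp_open_map[OF hom] unfolding open_map_def by blast
    then have opI: "openin (Euclidean_space (mdim M)) (\<phi> ` ?U')" using op\<phi>U openin_trans_full by blast
    have sf: "smooth_fun_on (mdim M) (\<phi> ` ?U') (\<lambda>y. \<psi> (h (inv_into U \<phi> y)) i)"
      using h U(1) V i unfolding smooth_map_def by fast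
    have "openin (top_of_set {a..b}) {t\<in>{a..b}. \<gamma> t \<in> U}"
      using smooth_curve_on_chart_domain[OF c\<gamma> opU] .
    then obtain W where W: "open W" "{t\<in>{a..b}. \<gamma> t \<in> U} = {a..b} \<inter> W"
      by (auto simp: openin_open)
    have tW: "t \<in> W" using t U(2) W(2) by blast
    let ?S = "?T \<inter> W"
    have SU: "\<gamma> s \<in> ?U'" if "s \<in> ?S" for s
      using that W(2) by blast
    have lpS: "\<forall>s\<in>?S. s islimpt ?S" using lpT islimpt_inter_open[OF W(1)] by blast
    have co: "smooth_real_on ?S (\<lambda>t. \<phi> (\<gamma> t) j)" if "j < mdim M" for j
    proof (rule smooth_real_on_subset)
      show "smooth_real_on {t\<in>{a..b}. \<gamma> t \<in> U} (\<lambda>t. \<phi> (\<gamma> t) j)"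
        using \<gamma> U(1) that unfolding smooth_curve_on_def by fast
      show "?S \<subseteq> {t\<in>{a..b}. \<gamma> t \<in> U}" using SU by blast
    qed
    have "times_differentiable k ?S (\<lambda>s. \<psi> (h (inv_into U \<phi> (\<phi> (\<gamma> s)))) i)" for k
    proof (rule times_differentiable_smooth_fun_compose[OF sf opI])
      show "\<phi> (\<gamma> s) \<in> \<phi> ` ?U'" if "s \<in> ?S" for s using SU[OF that] by blast
      show "times_differentiable k ?S (\<lambda>t. \<phi> (\<gamma> t) j)" if "j < mdim M" for j k
        using co[OF that] smooth_real_on_iff_times_differentiable[OF lpS] by blast
    qed
    then have "smooth_real_on ?S (\<lambda>s. \<psi> (h (inv_into U \<phi> (\<phi> (\<gamma> s)))) i)"
      using smooth_real_on_iff_times_differentiable[OF lpS] by blast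
    moreover have "inv_into U \<phi> (\<phi> (\<gamma> s)) = \<gamma> s" if "s \<in> ?S" for s
      using inv_into_f_f[OF inj] SU[OF that] by blast
    ultimately have "smooth_real_on ?S (\<lambda>s. \<psi> (h (\<gamma> s)) i)"
      using smooth_real_on_cong[of ?S "\<lambda>s. \<psi> (h (inv_into U \<phi> (\<phi> (\<gamma> s)))) i" "\<lambda>s. \<psi> (h (\<gamma> s)) i"] by simp
    with W(1) tW show "\<exists>W. open W \<and> t \<in> W \<and> smooth_real_on (?T \<inter> W) (\<lambda>t. \<psi> (h (\<gamma> t)) i)"
      by blast
  qed
  with c show ?thesis unfolding smooth_curve_on_def by blast
qed

lemma piecewise_smooth_path_compose:
  assumes M: "smooth_manifold M" and N: "charts_cover N" and h: "smooth_map M N h"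
    and \<gamma>: "piecewise_smooth_path M r \<gamma>"
  shows "piecewise_smooth_path N r (\<lambda>t. h (\<gamma> t))"
proof -
  obtain S where S: "finite S" "\<And>a b. 0 \<le> a \<Longrightarrow> a < b \<Longrightarrow> b \<le> r \<Longrightarrow> {a<..<b} \<inter> S = {} \<Longrightarrow> smooth_curve_on M a b \<gamma>"
    using \<gamma> unfolding piecewise_smooth_path_def by blast
  have "continuous_map (top_of_set {0..r}) (mtop N) (h \<circ> \<gamma>)"
    using \<gamma> h continuous_map_compose unfolding piecewise_smooth_path_def smooth_map_def by blast
  moreover have "smooth_curve_on N a b (\<lambda>t. h (\<gamma> t))"
    if "0 \<le> a" "a < b" "b \<le> r" "{a<..<b} \<inter> S = {}" for a b
    using smooth_curve_on_compose[OF M N h that(2) S(2)[OF that]] .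
  ultimately show ?thesis using S(1) unfolding piecewise_smooth_path_def o_def by blast
qed

section \<open>Joining paths\<close>

lemma smooth_curve_on_shift:
  assumes "smooth_curve_on M a b \<gamma>"
  shows "smooth_curve_on M (a + c) (b + c) (\<lambda>t. \<gamma> (t - c))"
proof -
  have "continuous_map (top_of_set {a + c..b + c}) (top_of_set {a..b}) (\<lambda>t. t - c)"
    by (auto simp: continuous_map_in_subtopology intro!: continuous_intros)
  then have "continuous_map (top_of_set {a + c..b + c}) (mtop M) (\<gamma> \<circ> (\<lambda>t. t - c))"
    using assms continuous_map_compose unfolding smooth_curve_on_def by blast
  moreover have "smooth_real_on {t\<in>{a + c..b + c}. \<gamma> (t - c) \<in> U} (\<lambda>t. \<phi> (\<gamma> (t - c)) i)"
    if "(U, \<phi>) \<in> atlas M" "i < mdim M" for U \<phi> i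
  proof -
    have "smooth_real_on {t\<in>{a..b}. \<gamma> t \<in> U} (\<lambda>t. \<phi> (\<gamma> t) i)"
      using assms that unfolding smooth_curve_on_def by fast
    from smooth_real_on_shift[OF this, of c] show ?thesis
    proof (rule smooth_real_on_subset)
      show "{t\<in>{a + c..b + c}. \<gamma> (t - c) \<in> U} \<subseteq> (\<lambda>t. t + c) ` {t\<in>{a..b}. \<gamma> t \<in> U}"
      proof
        fix t assume "t \<in> {t\<in>{a + c..b + c}. \<gamma> (t - c) \<in> U}"
        then show "t \<in> (\<lambda>t. t + c) ` {t\<in>{a..b}. \<gamma> t \<in> U}"
          by (intro image_eqI[of _ _ "t - c"]) auto
      qed
    qed
  qed
  ultimately show ?thesis unfolding smooth_curve_on_def o_def by blast
qed

text \<open>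
  The point at which the paths meet is added to the break points. An interval without break points
  inside then lies on one side of it.
\<close>

lemma piecewise_smooth_path_join:
  assumes \<gamma>: "piecewise_smooth_path M r \<gamma>" and \<delta>: "piecewise_smooth_path M s \<delta>"
    and rs: "0 \<le> r" "0 \<le> s" and eq: "\<gamma> r = \<delta> 0"
  shows "piecewise_smooth_path M (r + s) (\<lambda>t. if t \<le> r then \<gamma> t else \<delta> (t - r))" (is "piecewise_smooth_path _ _ ?\<eta>")
proof -
  obtain S where S: "finite S" "\<And>a b. 0 \<le> a \<Longrightarrow> a < b \<Longrightarrow> b \<le> r \<Longrightarrow> {a<..<b} \<inter> S = {} \<Longrightarrow> smooth_curve_on M a b \<gamma>"
    using \<gamma> unfolding piecewise_smooth_path_def by blast
  obtain S' where S': "finite S'" "\<And>a b. 0 \<le> a \<Longrightarrow> a < b \<Longrightarrow> b \<le> s \<Longrightarrow> {a<..<b} \<inter> S' = {} \<Longrightarrow> smooth_curve_on M a b \<delta>"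
    using \<delta> unfolding piecewise_smooth_path_def by blast
  have c\<gamma>: "continuous_map (top_of_set {0..r}) (mtop M) \<gamma>" and c\<delta>: "continuous_map (top_of_set {0..s}) (mtop M) \<delta>"
    using \<gamma> \<delta> unfolding piecewise_smooth_path_def by blast+
  have "continuous_map (top_of_set {r..r+s}) (top_of_set {0..s}) (\<lambda>t. t - r)"
    by (auto simp: continuous_map_in_subtopology intro!: continuous_intros)
  then have c\<delta>': "continuous_map (top_of_set {r..r+s}) (mtop M) (\<lambda>t. \<delta> (t - r))"
    using continuous_map_compose[OF _ c\<delta>, unfolded o_def] by blast
  have "continuous_map (top_of_set {0..r+s}) (mtop M) ?\<eta>"
  proof (rule continuous_map_cases_le)
    have "{0..r+s} \<inter> {t \<in> {0..r+s}. t \<le> r} = {0..r}" "{0..r+s} \<inter> {t \<in> {0..r+s}. r \<le> t} = {r..r+s}"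
      using rs by auto
    then show "continuous_map (subtopology (top_of_set {0..r+s}) {t \<in> topspace (top_of_set {0..r+s}). t \<le> r}) (mtop M) \<gamma>"
      "continuous_map (subtopology (top_of_set {0..r+s}) {t \<in> topspace (top_of_set {0..r+s}). r \<le> t}) (mtop M) (\<lambda>t. \<delta> (t - r))"
      using c\<gamma> c\<delta>' by (simp_all add: subtopology_subtopology)
  qed (use eq in auto)
  moreover have "smooth_curve_on M a b ?\<eta>"
    if ab: "0 \<le> a" "a < b" "b \<le> r + s" and disj: "{a<..<b} \<inter> (S \<union> {r} \<union> (\<lambda>t. t + r) ` S') = {}" for a b
  proof (cases "b \<le> r")
    case True
    then have "smooth_curve_on M a b \<gamma>" using S(2) ab disj by auto
    then show ?thesis using smooth_curve_on_cong[of a b \<gamma> ?\<eta>] True by auto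
  next
    case False
    then have ar: "r \<le> a" using disj ab by (force simp: not_le)
    have "{a - r<..<b - r} \<inter> S' = {}"
    proof (rule ccontr)
      assume "{a - r<..<b - r} \<inter> S' \<noteq> {}"
      then obtain x where x: "x \<in> S'" "x \<in> {a - r<..<b - r}" by blast
      then have "x + r \<in> {a<..<b}" by auto
      then show False using disj x(1) by blast
    qed
    then have "smooth_curve_on M (a - r) (b - r) \<delta>" using S'(2) ab ar by simp
    then have shifted: "smooth_curve_on M a b (\<lambda>t. \<delta> (t - r))"
      using smooth_curve_on_shift[of M "a - r" "b - r" \<delta> r] by simp
    have "\<delta> (t - r) = ?\<eta> t" if "t \<in> {a..b}" for t
      using that ar eq by (cases "t = r") auto
    then show ?thesis using smooth_curve_on_cong[of a b "\<lambda>t. \<delta> (t - r)" ?\<eta> M] shifted by blast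
  qed
  moreover have "finite (S \<union> {r} \<union> (\<lambda>t. t + r) ` S')" using S(1) S'(1) by simp
  ultimately show ?thesis unfolding piecewise_smooth_path_def
    by (intro conjI exI[of _ "S \<union> {r} \<union> (\<lambda>t. t + r) ` S'"] allI impI) blast+
qed

section \<open>Cycles\<close>

text \<open>
  The cycle \<open>[i\<^sub>1, \<dots>, i\<^sub>k]\<close> becomes \<open>[i\<^sub>k, i\<^sub>1, \<dots>, i\<^sub>k\<^sub>-\<^sub>1]\<close>, which is the order in which \<open>F\<close> runs
  through the components of a path.
\<close>

abbreviation rotate_back :: "'a list \<Rightarrow> 'a list" where
  "rotate_back c \<equiv> last c # butlast c"

lemma rotate_back_Suc: "Suc p < length c \<Longrightarrow> rotate_back c ! Suc p = c ! p"
  by (simp add: nth_butlast)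

lemma length_rotate_back: "c \<noteq> [] \<Longrightarrow> length (rotate_back c) = length c"
  by simp

lemma set_rotate_back: "c \<noteq> [] \<Longrightarrow> set (rotate_back c) = set c"
  by (cases c rule: rev_cases) auto

lemma distinct_rotate_back: "c \<noteq> [] \<Longrightarrow> distinct (rotate_back c) \<longleftrightarrow> distinct c"
  by (cases c rule: rev_cases) auto

text \<open>
  In this form the cyclic index \<open>p + 1\<close> modulo the length disappears.
\<close>

lemma is_cycle_iff_rotate_back:
  "is_cycle \<sigma> c \<longleftrightarrow> c \<noteq> [] \<and> distinct c \<and> (\<forall>p<length c. \<sigma> (rotate_back c ! p) = c ! p)"
proof (cases "c = []")
  case False
  have "(\<forall>p<length c. \<sigma> (c ! p) = c ! (Suc p mod length c)) \<longleftrightarrow>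
      (\<forall>p<length c. \<sigma> (rotate_back c ! p) = c ! p)" (is "?A \<longleftrightarrow> ?B")
  proof
    assume A: ?A
    show ?B
    proof (intro allI impI)
      fix p assume p: "p < length c"
      show "\<sigma> (rotate_back c ! p) = c ! p"
      proof (cases p)
        case 0
        then show ?thesis using A False by (simp add: last_conv_nth)
      next
        case (Suc p')
        then have "\<sigma> (c ! p') = c ! (Suc p' mod length c)" using A p by simp
        then show ?thesis using p Suc rotate_back_Suc[of p' c] by simp
      qed
    qed
  next
    assume B: ?B
    show ?A
    proof (intro allI impI)
      fix p assume p: "p < length c"
      show "\<sigma> (c ! p) = c ! (Suc p mod length c)"
      proof (cases "Suc p < length c")
        case True
        then show ?thesis using B rotate_back_Suc[of p c] by (metis mod_less)
      next
        case F: False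
        then have "Suc p = length c" using p by simp
        then have "p = length c - 1" "Suc p mod length c = 0" by auto
        then show ?thesis using B[rule_format, of 0] p False by (simp add: last_conv_nth)
      qed
    qed
  qed
  then show ?thesis by (simp add: is_cycle_def)
qed (simp add: is_cycle_def)

lemma cycle_prod_Nil: "cycle_prod G g [] = \<one>\<^bsub>G\<^esub>"
  by (simp add: cycle_prod_def)

lemma cycle_prod_snoc: "cycle_prod G g (c @ [x]) = g x \<otimes>\<^bsub>G\<^esub> cycle_prod G g c"
  by (simp add: cycle_prod_def)

lemma cycle_prod_take_Suc:
  "p < length c \<Longrightarrow> cycle_prod G g (take (Suc p) c) = g (c ! p) \<otimes>\<^bsub>G\<^esub> cycle_prod G g (take p c)"
  by (simp add: take_Suc_conv_app_nth cycle_prod_snoc)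

lemma (in monoid) cycle_prod_append:
  assumes "\<And>i. i \<in> set c \<union> set d \<Longrightarrow> g i \<in> carrier G"
  shows "cycle_prod G g (c @ d) = cycle_prod G g d \<otimes> cycle_prod G g c
    \<and> cycle_prod G g d \<in> carrier G \<and> cycle_prod G g c \<in> carrier G"
proof -
  have cl: "cycle_prod G g c \<in> carrier G" if "\<And>i. i \<in> set c \<Longrightarrow> g i \<in> carrier G" for c
    using that by (induction c rule: rev_induct) (auto simp: cycle_prod_Nil cycle_prod_snoc)
  have c: "cycle_prod G g c \<in> carrier G" using assms by (intro cl) auto
  have "cycle_prod G g (c @ d) = cycle_prod G g d \<otimes> cycle_prod G g c \<and> cycle_prod G g d \<in> carrier G"
    using assms
  proof (induction d rule: rev_induct)
    case Nil
    then show ?case using c by (simp add: cycle_prod_Nil)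
  next
    case (snoc x d)
    then have "cycle_prod G g (c @ d) = cycle_prod G g d \<otimes> cycle_prod G g c"
      "cycle_prod G g d \<in> carrier G" "g x \<in> carrier G" by auto
    moreover have "cycle_prod G g (c @ d @ [x]) = g x \<otimes> cycle_prod G g (c @ d)"
      using cycle_prod_snoc[of G g "c @ d" x] by simp
    ultimately show ?case using c by (simp add: cycle_prod_snoc m_assoc)
  qed
  with c show ?thesis by blast
qed

section \<open>Concatenation of paths\<close>

lemma path_join_assoc:
  "path_join a (b + c) \<gamma> (path_join b c \<delta> \<epsilon>) = path_join (a + b) c (path_join a b \<gamma> \<delta>) \<epsilon>"
  by (auto simp: path_join_def fun_eq_iff restrict_def algebra_simps)

lemma path_concat_append:
  assumes "xs \<noteq> []" "ys \<noteq> []"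
  shows "path_concat l (xs @ ys) =
    path_join (length xs * l) (length ys * l) (path_concat l xs) (path_concat l ys)"
  using assms(1)
proof (induction xs rule: list_nonempty_induct)
  case (single x)
  obtain y ys' where "ys = y # ys'" using assms(2) by (cases ys) auto
  then show ?case by simp
next
  case (cons x xs)
  obtain x' xs' where x': "xs = x' # xs'" using cons(1) by (cases xs) auto
  have "path_concat l ((x # xs) @ ys) = path_join l (length (xs @ ys) * l) x (path_concat l (xs @ ys))"
    using x' by simp
  also have "\<dots> = path_join l (length xs * l + length ys * l) x
      (path_join (length xs * l) (length ys * l) (path_concat l xs) (path_concat l ys))"
    by (simp add: cons.IH algebra_simps)
  also have "\<dots> = path_join (length (x # xs) * l) (length ys * l)
      (path_join l (length xs * l) x (path_concat l xs)) (path_concat l ys)"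
    by (simp add: path_join_assoc)
  also have "path_join l (length xs * l) x (path_concat l xs) = path_concat l (x # xs)"
    using x' by simp
  finally show ?case .
qed

text \<open>
  Associativity of concatenation, for blocks of \<open>k\<close> paths each.
\<close>

lemma path_concat_concat:
  assumes "xss \<noteq> []" "k > 0" "\<And>xs. xs \<in> set xss \<Longrightarrow> length xs = k"
  shows "path_concat (k * l) (map (path_concat l) xss) = path_concat l (concat xss)"
  using assms(1,3)
proof (induction xss rule: list_nonempty_induct)
  case (single xs)
  then show ?case by simp
next
  case (cons xs xss)
  have len: "length (concat xss) = length xss * k"
    using cons.prems by (induction xss) auto
  have "length xs > 0" "length (concat xss) > 0"
    unfolding len using cons.prems[of xs] cons.hyps assms(2) by simp_all
  then have ne: "xs \<noteq> []" "concat xss \<noteq> []" by blast+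
  have "path_concat (k * l) (map (path_concat l) (xs # xss)) =
      path_concat (k * l) ([path_concat l xs] @ map (path_concat l) xss)" by simp
  also have "\<dots> = path_join (k * l) (length xss * (k * l)) (path_concat l xs) (path_concat l (concat xss))"
    using cons by (subst path_concat_append) simp_all
  also have "\<dots> = path_concat l (xs @ concat xss)"
    using cons.prems[of xs] len by (subst path_concat_append[OF ne]) (simp add: mult.assoc)
  finally show ?case by simp
qed

text \<open>
  Applied to the projection to a component, followed by the action of a group element.
\<close>

lemma path_concat_map:
  assumes "xs \<noteq> []"
  shows "(\<lambda>t\<in>{0..real (length xs * l)}. f (path_concat l xs t)) =
    path_concat l (map (\<lambda>x. \<lambda>t\<in>{0..real l}. f (x t)) xs)"
  using assms
proof (induction xs rule: list_nonempty_induct)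
  case (single x)
  then show ?case by simp
next
  case (cons x xs)
  obtain x' xs' where x': "xs = x' # xs'" using cons(1) by (cases xs) auto
  let ?R = "\<lambda>x. \<lambda>t\<in>{0..real l}. f (x t)"
  have "path_concat l (map ?R (x # xs)) = path_join l (length xs * l) (?R x) (path_concat l (map ?R xs))"
    using x' by simp
  also have "\<dots> = path_join l (length xs * l) (?R x) (\<lambda>t\<in>{0..real (length xs * l)}. f (path_concat l xs t))"
    by (simp only: cons.IH)
  also have "\<dots> = (\<lambda>t\<in>{0..real (length (x # xs) * l)}.
      f (path_join l (length xs * l) x (path_concat l xs) t))"
    by (auto simp: path_join_def fun_eq_iff restrict_def)
  also have "path_join l (length xs * l) x (path_concat l xs) = path_concat l (x # xs)"
    using x' by simp
  finally show ?case by simp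
qed

text \<open>
  The end points are part of the induction, since they are what joins the next piece.
\<close>

lemma path_concat_piecewise_smooth:
  assumes "xs \<noteq> []"
    and "\<And>x. x \<in> set xs \<Longrightarrow> x \<in> extensional {0..real l} \<and> piecewise_smooth_path M (real l) x"
    and "\<And>p. Suc p < length xs \<Longrightarrow> (xs ! p) (real l) = (xs ! Suc p) 0"
  shows "path_concat l xs \<in> extensional {0..real (length xs * l)}
    \<and> piecewise_smooth_path M (real (length xs * l)) (path_concat l xs)
    \<and> path_concat l xs 0 = hd xs 0
    \<and> path_concat l xs (real (length xs * l)) = last xs (real l)"
  using assms
proof (induction xs rule: list_nonempty_induct)
  case (single x)
  then show ?case by simp
next
  case (cons x xs)
  obtain x' xs' where x': "xs = x' # xs'" using cons(1) by (cases xs) auto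
  let ?L = "length xs * l" and ?\<delta> = "path_concat l xs"
  have IH: "piecewise_smooth_path M (real ?L) ?\<delta>" "?\<delta> 0 = hd xs 0" "?\<delta> (real ?L) = last xs (real l)"
    using cons.IH cons.prems(1) cons.prems(2)[of "Suc _"] by auto
  have x: "piecewise_smooth_path M (real l) x" using cons.prems(1) by simp
  have j: "x (real l) = ?\<delta> 0" using cons.prems(2)[of 0] x' IH(2) by simp
  have pc: "path_concat l (x # xs) = path_join l ?L x ?\<delta>" using x' by simp
  have len: "length (x # xs) * l = l + ?L" by simp
  have "piecewise_smooth_path M (real l + real ?L) (\<lambda>t. if t \<le> real l then x t else ?\<delta> (t - real l))"
    by (rule piecewise_smooth_path_join[OF x IH(1) _ _ j]) auto
  then have "piecewise_smooth_path M (real (l + ?L)) (path_join l ?L x ?\<delta>)"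
    using piecewise_smooth_path_cong[of "real (l + ?L)"
        "\<lambda>t. if t \<le> real l then x t else ?\<delta> (t - real l)" "path_join l ?L x ?\<delta>" M]
    by (simp add: path_join_def)
  moreover have "path_join l ?L x ?\<delta> (real (l + ?L)) = last xs (real l)"
  \<comment> \<open>For \<open>l = 0\<close> the end of the join is read off \<open>x\<close>, and the pieces meet there.\<close>
  proof (cases "?L = 0")
    case True
    then have "path_join l ?L x ?\<delta> (real (l + ?L)) = x (real l)"
      unfolding path_join_def by (simp only:) simp
    also have "\<dots> = ?\<delta> (real ?L)" unfolding j True by simp
    finally show ?thesis using IH(3) by simp
  next
    case False
    then have "real l < real (l + ?L)" by (simp only: of_nat_less_iff)
    then have "path_join l ?L x ?\<delta> (real (l + ?L)) = ?\<delta> (real ?L)"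
      unfolding path_join_def by simp
    then show ?thesis using IH(3) by simp
  qed
  moreover have "path_join l ?L x ?\<delta> 0 = x 0" by (simp add: path_join_def)
  moreover have "path_join l ?L x ?\<delta> \<in> extensional {0..real (l + ?L)}" by (simp add: path_join_def)
  ultimately show ?case unfolding pc len using cons.hyps by simp
qed

section \<open>Actions that preserve piecewise smooth paths\<close>

text \<open>
  What a right action must satisfy for \<open>F\<close> to map loops to loops. Smoothness of the action enters
  only through its effect on paths, and this condition passes to wreath products component by
  component.
\<close>

locale path_action =
  fixes G :: "('g, 'r) monoid_scheme" and M :: "'a manifold" and act :: "'a \<Rightarrow> 'g \<Rightarrow> 'a"
  assumes one_closed: "\<one>\<^bsub>G\<^esub> \<in> carrier G"
    and mult_closed: "\<lbrakk>g \<in> carrier G; h \<in> carrier G\<rbrakk> \<Longrightarrow> g \<otimes>\<^bsub>G\<^esub> h \<in> carrier G"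
    and act_closed: "\<lbrakk>x \<in> topspace (mtop M); g \<in> carrier G\<rbrakk> \<Longrightarrow> act x g \<in> topspace (mtop M)"
    and act_one: "x \<in> topspace (mtop M) \<Longrightarrow> act x \<one>\<^bsub>G\<^esub> = x"
    and act_act: "\<lbrakk>x \<in> topspace (mtop M); g \<in> carrier G; h \<in> carrier G\<rbrakk>
      \<Longrightarrow> act (act x g) h = act x (g \<otimes>\<^bsub>G\<^esub> h)"
    and act_path: "\<lbrakk>g \<in> carrier G; piecewise_smooth_path M r \<gamma>\<rbrakk>
      \<Longrightarrow> piecewise_smooth_path M r (\<lambda>t. act (\<gamma> t) g)"

lemma path_action_smooth_right_action:
  assumes G: "monoid G" and M: "smooth_manifold M" and act: "smooth_right_action G M act"
  shows "path_action G M act"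
proof
  interpret monoid G by fact
  show "\<one>\<^bsub>G\<^esub> \<in> carrier G" by simp
  show "g \<otimes>\<^bsub>G\<^esub> h \<in> carrier G" if "g \<in> carrier G" "h \<in> carrier G" for g h using that by simp
  show "act x \<one>\<^bsub>G\<^esub> = x" if "x \<in> topspace (mtop M)" for x
    using act that unfolding smooth_right_action_def by blast
  show "act (act x g) h = act x (g \<otimes>\<^bsub>G\<^esub> h)" if "x \<in> topspace (mtop M)" "g \<in> carrier G" "h \<in> carrier G" for x g h
    using act that unfolding smooth_right_action_def by blast
  have sm: "smooth_map M M (\<lambda>x. act x g)" if "g \<in> carrier G" for g
    using act that unfolding smooth_right_action_def by blast
  show "act x g \<in> topspace (mtop M)" if "x \<in> topspace (mtop M)" "g \<in> carrier G" for x g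
    using continuous_map_funspace[OF sm[OF that(2), unfolded smooth_map_def, THEN conjunct1]] that(1)
    by (rule funcset_mem)
  show "piecewise_smooth_path M r (\<lambda>t. act (\<gamma> t) g)"
    if "g \<in> carrier G" "piecewise_smooth_path M r \<gamma>" for g r \<gamma>
    by (rule piecewise_smooth_path_compose[OF M smooth_manifold_charts_cover[OF M] sm[OF that(1)] that(2)])
qed

lemma mem_carrier_wreath:
  "(g, \<sigma>) \<in> carrier (wreath G n) \<longleftrightarrow> g \<in> {1..n} \<rightarrow>\<^sub>E carrier G \<and> \<sigma> permutes {1..n}"
  by (simp add: wreath_def)

lemma mult_wreath: "(g, \<sigma>) \<otimes>\<^bsub>wreath G n\<^esub> (h, \<tau>) =
    (\<lambda>i\<in>{1..n}. g i \<otimes>\<^bsub>G\<^esub> h (inv_into UNIV \<sigma> i), \<sigma> \<circ> \<tau>)"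
  by (simp add: wreath_def)

lemma one_wreath: "\<one>\<^bsub>wreath G n\<^esub> = (\<lambda>i\<in>{1..n}. \<one>\<^bsub>G\<^esub>, id)"
  by (simp add: wreath_def)

lemma wreath_act_apply: "i \<in> {1..n} \<Longrightarrow> wreath_act n act x (g, \<sigma>) i = act (x (\<sigma> i)) (g (\<sigma> i))"
  by (simp add: wreath_act_def)

lemma wreath_act_extensional: "wreath_act n act x h \<in> extensional {1..n}"
  by (simp add: wreath_act_def case_prod_beta)

context path_action
begin

text \<open>
  Component \<open>i\<close> of \<open>x\<close> acted on by \<open>(g, \<sigma>)\<close> is \<open>x (\<sigma> i)\<close> acted on by \<open>g (\<sigma> i)\<close>. The inverse
  permutation in the product of the wreath product cancels against this shift of indices.
\<close>

lemma path_action_wreath: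
  assumes M: "charts_cover M"
  shows "path_action (wreath G m) (power_manifold m M) (wreath_act m act)"
proof
  let ?P = "power_manifold m M"
  show "\<one>\<^bsub>wreath G m\<^esub> \<in> carrier (wreath G m)"
    by (simp add: one_wreath mem_carrier_wreath one_closed permutes_id)
  fix g h :: "(nat \<Rightarrow> 'g) \<times> (nat \<Rightarrow> nat)"
  assume g0: "g \<in> carrier (wreath G m)"
  obtain a \<sigma> where g: "g = (a, \<sigma>)" "a \<in> {1..m} \<rightarrow>\<^sub>E carrier G" "\<sigma> permutes {1..m}"
    using g0 by (cases g) (simp add: mem_carrier_wreath)
  have \<sigma>: "\<sigma> i \<in> {1..m}" if "i \<in> {1..m}" for i using permutes_in_image[OF g(3)] that by blast
  have a: "a i \<in> carrier G" if "i \<in> {1..m}" for i using g(2) that by blast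
  show "wreath_act m act x g \<in> topspace (mtop ?P)" if "x \<in> topspace (mtop ?P)" for x
    using that \<sigma> a unfolding topspace_power_manifold g(1) wreath_act_def
    by (auto intro!: act_closed simp: PiE_iff simp del: atLeastAtMost_iff)
  show "piecewise_smooth_path ?P r (\<lambda>t. wreath_act m act (\<gamma> t) g)" if "piecewise_smooth_path ?P r \<gamma>" for r \<gamma>
    unfolding piecewise_smooth_path_power[OF M]
  proof (intro conjI ballI)
    show "wreath_act m act (\<gamma> t) g \<in> extensional {1..m}" for t by (rule wreath_act_extensional)
    fix i assume i: "i \<in> {1..m}"
    have "piecewise_smooth_path M r (\<lambda>t. \<gamma> t (\<sigma> i))"
      using that \<sigma>[OF i] unfolding piecewise_smooth_path_power[OF M] by blast
    then show "piecewise_smooth_path M r (\<lambda>t. wreath_act m act (\<gamma> t) g i)"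
      unfolding g(1) wreath_act_apply[OF i] by (rule act_path[OF a[OF \<sigma>[OF i]]])
  qed
  assume h0: "h \<in> carrier (wreath G m)"
  obtain b \<tau> where h: "h = (b, \<tau>)" "b \<in> {1..m} \<rightarrow>\<^sub>E carrier G" "\<tau> permutes {1..m}"
    using h0 by (cases h) (simp add: mem_carrier_wreath)
  have \<tau>: "\<tau> i \<in> {1..m}" if "i \<in> {1..m}" for i using permutes_in_image[OF h(3)] that by blast
  have b: "b i \<in> carrier G" if "i \<in> {1..m}" for i using h(2) that by blast
  have \<sigma>i: "inv_into UNIV \<sigma> i \<in> {1..m}" if "i \<in> {1..m}" for i
    using permutes_in_image[OF permutes_inv[OF g(3)]] that by blast
  show "g \<otimes>\<^bsub>wreath G m\<^esub> h \<in> carrier (wreath G m)"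
    unfolding g(1) h(1) mult_wreath mem_carrier_wreath
    using permutes_compose[OF h(3) g(3)] mult_closed[OF a b[OF \<sigma>i]] by (simp del: atLeastAtMost_iff)
  show "wreath_act m act (wreath_act m act x g) h = wreath_act m act x (g \<otimes>\<^bsub>wreath G m\<^esub> h)"
    if "x \<in> topspace (mtop ?P)" for x
  proof (rule extensionalityI[OF wreath_act_extensional wreath_act_extensional])
    fix i assume i: "i \<in> {1..m}"
    let ?k = "\<sigma> (\<tau> i)"
    have k: "?k \<in> {1..m}" using \<sigma>[OF \<tau>[OF i]] .
    have "wreath_act m act (wreath_act m act x g) h i = act (act (x ?k) (a ?k)) (b (\<tau> i))"
      unfolding g(1) h(1) wreath_act_apply[OF i] wreath_act_apply[OF \<tau>[OF i]] ..
    also have "\<dots> = act (x ?k) (a ?k \<otimes>\<^bsub>G\<^esub> b (\<tau> i))"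
      by (rule act_act) (use that k a[OF k] b[OF \<tau>[OF i]] in \<open>auto simp: topspace_power_manifold simp del: atLeastAtMost_iff\<close>)
    also have "b (\<tau> i) = b (inv_into UNIV \<sigma> ?k)" using permutes_inverses(2)[OF g(3)] by simp
    also have "act (x ?k) (a ?k \<otimes>\<^bsub>G\<^esub> b (inv_into UNIV \<sigma> ?k)) =
        wreath_act m act x (g \<otimes>\<^bsub>wreath G m\<^esub> h) i"
      unfolding g(1) h(1) mult_wreath wreath_act_apply[OF i] using k by (simp del: atLeastAtMost_iff)
    finally show "wreath_act m act (wreath_act m act x g) h i = wreath_act m act x (g \<otimes>\<^bsub>wreath G m\<^esub> h) i" .
  qed
next
  fix x assume x: "x \<in> topspace (mtop (power_manifold m M))"
  show "wreath_act m act x \<one>\<^bsub>wreath G m\<^esub> = x"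
  proof (rule extensionalityI[OF wreath_act_extensional])
    show "x \<in> extensional {1..m}" using x by (simp add: topspace_power_manifold PiE_iff)
    show "wreath_act m act x \<one>\<^bsub>wreath G m\<^esub> i = x i" if "i \<in> {1..m}" for i
      unfolding one_wreath wreath_act_apply[OF that]
      using that x act_one by (auto simp: topspace_power_manifold simp del: atLeastAtMost_iff)
  qed
qed

lemma cycle_prod_closed:
  "(\<And>i. i \<in> set c \<Longrightarrow> g i \<in> carrier G) \<Longrightarrow> cycle_prod G g c \<in> carrier G"
  by (induction c rule: rev_induct) (auto simp: cycle_prod_Nil cycle_prod_snoc one_closed mult_closed)

text \<open>
  All pieces of \<open>F\<close> get the same form: the first one is acted on by the empty product.
\<close>

lemma F_cycle_eq:
  assumes c: "c \<noteq> []" and \<gamma>: "\<And>t. t \<in> {0..real l} \<Longrightarrow> \<gamma> t (last c) \<in> topspace (mtop M)"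
  shows "F_cycle G act l g \<gamma> c =
    path_concat l (map (\<lambda>p. path_act l act (\<lambda>t. \<gamma> t (rotate_back c ! p)) (cycle_prod G g (take p c)))
       [0..<length c])"
proof -
  have "(\<lambda>t\<in>{0..real l}. \<gamma> t (last c)) = path_act l act (\<lambda>t. \<gamma> t (last c)) \<one>\<^bsub>G\<^esub>"
    using \<gamma> by (auto simp: path_act_def act_one fun_eq_iff restrict_def)
  moreover have "map (\<lambda>p. path_act l act (\<lambda>t\<in>{0..real l}. \<gamma> t (c ! (p - 1))) (cycle_prod G g (take p c)))
      [1..<length c] =
    map (\<lambda>p. path_act l act (\<lambda>t. \<gamma> t (rotate_back c ! p)) (cycle_prod G g (take p c))) [1..<length c]"
  proof (rule map_cong[OF refl])
    fix p assume "p \<in> set [1..<length c]"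
    then have "rotate_back c ! p = c ! (p - 1)" using rotate_back_Suc[of "p - 1" c] by simp
    then show "path_act l act (\<lambda>t\<in>{0..real l}. \<gamma> t (c ! (p - 1))) (cycle_prod G g (take p c)) =
        path_act l act (\<lambda>t. \<gamma> t (rotate_back c ! p)) (cycle_prod G g (take p c))"
      by (auto simp: path_act_def fun_eq_iff restrict_def)
  qed
  moreover have "[0..<length c] = 0 # [1..<length c]" using c by (simp add: upt_rec)
  ultimately show ?thesis unfolding F_cycle_def Let_def
    by (simp only: list.map take_0 cycle_prod_Nil nth_Cons_0)
qed

lemma mem_loops_power:
  assumes M: "charts_cover M"
  shows "\<gamma> \<in> loops l (power_manifold n M) (wreath_act n act) (g, \<sigma>) \<longleftrightarrow>
     \<gamma> \<in> extensional {0..real l} \<and> (\<forall>t\<in>{0..real l}. \<gamma> t \<in> extensional {1..n}) \<and>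
     (\<forall>i\<in>{1..n}. piecewise_smooth_path M (real l) (\<lambda>t. \<gamma> t i)) \<and>
     (\<forall>i\<in>{1..n}. \<gamma> (real l) i = act (\<gamma> 0 (\<sigma> i)) (g (\<sigma> i)))"
proof -
  have "\<gamma> (real l) = wreath_act n act (\<gamma> 0) (g, \<sigma>) \<longleftrightarrow>
      (\<forall>i\<in>{1..n}. \<gamma> (real l) i = act (\<gamma> 0 (\<sigma> i)) (g (\<sigma> i)))"
    if "\<gamma> (real l) \<in> extensional {1..n}"
  proof
    assume "\<gamma> (real l) = wreath_act n act (\<gamma> 0) (g, \<sigma>)"
    then show "\<forall>i\<in>{1..n}. \<gamma> (real l) i = act (\<gamma> 0 (\<sigma> i)) (g (\<sigma> i))"
      using wreath_act_apply by metis
  next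
    assume *: "\<forall>i\<in>{1..n}. \<gamma> (real l) i = act (\<gamma> 0 (\<sigma> i)) (g (\<sigma> i))"
    show "\<gamma> (real l) = wreath_act n act (\<gamma> 0) (g, \<sigma>)"
    proof (rule extensionalityI[OF that wreath_act_extensional])
      show "\<gamma> (real l) i = wreath_act n act (\<gamma> 0) (g, \<sigma>) i" if "i \<in> {1..n}" for i
        unfolding wreath_act_apply[OF that] using * that by blast
    qed
  qed
  moreover have "\<gamma> (real l) \<in> extensional {1..n}" if "\<forall>t\<in>{0..real l}. \<gamma> t \<in> extensional {1..n}"
    by (rule that[THEN bspec]) simp
  ultimately show ?thesis unfolding loops_def piecewise_smooth_path_power[OF M] mem_Collect_eq Int_iff
    by blast
qed

text \<open>
  The piece in position \<open>p\<close> ends where the next one starts: by the twisting condition on \<open>\<gamma>\<close> its end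
  point is \<open>\<gamma>\<close> at 0, in the component \<open>c ! p\<close>, acted on by one more factor of the cycle product.
  For the last piece this says that the concatenation is twisted by the full cycle product.
\<close>

lemma F_cycle_loops:
  assumes M: "charts_cover M" and g\<sigma>: "(g, \<sigma>) \<in> carrier (wreath G n)"
    and \<gamma>: "\<gamma> \<in> loops l (power_manifold n M) (wreath_act n act) (g, \<sigma>)"
    and c: "is_cycle \<sigma> c" "set c \<subseteq> {1..n}"
  shows "F_cycle G act l g \<gamma> c \<in> loops (length c * l) M act (cycle_prod G g c)"
proof -
  have cne: "c \<noteq> []" and step: "\<And>p. p < length c \<Longrightarrow> \<sigma> (rotate_back c ! p) = c ! p"
    using c(1) unfolding is_cycle_iff_rotate_back by blast+
  have g: "g i \<in> carrier G" if "i \<in> {1..n}" for i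
    using g\<sigma> that by (auto simp: mem_carrier_wreath)
  have ps: "piecewise_smooth_path M (real l) (\<lambda>t. \<gamma> t i)" if "i \<in> {1..n}" for i
    using \<gamma> that unfolding mem_loops_power[OF M] by blast
  have top: "\<gamma> t i \<in> topspace (mtop M)" if "i \<in> {1..n}" "t \<in> {0..real l}" for i t
    using piecewise_smooth_path_topspace[OF ps[OF that(1)] that(2)] .
  have twist: "\<gamma> (real l) i = act (\<gamma> 0 (\<sigma> i)) (g (\<sigma> i))" if "i \<in> {1..n}" for i
    using \<gamma> that unfolding mem_loops_power[OF M] by blast
  have cn: "c ! p \<in> {1..n}" if "p < length c" for p using c(2) that by (meson nth_mem subsetD)
  have rn: "rotate_back c ! p \<in> {1..n}" if "p < length c" for p
    using c(2) that set_rotate_back[OF cne] length_rotate_back[OF cne] nth_mem[of p "rotate_back c"] by auto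
  have cp: "cycle_prod G g (take p c) \<in> carrier G" for p
    using c(2) set_take_subset[of p c] by (intro cycle_prod_closed g) blast
  define P where "P p = path_act l act (\<lambda>t. \<gamma> t (rotate_back c ! p)) (cycle_prod G g (take p c))" for p
  have P_end: "P p (real l) = act (\<gamma> 0 (c ! p)) (cycle_prod G g (take (Suc p) c))" if p: "p < length c" for p
  proof -
    have "P p (real l) = act (\<gamma> (real l) (rotate_back c ! p)) (cycle_prod G g (take p c))"
      by (simp add: P_def path_act_def)
    also have "\<dots> = act (act (\<gamma> 0 (c ! p)) (g (c ! p))) (cycle_prod G g (take p c))"
      by (simp only: twist[OF rn[OF p]] step[OF p])
    also have "\<dots> = act (\<gamma> 0 (c ! p)) (cycle_prod G g (take (Suc p) c))"
      unfolding cycle_prod_take_Suc[OF p] by (rule act_act) (use top cn[OF p] g cp in auto)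
    finally show ?thesis .
  qed
  have P_start: "P p 0 = act (\<gamma> 0 (rotate_back c ! p)) (cycle_prod G g (take p c))" for p
    by (simp add: P_def path_act_def)
  have lastc: "last c \<in> {1..n}" using rn[of 0] cne by simp
  have F: "F_cycle G act l g \<gamma> c = path_concat l (map P [0..<length c])"
    unfolding P_def by (rule F_cycle_eq[where \<gamma> = \<gamma>, OF cne]) (rule top[OF lastc])
  have *: "path_concat l (map P [0..<length c]) \<in> extensional {0..real (length (map P [0..<length c]) * l)}
    \<and> piecewise_smooth_path M (real (length (map P [0..<length c]) * l)) (path_concat l (map P [0..<length c]))
    \<and> path_concat l (map P [0..<length c]) 0 = hd (map P [0..<length c]) 0
    \<and> path_concat l (map P [0..<length c]) (real (length (map P [0..<length c]) * l)) = last (map P [0..<length c]) (real l)"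
  proof (rule path_concat_piecewise_smooth)
    show "map P [0..<length c] \<noteq> []" using cne by simp
    fix x assume "x \<in> set (map P [0..<length c])"
    then obtain p where p: "p < length c" "x = P p" by auto
    have "piecewise_smooth_path M (real l) (\<lambda>t. act (\<gamma> t (rotate_back c ! p)) (cycle_prod G g (take p c)))"
      by (rule act_path[OF cp ps[OF rn[OF p(1)]]])
    then have "piecewise_smooth_path M (real l) x"
      using piecewise_smooth_path_cong[of "real l" x "\<lambda>t. act (\<gamma> t (rotate_back c ! p)) (cycle_prod G g (take p c))" M]
      unfolding p(2) P_def path_act_def by simp
    then show "x \<in> extensional {0..real l} \<and> piecewise_smooth_path M (real l) x"
      unfolding p(2) P_def path_act_def by simp
  next
    fix p assume "Suc p < length (map P [0..<length c])"
    then have p: "Suc p < length c" by simp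
    show "(map P [0..<length c] ! p) (real l) = (map P [0..<length c] ! Suc p) 0"
      using p P_end[of p] P_start[of "Suc p"] rotate_back_Suc[OF p] by simp
  qed
  have "hd (map P [0..<length c]) 0 = \<gamma> 0 (last c)"
    using cne P_start[of 0] act_one[OF top[OF lastc]] by (simp add: hd_map cycle_prod_Nil)
  moreover have "last (map P [0..<length c]) (real l) = act (\<gamma> 0 (last c)) (cycle_prod G g c)"
    using cne P_end[of "length c - 1"] by (simp add: last_map last_conv_nth)
  ultimately show ?thesis unfolding F loops_def using * by simp
qed

end

section \<open>The bijection of pairs with indices\<close>

text \<open>
  The inverse is division with remainder by \<open>n\<close> of \<open>i - 1 + (j - 1)n\<close>.
\<close>

lemma pair_index_bij: "bij_betw (pair_index n) ({1..n} \<times> {1..m}) {1..n * m}"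
proof (rule bij_betwI[where g = "\<lambda>q. ((q - 1) mod n + 1, (q - 1) div n + 1)"])
  show "pair_index n \<in> {1..n} \<times> {1..m} \<rightarrow> {1..n * m}"
  proof
    fix x assume "x \<in> {1..n} \<times> {1..m}"
    then obtain i j where x: "x = (i, j)" "1 \<le> i" "i \<le> n" "1 \<le> j" "j \<le> m" by (cases x) auto
    then obtain j' where j: "j = Suc j'" by (cases j) auto
    have "i + j' * n \<le> Suc j' * n" using x by simp
    also have "\<dots> \<le> m * n" using x j by (intro mult_le_mono1) simp
    finally show "pair_index n x \<in> {1..n * m}" using x j by (simp add: pair_index_def mult.commute)
  qed
  show "(\<lambda>q. ((q - 1) mod n + 1, (q - 1) div n + 1)) \<in> {1..n * m} \<rightarrow> {1..n} \<times> {1..m}"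
  proof
    fix q assume "q \<in> {1..n * m}"
    then have q: "q - 1 < m * n" by (auto simp: mult.commute)
    then have n: "n > 0" by (cases n) auto
    have "(q - 1) div n < m" using q by (rule less_mult_imp_div_less)
    moreover have "(q - 1) mod n < n" using n by simp
    ultimately show "((q - 1) mod n + 1, (q - 1) div n + 1) \<in> {1..n} \<times> {1..m}" by auto
  qed
  show "((pair_index n x - 1) mod n + 1, (pair_index n x - 1) div n + 1) = x"
    if mem: "x \<in> {1..n} \<times> {1..m}" for x
  proof -
    obtain i j where "x = (i, j)" "1 \<le> i" "i \<le> n" "1 \<le> j" using mem by (cases x) auto
    then obtain i' j' where x: "x = (Suc i', Suc j')" "i' < n" by (cases i; cases j) auto
    then have "pair_index n x - 1 = i' + j' * n" by (simp add: pair_index_def)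
    then show ?thesis using x by simp
  qed
  show "pair_index n ((q - 1) mod n + 1, (q - 1) div n + 1) = q" if "q \<in> {1..n * m}" for q
    using that by (simp add: pair_index_def)
qed

lemma pair_index_mem: "i \<in> {1..n} \<Longrightarrow> j \<in> {1..m} \<Longrightarrow> pair_index n (i, j) \<in> {1..n * m}"
  using bij_betwE[OF pair_index_bij[of n m]] by blast

lemma index_pair_pair_index:
  "i \<in> {1..n} \<Longrightarrow> j \<in> {1..m} \<Longrightarrow> index_pair n m (pair_index n (i, j)) = (i, j)"
  unfolding index_pair_def
  by (rule inv_into_f_f[OF bij_betw_imp_inj_on[OF pair_index_bij[of n m]]]) simp

lemma pair_index_eq_iff:
  assumes "i \<in> {1..n}" "j \<in> {1..m}" "i' \<in> {1..n}" "j' \<in> {1..m}"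
  shows "pair_index n (i, j) = pair_index n (i', j') \<longleftrightarrow> i = i' \<and> j = j'"
  using inj_on_eq_iff[OF bij_betw_imp_inj_on[OF pair_index_bij[of n m]], of "(i, j)" "(i', j')"]
    assms by (simp del: atLeastAtMost_iff)

lemma pair_index_cases:
  assumes "q \<in> {1..n * m}"
  obtains i j where "i \<in> {1..n}" "j \<in> {1..m}" "q = pair_index n (i, j)"
proof -
  have "q \<in> pair_index n ` ({1..n} \<times> {1..m})"
    using assms bij_betw_imp_surj_on[OF pair_index_bij[of n m]] by simp
  then show ?thesis using that by blast
qed

lemma ball_pair_index:
  "(\<forall>q\<in>{1..n * m}. P q) \<longleftrightarrow> (\<forall>i\<in>{1..n}. \<forall>j\<in>{1..m}. P (pair_index n (i, j)))"
proof
  assume R: "\<forall>i\<in>{1..n}. \<forall>j\<in>{1..m}. P (pair_index n (i, j))"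
  show "\<forall>q\<in>{1..n * m}. P q"
  proof
    fix q assume "q \<in> {1..n * m}"
    then obtain i j where "i \<in> {1..n}" "j \<in> {1..m}" "q = pair_index n (i, j)"
      by (rule pair_index_cases)
    then show "P q" using R by blast
  qed
qed (use pair_index_mem[of _ n _ m] in blast)

lemma flatten_pair_index:
  "i \<in> {1..n} \<Longrightarrow> j \<in> {1..m} \<Longrightarrow> flatten n m x (pair_index n (i, j)) = x i j"
  unfolding flatten_def restrict_apply using pair_index_mem[of i n j m]
  by (simp only: if_True index_pair_pair_index prod.case)

lemma iota_pair_index:
  "i \<in> {1..n} \<Longrightarrow> j \<in> {1..m} \<Longrightarrow>
    iota n m \<tau> \<sigma> (pair_index n (i, j)) = pair_index n (\<sigma> i, \<tau> (\<sigma> i) j)"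
  unfolding iota_def using pair_index_mem[of i n j m]
  by (simp only: if_True index_pair_pair_index prod.case)

lemma iota_permutes:
  assumes \<sigma>: "\<sigma> permutes {1..n}" and \<tau>: "\<And>i. i \<in> {1..n} \<Longrightarrow> \<tau> i permutes {1..m}"
  shows "iota n m \<tau> \<sigma> permutes {1..n * m}"
proof (rule bij_imp_permutes)
  have \<sigma>m: "\<sigma> i \<in> {1..n}" if "i \<in> {1..n}" for i using permutes_in_image[OF \<sigma>] that by blast
  have \<tau>m: "\<tau> i j \<in> {1..m}" if "i \<in> {1..n}" "j \<in> {1..m}" for i j
    using permutes_in_image[OF \<tau>] that by blast
  have "iota n m \<tau> \<sigma> ` {1..n * m} \<subseteq> {1..n * m}"
  proof (rule image_subsetI)
    fix q assume "q \<in> {1..n * m}"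
    then obtain i j where q: "i \<in> {1..n}" "j \<in> {1..m}" "q = pair_index n (i, j)"
      by (rule pair_index_cases)
    then show "iota n m \<tau> \<sigma> q \<in> {1..n * m}"
      unfolding q(3) iota_pair_index[OF q(1,2)] by (intro pair_index_mem \<sigma>m \<tau>m)
  qed
  moreover have "inj_on (iota n m \<tau> \<sigma>) {1..n * m}"
  proof (rule inj_onI)
    fix q q' assume "q \<in> {1..n * m}" "q' \<in> {1..n * m}" and eq: "iota n m \<tau> \<sigma> q = iota n m \<tau> \<sigma> q'"
    then obtain i j i' j' where q: "i \<in> {1..n}" "j \<in> {1..m}" "q = pair_index n (i, j)"
      and q': "i' \<in> {1..n}" "j' \<in> {1..m}" "q' = pair_index n (i', j')" by (metis pair_index_cases)
    have "\<sigma> i = \<sigma> i' \<and> \<tau> (\<sigma> i) j = \<tau> (\<sigma> i') j'"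
      using eq pair_index_eq_iff[OF \<sigma>m[OF q(1)] \<tau>m[OF \<sigma>m[OF q(1)] q(2)] \<sigma>m[OF q'(1)] \<tau>m[OF \<sigma>m[OF q'(1)] q'(2)]]
      unfolding q(3) q'(3) iota_pair_index[OF q(1,2)] iota_pair_index[OF q'(1,2)] by blast
    then have "i = i'" "j = j'"
      using permutes_inj[OF \<sigma>] permutes_inj[OF \<tau>[OF \<sigma>m[OF q'(1)]]] by (auto dest: injD)
    then show "q = q'" using q q' by simp
  qed
  ultimately show "bij_betw (iota n m \<tau> \<sigma>) {1..n * m} {1..n * m}"
    by (simp add: bij_betw_def endo_inj_surj)
  show "iota n m \<tau> \<sigma> q = q" if "q \<notin> {1..n * m}" for q
    using that unfolding iota_def by (simp only: if_False)
qed

section \<open>Lists made of blocks of equal length\<close>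

lemma length_concat_blocks:
  "(\<And>b. b \<in> set bs \<Longrightarrow> length b = L) \<Longrightarrow> length (concat bs) = length bs * L"
  by (induction bs) auto

lemma take_concat_blocks:
  assumes "\<And>b. b \<in> set bs \<Longrightarrow> length b = L" "p < length bs" "q \<le> L"
  shows "take (p * L + q) (concat bs) = concat (take p bs) @ take q (bs ! p)"
  using assms
proof (induction bs arbitrary: p)
  case (Cons b bs)
  show ?case
  proof (cases p)
    case 0
    then show ?thesis using Cons.prems by simp
  next
    case (Suc p')
    have "take (p' * L + q) (concat bs) = concat (take p' bs) @ take q (bs ! p')"
      using Cons.prems Suc by (intro Cons.IH) auto
    then show ?thesis using Cons.prems(1)[of b] Suc by (simp add: add.assoc)
  qed
qed simp

lemma nth_concat_blocks:
  assumes "\<And>b. b \<in> set bs \<Longrightarrow> length b = L" "p < length bs" "q < L"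
  shows "concat bs ! (p * L + q) = bs ! p ! q"
  using assms
proof (induction bs arbitrary: p)
  case (Cons b bs)
  show ?case
  proof (cases p)
    case 0
    then show ?thesis using Cons.prems by (simp add: nth_append)
  next
    case (Suc p')
    have "concat bs ! (p' * L + q) = bs ! p' ! q"
      using Cons.prems Suc by (intro Cons.IH) auto
    then show ?thesis using Cons.prems(1)[of b] Suc by (simp add: nth_append add.assoc)
  qed
qed simp

lemma block_index:
  fixes k L r :: nat
  assumes "r < k * L"
  obtains p q where "p < k" "q < L" "r = p * L + q"
proof (rule that)
  show "r div L < k" using assms by (rule less_mult_imp_div_less)
  show "r mod L < L" using assms by (cases L) auto
  show "r = r div L * L + r mod L" using div_mult_mod_eq[of r L] by (rule sym)
qed

text \<open>
  A double list is recognized as a single one by comparing the entries in position \<open>p * L + q\<close>.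
\<close>

lemma concat_map_upt_blocks:
  assumes "\<And>p q. p < k \<Longrightarrow> q < L \<Longrightarrow> f p q = h (p * L + q)"
  shows "concat (map (\<lambda>p. map (f p) [0..<L]) [0..<k]) = map h [0..<k * L]"
  using assms
proof (induction k)
  case (Suc k)
  have "map h [0..<Suc k * L] = map h [0..<k * L] @ map h [k * L..<k * L + L]"
    using upt_add_eq_append[of 0 "k * L" L] by (simp add: add.commute)
  also have "map h [k * L..<k * L + L] = map (\<lambda>q. h (k * L + q)) [0..<L]"
    by (rule nth_equalityI) simp_all
  also have "\<dots> = map (f k) [0..<L]" using Suc.prems by simp
  finally show ?case using Suc by simp
qed simp

section \<open>Cycles of the iterated wreath product\<close>

lemma fold_permutes:
  "(\<And>i. i \<in> set c \<Longrightarrow> \<tau> i permutes S) \<Longrightarrow> fold \<tau> c permutes S"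
proof (induction c rule: rev_induct)
  case (snoc x c)
  have "fold \<tau> (c @ [x]) = \<tau> x \<circ> fold \<tau> c" by (simp add: fun_eq_iff)
  moreover have "fold \<tau> c permutes S" "\<tau> x permutes S" using snoc by auto
  ultimately show ?case by (simp only: permutes_compose)
qed (simp add: permutes_id id_def[symmetric])

text \<open>
  The part of the long cycle that starts from \<open>j\<close> and passes once through \<open>c\<close>.
\<close>

definition iota_block :: "nat \<Rightarrow> (nat \<Rightarrow> nat \<Rightarrow> nat) \<Rightarrow> nat list \<Rightarrow> nat \<Rightarrow> nat list" where
  "iota_block n \<tau> c j = map (\<lambda>p. pair_index n (c ! p, fold \<tau> (take (Suc p) c) j)) [0..<length c]"

lemma iota_cycle_blocks: "iota_cycle n \<tau> c d = concat (map (iota_block n \<tau> c) (rotate_back d))"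
  unfolding iota_cycle_def iota_block_def ..

lemma length_iota_block: "length (iota_block n \<tau> c j) = length c"
  by (simp add: iota_block_def)

lemma length_iota_cycle: "d \<noteq> [] \<Longrightarrow> length (iota_cycle n \<tau> c d) = length d * length c"
  unfolding iota_cycle_blocks
  by (subst length_concat_blocks[of _ "length c"]) (auto simp: length_iota_block)

lemma nth_iota_cycle:
  assumes "p < length d" "q < length c"
  shows "iota_cycle n \<tau> c d ! (p * length c + q) =
    pair_index n (c ! q, fold \<tau> (take (Suc q) c) (rotate_back d ! p))"
proof -
  have d: "d \<noteq> []" using assms by auto
  then have p: "p < length (rotate_back d)" using assms by simp
  have "iota_cycle n \<tau> c d ! (p * length c + q) = map (iota_block n \<tau> c) (rotate_back d) ! p ! q"
    unfolding iota_cycle_blocks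
    by (rule nth_concat_blocks) (use p assms in \<open>auto simp: length_iota_block\<close>)
  also have "\<dots> = iota_block n \<tau> c (rotate_back d ! p) ! q" using p by (subst nth_map) auto
  also have "\<dots> = pair_index n (c ! q, fold \<tau> (take (Suc q) c) (rotate_back d ! p))"
    using assms(2) by (simp add: iota_block_def)
  finally show ?thesis .
qed

lemma set_iota_cycle:
  assumes "d \<noteq> []"
  shows "set (iota_cycle n \<tau> c d) =
    {pair_index n (c ! q, fold \<tau> (take (Suc q) c) j) | q j. q < length c \<and> j \<in> set d}"
proof -
  have "set (iota_cycle n \<tau> c d) = (\<Union>j\<in>set (rotate_back d). set (iota_block n \<tau> c j))"
    unfolding iota_cycle_blocks by simp
  also have "\<dots> = (\<Union>j\<in>set d. set (iota_block n \<tau> c j))" using set_rotate_back[OF assms] by simp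
  also have "\<dots> = {pair_index n (c ! q, fold \<tau> (take (Suc q) c) j) | q j. q < length c \<and> j \<in> set d}"
    unfolding iota_block_def set_map set_upt atLeast0LessThan by blast
  finally show ?thesis .
qed

text \<open>
  Rotating the long cycle back rotates \<open>c\<close> back within a block, except at the beginning of a block,
  where the preceding entry is the last one of the preceding block. That block starts from the
  preceding entry of \<open>rotate_back d\<close>, and one passage through \<open>c\<close> takes it to the required one,
  since \<open>d\<close> is a cycle of \<open>fold \<tau> c\<close>.
\<close>

lemma nth_rotate_back_iota_cycle:
  assumes c: "c \<noteq> []" and d: "is_cycle (fold \<tau> c) d" and pq: "p < length d" "q < length c"
  shows "rotate_back (iota_cycle n \<tau> c d) ! (p * length c + q) =
    pair_index n (rotate_back c ! q, fold \<tau> (take q c) (rotate_back d ! p))"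
proof -
  let ?e = "iota_cycle n \<tau> c d" and ?L = "length c"
  have dne: "d \<noteq> []" and step: "\<And>p. p < length d \<Longrightarrow> fold \<tau> c (rotate_back d ! p) = d ! p"
    using d unfolding is_cycle_iff_rotate_back by blast+
  have len: "length ?e = length d * ?L" using dne by (rule length_iota_cycle)
  have L: "Suc (?L - 1) = ?L" "?L - 1 < ?L" using c by (cases c, auto)+
  have block_end: "?e ! (p' * ?L + (?L - 1)) = pair_index n (last c, d ! p')" if "p' < length d" for p'
  proof -
    have "?e ! (p' * ?L + (?L - 1)) = pair_index n (c ! (?L - 1), fold \<tau> (take ?L c) (rotate_back d ! p'))"
      using nth_iota_cycle[OF that L(2), of n \<tau>] unfolding L(1) .
    then show ?thesis using step[OF that] c by (simp add: last_conv_nth)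
  qed
  show ?thesis
  proof (cases q)
    case (Suc q')
    have "p * ?L + q < length ?e"
    proof -
      have "p * ?L + q < Suc p * ?L" using pq by simp
      also have "\<dots> \<le> length d * ?L" using pq by (intro mult_le_mono1) simp
      finally show ?thesis unfolding len .
    qed
    then have "rotate_back ?e ! (p * ?L + q) = ?e ! (p * ?L + q')"
      using rotate_back_Suc[of "p * ?L + q'" ?e] Suc by simp
    also have "\<dots> = pair_index n (c ! q', fold \<tau> (take (Suc q') c) (rotate_back d ! p))"
      by (rule nth_iota_cycle) (use pq Suc in auto)
    finally show ?thesis using Suc rotate_back_Suc[of q' c] pq by simp
  next
    case 0
    show ?thesis
    proof (cases p)
      case (Suc p')
      have p': "Suc p' < length d" using Suc pq by simp
      have e: "Suc (p' * ?L + (?L - 1)) = p * ?L + q" using L(1) Suc 0 by simp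
      have "p * ?L < length d * ?L" using pq c by simp
      then have "Suc (p' * ?L + (?L - 1)) < length ?e" unfolding e len using 0 by simp
      then have "rotate_back ?e ! (p * ?L + q) = ?e ! (p' * ?L + (?L - 1))"
        using rotate_back_Suc[of "p' * ?L + (?L - 1)" ?e] unfolding e by (simp only:)
      also have "\<dots> = pair_index n (last c, d ! p')" by (rule block_end) (use p' in simp)
      also have "d ! p' = rotate_back d ! p" using rotate_back_Suc[OF p'] Suc by simp
      finally show ?thesis using 0 by simp
    next
      case p: 0
      have "length ?e - 1 = (length d - 1) * ?L + (?L - 1)"
        unfolding len using dne L(1) by (cases d) (auto simp: algebra_simps)
      moreover have "?e \<noteq> []" using len dne c by fastforce
      ultimately have "last ?e = ?e ! ((length d - 1) * ?L + (?L - 1))" by (simp add: last_conv_nth)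
      also have "\<dots> = pair_index n (last c, d ! (length d - 1))" by (rule block_end) (use dne in auto)
      finally show ?thesis using 0 p dne by (simp add: last_conv_nth)
    qed
  qed
qed

locale nested_permutation =
  fixes n m :: nat and \<tau> :: "nat \<Rightarrow> nat \<Rightarrow> nat" and \<sigma> :: "nat \<Rightarrow> nat"
  assumes \<sigma>: "\<sigma> permutes {1..n}" and \<tau>: "\<And>i. i \<in> {1..n} \<Longrightarrow> \<tau> i permutes {1..m}"
begin

lemma fold_take_permutes: "set c \<subseteq> {1..n} \<Longrightarrow> fold \<tau> (take q c) permutes {1..m}"
  by (rule fold_permutes) (use set_take_subset[of q c] \<tau> in blast)

lemma fold_permutes': "set c \<subseteq> {1..n} \<Longrightarrow> fold \<tau> c permutes {1..m}"
  by (rule fold_permutes) (use \<tau> in blast)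

lemma fold_take_mem:
  assumes "set c \<subseteq> {1..n}" "j \<in> {1..m}"
  shows "fold \<tau> (take q c) j \<in> {1..m}"
  using permutes_in_image[OF fold_take_permutes[OF assms(1)]] assms(2) by blast

lemma pair_index_in_iota_cycle:
  assumes c: "set c \<subseteq> {1..n}" and d: "d \<noteq> []" "set d \<subseteq> {1..m}" and ij: "i \<in> {1..n}" "j \<in> {1..m}"
  shows "pair_index n (i, j) \<in> set (iota_cycle n \<tau> c d) \<longleftrightarrow>
    (\<exists>q j'. q < length c \<and> j' \<in> set d \<and> i = c ! q \<and> j = fold \<tau> (take (Suc q) c) j')"
proof -
  have "pair_index n (i, j) = pair_index n (c ! q, fold \<tau> (take (Suc q) c) j') \<longleftrightarrow>
      i = c ! q \<and> j = fold \<tau> (take (Suc q) c) j'" if "q < length c" "j' \<in> set d" for q j'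
    by (rule pair_index_eq_iff[OF ij])
      (use c d(2) that nth_mem fold_take_mem[OF c] in blast)+
  then show ?thesis unfolding set_iota_cycle[OF d(1)] by blast
qed

lemma set_iota_cycle_subset:
  assumes "set c \<subseteq> {1..n}" "d \<noteq> []" "set d \<subseteq> {1..m}"
  shows "set (iota_cycle n \<tau> c d) \<subseteq> {1..n * m}"
proof
  fix x assume "x \<in> set (iota_cycle n \<tau> c d)"
  then obtain q j where x: "x = pair_index n (c ! q, fold \<tau> (take (Suc q) c) j)" "q < length c" "j \<in> set d"
    unfolding set_iota_cycle[OF assms(2)] by blast
  have "c ! q \<in> {1..n}" using assms(1) x(2) nth_mem by blast
  moreover have "fold \<tau> (take (Suc q) c) j \<in> {1..m}"
    using fold_take_mem[OF assms(1)] assms(3) x(3) by blast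
  ultimately show "x \<in> {1..n * m}" unfolding x(1) by (rule pair_index_mem)
qed

text \<open>
  Applying \<open>\<iota>(\<tau>, \<sigma>)\<close> to an entry of the rotated list moves \<open>rotate_back c ! q\<close> to \<open>c ! q\<close> and
  prolongs the product of the \<open>\<tau>\<^sub>i\<close> by one factor, so it gives the entry of the long cycle in the same
  position. Entries are distinct because \<open>c ! q\<close> determines \<open>q\<close> and, for fixed \<open>q\<close>, the second
  component determines the start of the block.
\<close>

lemma is_cycle_iota_cycle:
  assumes c: "is_cycle \<sigma> c" "set c \<subseteq> {1..n}" and d: "is_cycle (fold \<tau> c) d" "set d \<subseteq> {1..m}"
  shows "is_cycle (iota n m \<tau> \<sigma>) (iota_cycle n \<tau> c d)"
  unfolding is_cycle_iff_rotate_back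
proof (intro conjI allI impI)
  let ?e = "iota_cycle n \<tau> c d" and ?L = "length c"
  have c': "c \<noteq> []" "distinct c" "\<And>p. p < ?L \<Longrightarrow> \<sigma> (rotate_back c ! p) = c ! p"
    using c(1) unfolding is_cycle_iff_rotate_back by blast+
  have d': "d \<noteq> []" "distinct d" using d(1) unfolding is_cycle_def by blast+
  have len: "length ?e = length d * ?L" using d'(1) by (rule length_iota_cycle)
  then show "?e \<noteq> []" using c' d' by fastforce
  have rd: "rotate_back d ! p \<in> {1..m}" if "p < length d" for p
    using d(2) set_rotate_back[OF d'(1)] nth_mem[of p "rotate_back d"] that d'(1) by auto
  have rc: "rotate_back c ! q \<in> {1..n}" if "q < ?L" for q
    using c(2) set_rotate_back[OF c'(1)] nth_mem[of q "rotate_back c"] that c'(1) by auto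
  show "iota n m \<tau> \<sigma> (rotate_back ?e ! r) = ?e ! r" if "r < length ?e" for r
  proof -
    obtain p q where r: "p < length d" "q < ?L" "r = p * ?L + q"
      using block_index[of r "length d" ?L] \<open>r < length ?e\<close> unfolding len by blast
    have "iota n m \<tau> \<sigma> (rotate_back ?e ! r) =
       iota n m \<tau> \<sigma> (pair_index n (rotate_back c ! q, fold \<tau> (take q c) (rotate_back d ! p)))"
      unfolding r(3) nth_rotate_back_iota_cycle[OF c'(1) d(1) r(1,2)] ..
    also have "\<dots> = pair_index n (c ! q, \<tau> (c ! q) (fold \<tau> (take q c) (rotate_back d ! p)))"
      unfolding iota_pair_index[OF rc[OF r(2)] fold_take_mem[OF c(2) rd[OF r(1)]]] c'(3)[OF r(2)] ..
    also have "\<tau> (c ! q) (fold \<tau> (take q c) (rotate_back d ! p)) = fold \<tau> (take (Suc q) c) (rotate_back d ! p)"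
      using r(2) by (simp add: take_Suc_conv_app_nth)
    finally show ?thesis unfolding r(3) nth_iota_cycle[OF r(1,2)] .
  qed
  have eqD: "q = q' \<and> j = j'"
    if "pair_index n (c ! q, fold \<tau> (take (Suc q) c) j) = pair_index n (c ! q', fold \<tau> (take (Suc q') c) j')"
      "q < ?L" "q' < ?L" "j \<in> {1..m}" "j' \<in> {1..m}" for q q' j j'
  proof -
    have "c ! q \<in> {1..n}" "c ! q' \<in> {1..n}" using c(2) that nth_mem by blast+
    then have eq: "c ! q = c ! q'" "fold \<tau> (take (Suc q) c) j = fold \<tau> (take (Suc q') c) j'"
      using that(1) pair_index_eq_iff[OF _ fold_take_mem[OF c(2) that(4)] _ fold_take_mem[OF c(2) that(5)]]
      by blast+
    have q: "q = q'" using eq(1) nth_eq_iff_index_eq[OF c'(2) that(2,3)] by blast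
    have "inj (fold \<tau> (take (Suc q') c))" by (rule permutes_inj[OF fold_take_permutes[OF c(2)]])
    then have "j = j'" using eq(2) unfolding q by (rule injD)
    with q show ?thesis ..
  qed
  have nth_block: "iota_block n \<tau> c j ! q = pair_index n (c ! q, fold \<tau> (take (Suc q) c) j)" if "q < ?L" for j q
    using that unfolding iota_block_def by simp
  have mem_rd: "j \<in> {1..m}" if "j \<in> set (rotate_back d)" for j
    by (rule subsetD[OF d(2) that[unfolded set_rotate_back[OF d'(1)]]])
  have common: "j = j'" if xj: "x \<in> set (iota_block n \<tau> c j)" "x \<in> set (iota_block n \<tau> c j')"
    and jj: "j \<in> set (rotate_back d)" "j' \<in> set (rotate_back d)" for x j j'
  proof -
    obtain q where q: "q < ?L" "iota_block n \<tau> c j ! q = x"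
      using xj(1) unfolding in_set_conv_nth length_iota_block by blast
    obtain q' where q': "q' < ?L" "iota_block n \<tau> c j' ! q' = x"
      using xj(2) unfolding in_set_conv_nth length_iota_block by blast
    have "pair_index n (c ! q, fold \<tau> (take (Suc q) c) j) = pair_index n (c ! q', fold \<tau> (take (Suc q') c) j')"
      using q(2) q'(2) unfolding nth_block[OF q(1)] nth_block[OF q'(1)] by (rule trans[OF _ sym])
    from eqD[OF this q(1) q'(1) mem_rd[OF jj(1)] mem_rd[OF jj(2)]] show ?thesis ..
  qed
  show "distinct ?e" unfolding iota_cycle_blocks
  proof (rule distinct_concat)
    have "inj_on (iota_block n \<tau> c) (set (rotate_back d))"
    proof (rule inj_onI)
      fix j j' assume jj: "j \<in> set (rotate_back d)" "j' \<in> set (rotate_back d)" "iota_block n \<tau> c j = iota_block n \<tau> c j'"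
      have "iota_block n \<tau> c j ! 0 \<in> set (iota_block n \<tau> c j)" using c'(1) by (intro nth_mem) (simp add: length_iota_block)
      then show "j = j'" using common jj by metis
    qed
    then show "distinct (map (iota_block n \<tau> c) (rotate_back d))"
      unfolding distinct_map distinct_rotate_back[OF d'(1)] using d'(2) by blast
    show "distinct ys" if ys: "ys \<in> set (map (iota_block n \<tau> c) (rotate_back d))" for ys
    proof -
      obtain j where j: "j \<in> set (rotate_back d)" "ys = iota_block n \<tau> c j" using ys unfolding set_map by blast
      show ?thesis unfolding j(2) distinct_conv_nth length_iota_block
      proof (intro allI impI notI)
        fix q q' assume q: "q < ?L" "q' < ?L" "q \<noteq> q'" "iota_block n \<tau> c j ! q = iota_block n \<tau> c j ! q'"
        from eqD[OF q(4)[unfolded nth_block[OF q(1)] nth_block[OF q(2)]] q(1,2) mem_rd[OF j(1)] mem_rd[OF j(1)]]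
        show False using q(3) by blast
      qed
    qed
    show "set ys \<inter> set zs = {}" if "ys \<in> set (map (iota_block n \<tau> c) (rotate_back d))"
      "zs \<in> set (map (iota_block n \<tau> c) (rotate_back d))" "ys \<noteq> zs" for ys zs
      using that common unfolding set_map by blast
  qed
qed

end

locale nested_cycles = nested_permutation +
  fixes C :: "nat list set" and D :: "nat list \<Rightarrow> nat list set"
  assumes C: "cycle_system n \<sigma> C"
    and D: "\<And>c. c \<in> C \<Longrightarrow> cycle_system m (fold \<tau> c) (D c)"
begin

lemma C_cycle: "c \<in> C \<Longrightarrow> is_cycle \<sigma> c" "c \<in> C \<Longrightarrow> set c \<subseteq> {1..n}"
  using C unfolding cycle_system_def by blast+

lemma D_cycle: "c \<in> C \<Longrightarrow> d \<in> D c \<Longrightarrow> is_cycle (fold \<tau> c) d"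
  "c \<in> C \<Longrightarrow> d \<in> D c \<Longrightarrow> set d \<subseteq> {1..m}"
  using D unfolding cycle_system_def by blast+

text \<open>
  For \<open>x\<close> corresponding to \<open>(i, j)\<close>, the cycle \<open>c\<close> is the one through \<open>i\<close>, and \<open>d\<close> is the one through
  the element that the product of the \<open>\<tau>\<close> along \<open>c\<close> up to \<open>i\<close> maps to \<open>j\<close>.
\<close>

lemma ex1_iota_cycle:
  assumes "x \<in> {1..n * m}"
  shows "\<exists>!cd. cd \<in> Sigma C D \<and> x \<in> set (iota_cycle n \<tau> (fst cd) (snd cd))"
proof -
  obtain i j where x: "i \<in> {1..n}" "j \<in> {1..m}" "x = pair_index n (i, j)"
    using assms by (rule pair_index_cases)
  obtain c where c: "c \<in> C" "i \<in> set c" "\<And>c'. c' \<in> C \<Longrightarrow> i \<in> set c' \<Longrightarrow> c' = c"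
    using C x(1) unfolding cycle_system_def by metis
  obtain q where q: "q < length c" "c ! q = i" using c(2) by (metis in_set_conv_nth)
  let ?T = "fold \<tau> (take (Suc q) c)"
  have T: "?T permutes {1..m}" by (rule fold_take_permutes[OF C_cycle(2)[OF c(1)]])
  obtain j' where j': "?T j' = j" "j' \<in> {1..m}"
    using permutes_in_image[OF T] permutes_surj[OF T] x(2) by (metis surjD)
  obtain d where d: "d \<in> D c" "j' \<in> set d" "\<And>d'. d' \<in> D c \<Longrightarrow> j' \<in> set d' \<Longrightarrow> d' = d"
    using D[OF c(1)] j'(2) unfolding cycle_system_def by metis
  have mem: "x \<in> set (iota_cycle n \<tau> c' d') \<longleftrightarrow>
      (\<exists>q j'. q < length c' \<and> j' \<in> set d' \<and> i = c' ! q \<and> j = fold \<tau> (take (Suc q) c') j')"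
    if "c' \<in> C" "d' \<in> D c'" for c' d'
    unfolding x(3)
    by (rule pair_index_in_iota_cycle[OF C_cycle(2)[OF that(1)] _ D_cycle(2)[OF that] x(1,2)])
      (use D_cycle(1)[OF that] in \<open>simp add: is_cycle_def\<close>)
  show ?thesis
  proof (rule ex1I[of _ "(c, d)"])
    show "(c, d) \<in> Sigma C D \<and> x \<in> set (iota_cycle n \<tau> (fst (c, d)) (snd (c, d)))"
    proof
      show "(c, d) \<in> Sigma C D" using c(1) d(1) by blast
      show "x \<in> set (iota_cycle n \<tau> (fst (c, d)) (snd (c, d)))"
        unfolding fst_conv snd_conv mem[OF c(1) d(1)] using q d(2) j'(1) by blast
    qed
    fix cd assume cd: "cd \<in> Sigma C D \<and> x \<in> set (iota_cycle n \<tau> (fst cd) (snd cd))"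
    obtain c' d' where cd': "cd = (c', d')" by fastforce
    with cd have mem': "c' \<in> C" "d' \<in> D c'" "x \<in> set (iota_cycle n \<tau> c' d')" by auto
    then obtain q' j'' where *: "q' < length c'" "j'' \<in> set d'" "i = c' ! q'" "j = fold \<tau> (take (Suc q') c') j''"
      unfolding mem[OF mem'(1,2)] by blast
    have "i \<in> set c'" unfolding *(3) by (rule nth_mem[OF *(1)])
    then have c'c: "c' = c" by (rule c(3)[OF mem'(1)])
    have "distinct c" using C_cycle(1)[OF c(1)] unfolding is_cycle_def by blast
    moreover have "c ! q' = c ! q" using *(3) q(2) unfolding c'c by (rule trans[OF sym sym])
    ultimately have q'q: "q' = q" using nth_eq_iff_index_eq *(1)[unfolded c'c] q(1) by blast
    have "?T j'' = ?T j'" using *(4)[unfolded c'c q'q] j'(1) by (rule trans[OF sym sym])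
    then have "j'' = j'" by (rule injD[OF permutes_inj[OF T]])
    then have "d' = d" using d(3)[of d'] mem'(2)[unfolded c'c] *(2) by blast
    with c'c cd' show "cd = (c, d)" by blast
  qed
qed

lemma iota_cycle_nonempty:
  assumes "c \<in> C" "d \<in> D c"
  shows "iota_cycle n \<tau> c d \<noteq> []"
  using is_cycle_iota_cycle[OF C_cycle[OF assms(1)] D_cycle[OF assms]] by (simp add: is_cycle_def)

lemma set_iota_cycle_le:
  assumes "c \<in> C" "d \<in> D c"
  shows "set (iota_cycle n \<tau> c d) \<subseteq> {1..n * m}"
  by (rule set_iota_cycle_subset[OF C_cycle(2)[OF assms(1)] _ D_cycle(2)[OF assms]])
    (use D_cycle(1)[OF assms] in \<open>simp add: is_cycle_def\<close>)

lemma bij_betw_iota_cycle: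
  "bij_betw (\<lambda>(c, d). iota_cycle n \<tau> c d) (Sigma C D) (\<Union>c\<in>C. iota_cycle n \<tau> c ` D c)"
  unfolding bij_betw_def
proof
  show "inj_on (\<lambda>(c, d). iota_cycle n \<tau> c d) (Sigma C D)"
  proof (rule inj_onI)
    fix cd cd' assume *: "cd \<in> Sigma C D" "cd' \<in> Sigma C D"
      "(\<lambda>(c, d). iota_cycle n \<tau> c d) cd = (\<lambda>(c, d). iota_cycle n \<tau> c d) cd'"
    then have eq: "iota_cycle n \<tau> (fst cd) (snd cd) = iota_cycle n \<tau> (fst cd') (snd cd')"
      by (simp add: case_prod_beta)
    have m: "fst cd \<in> C" "snd cd \<in> D (fst cd)" using *(1) by auto
    obtain x where x: "x \<in> set (iota_cycle n \<tau> (fst cd) (snd cd))"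
      using hd_in_set[OF iota_cycle_nonempty[OF m]] by (rule that)
    then have "x \<in> {1..n * m}" using set_iota_cycle_le[OF m] by blast
    from ex1_iota_cycle[OF this] show "cd = cd'"
    proof (rule ex1E)
      fix z assume "\<forall>y. y \<in> Sigma C D \<and> x \<in> set (iota_cycle n \<tau> (fst y) (snd y)) \<longrightarrow> y = z"
      then have "cd = z" "cd' = z" using *(1,2) x x[unfolded eq] by blast+
      then show ?thesis by simp
    qed
  qed
  show "(\<lambda>(c, d). iota_cycle n \<tau> c d) ` Sigma C D = (\<Union>c\<in>C. iota_cycle n \<tau> c ` D c)" by (auto simp: image_iff)
qed

lemma cycle_system_iota:
  "cycle_system (n * m) (iota n m \<tau> \<sigma>) (\<Union>c\<in>C. iota_cycle n \<tau> c ` D c)"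
  unfolding cycle_system_def
proof (intro conjI ballI)
  fix e assume "e \<in> (\<Union>c\<in>C. iota_cycle n \<tau> c ` D c)"
  then obtain c d where e: "c \<in> C" "d \<in> D c" "e = iota_cycle n \<tau> c d" by blast
  show "is_cycle (iota n m \<tau> \<sigma>) e" unfolding e(3)
    by (rule is_cycle_iota_cycle[OF C_cycle[OF e(1)] D_cycle[OF e(1,2)]])
  show "set e \<subseteq> {1..n * m}" unfolding e(3) by (rule set_iota_cycle_le[OF e(1,2)])
next
  fix x assume "x \<in> {1..n * m}"
  from ex1_iota_cycle[OF this]
  obtain cd where cd: "cd \<in> Sigma C D" "x \<in> set (iota_cycle n \<tau> (fst cd) (snd cd))"
    and uniq: "\<forall>y. y \<in> Sigma C D \<and> x \<in> set (iota_cycle n \<tau> (fst y) (snd y)) \<longrightarrow> y = cd"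
    by (elim ex1E conjE)
  show "\<exists>!e. e \<in> (\<Union>c\<in>C. iota_cycle n \<tau> c ` D c) \<and> x \<in> set e"
  proof (rule ex1I[of _ "iota_cycle n \<tau> (fst cd) (snd cd)"])
    show "iota_cycle n \<tau> (fst cd) (snd cd) \<in> (\<Union>c\<in>C. iota_cycle n \<tau> c ` D c)
        \<and> x \<in> set (iota_cycle n \<tau> (fst cd) (snd cd))" using cd by (cases cd) auto
    fix e assume e: "e \<in> (\<Union>c\<in>C. iota_cycle n \<tau> c ` D c) \<and> x \<in> set e"
    then obtain c d where cd': "c \<in> C" "d \<in> D c" "e = iota_cycle n \<tau> c d" by blast
    have "(c, d) = cd"
    proof (rule uniq[THEN spec, THEN mp])
      show "(c, d) \<in> Sigma C D \<and> x \<in> set (iota_cycle n \<tau> (fst (c, d)) (snd (c, d)))"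
        using e cd' by simp
    qed
    then show "e = iota_cycle n \<tau> (fst cd) (snd cd)" unfolding cd'(3) by (metis fst_conv snd_conv)
  qed
qed

end

section \<open>Loops in iterated powers\<close>

lemma snd_cycle_prod_wreath:
  "snd (cycle_prod (wreath G m) g\<tau> c) = fold (\<lambda>i. snd (g\<tau> i)) c"
proof (induction c rule: rev_induct)
  case Nil
  show ?case by (simp add: cycle_prod_Nil one_wreath id_def)
next
  case (snoc x c)
  have "snd (cycle_prod (wreath G m) g\<tau> (c @ [x])) = snd (g\<tau> x) \<circ> snd (cycle_prod (wreath G m) g\<tau> c)"
    unfolding cycle_prod_snoc by (simp add: wreath_def case_prod_beta)
  then show ?case unfolding snoc by (simp add: fun_eq_iff)
qed

locale wreath_loops = nested_cycles n m \<tau> \<sigma> C D + path_action G M act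
  for n m :: nat and \<tau> \<sigma> C D and G :: "('g, 'r) monoid_scheme"
    and M :: "'a manifold" and act +
  fixes g :: "nat \<Rightarrow> nat \<Rightarrow> 'g"
  assumes G: "monoid G" and M: "charts_cover M"
    and g: "\<And>i. i \<in> {1..n} \<Longrightarrow> g i \<in> {1..m} \<rightarrow>\<^sub>E carrier G"
begin

abbreviation g\<tau> :: "nat \<Rightarrow> (nat \<Rightarrow> 'g) \<times> (nat \<Rightarrow> nat)" where
  "g\<tau> \<equiv> \<lambda>i\<in>{1..n}. (g i, \<tau> i)"

abbreviation cprod :: "nat list \<Rightarrow> (nat \<Rightarrow> 'g) \<times> (nat \<Rightarrow> nat)" where
  "cprod c \<equiv> cycle_prod (wreath G m) g\<tau> c"

abbreviation double_loops :: "(real \<Rightarrow> nat \<Rightarrow> nat \<Rightarrow> 'a) set" where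
  "double_loops \<equiv> loops 1 (power_manifold n (power_manifold m M))
     (wreath_act n (wreath_act m act)) (g\<tau>, \<sigma>)"

abbreviation flat_loops :: "(real \<Rightarrow> nat \<Rightarrow> 'a) set" where
  "flat_loops \<equiv> loops 1 (power_manifold (n * m) M)
     (wreath_act (n * m) act) (flatten n m g, iota n m \<tau> \<sigma>)"

sublocale W: path_action "wreath G m" "power_manifold m M" "wreath_act m act"
  by (rule path_action_wreath[OF M])

lemma g_closed: "i \<in> {1..n} \<Longrightarrow> j \<in> {1..m} \<Longrightarrow> g i j \<in> carrier G"
  using g by (rule PiE_mem)

lemma \<sigma>_mem: "i \<in> {1..n} \<Longrightarrow> \<sigma> i \<in> {1..n}"
  using permutes_in_image[OF \<sigma>] by blast

lemma \<tau>_mem: "i \<in> {1..n} \<Longrightarrow> j \<in> {1..m} \<Longrightarrow> \<tau> i j \<in> {1..m}"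
  using permutes_in_image[OF \<tau>] by blast

lemma g\<tau>_closed: "i \<in> {1..n} \<Longrightarrow> g\<tau> i \<in> carrier (wreath G m)"
  using g \<tau> by (simp add: mem_carrier_wreath)

lemma g\<tau>\<sigma>_closed: "(g\<tau>, \<sigma>) \<in> carrier (wreath (wreath G m) n)"
  unfolding mem_carrier_wreath using g\<tau>_closed \<sigma> by (simp del: restrict_apply add: PiE_iff)

lemma flatten_g_mem: "q \<in> {1..n * m} \<Longrightarrow> flatten n m g q \<in> carrier G"
  by (erule pair_index_cases) (simp only: flatten_pair_index g_closed)

lemma flatten_g_closed: "(flatten n m g, iota n m \<tau> \<sigma>) \<in> carrier (wreath G (n * m))"
  unfolding mem_carrier_wreath PiE_iff
  using flatten_g_mem iota_permutes[OF \<sigma> \<tau>] by (simp add: flatten_def del: atLeastAtMost_iff)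

lemma cprod_closed: "set c \<subseteq> {1..n} \<Longrightarrow> cprod c \<in> carrier (wreath G m)"
  by (rule W.cycle_prod_closed) (use g\<tau>_closed in blast)

lemma snd_cprod:
  assumes "set c \<subseteq> {1..n}"
  shows "snd (cprod c) = fold \<tau> c"
  unfolding snd_cycle_prod_wreath by (rule ext, rule fold_cong) (use assms in auto)

lemma cprod_eq: "set c \<subseteq> {1..n} \<Longrightarrow> cprod c = (fst (cprod c), fold \<tau> c)"
  using snd_cprod[of c] by (metis prod.collapse)

lemma fst_cprod_closed:
  assumes "set c \<subseteq> {1..n}" "j \<in> {1..m}"
  shows "fst (cprod c) j \<in> carrier G"
proof -
  have "(fst (cprod c), fold \<tau> c) \<in> carrier (wreath G m)"
    using cprod_closed[OF assms(1)] cprod_eq[OF assms(1)] by simp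
  then have "fst (cprod c) \<in> {1..m} \<rightarrow>\<^sub>E carrier G" unfolding mem_carrier_wreath ..
  then show ?thesis using assms(2) by (rule PiE_mem)
qed

lemma fst_cprod_Nil: "j \<in> {1..m} \<Longrightarrow> fst (cprod []) j = \<one>\<^bsub>G\<^esub>"
  by (simp add: cycle_prod_Nil one_wreath)

text \<open>
  Evaluating at the image of \<open>j\<close> removes the inverse permutation from the product of the wreath
  product. The components then multiply like the elements at the entries of a block.
\<close>

lemma fst_cprod_snoc:
  assumes c: "set c \<subseteq> {1..n}" and x: "x \<in> {1..n}" and j: "j \<in> {1..m}"
  shows "fst (cprod (c @ [x])) (fold \<tau> (c @ [x]) j) =
    g x (fold \<tau> (c @ [x]) j) \<otimes>\<^bsub>G\<^esub> fst (cprod c) (fold \<tau> c j)"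
proof -
  let ?k = "fold \<tau> (c @ [x]) j"
  have k: "?k = \<tau> x (fold \<tau> c j)" by simp
  have "fold \<tau> c j \<in> {1..m}" using permutes_in_image[OF fold_permutes'[OF c]] j by blast
  then have k_mem: "?k \<in> {1..m}" unfolding k by (rule \<tau>_mem[OF x])
  have "cprod (c @ [x]) = (g x, \<tau> x) \<otimes>\<^bsub>wreath G m\<^esub> (fst (cprod c), fold \<tau> c)"
    unfolding cycle_prod_snoc cprod_eq[OF c, symmetric] using x by simp
  then have "fst (cprod (c @ [x])) ?k = g x ?k \<otimes>\<^bsub>G\<^esub> fst (cprod c) (inv_into UNIV (\<tau> x) ?k)"
    unfolding mult_wreath using k_mem by (simp del: atLeastAtMost_iff)
  also have "inv_into UNIV (\<tau> x) ?k = fold \<tau> c j"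
    unfolding k by (rule permutes_inverses(2)[OF \<tau>[OF x]])
  finally show ?thesis .
qed

lemma cycle_prod_take_iota_block:
  assumes c: "set c \<subseteq> {1..n}" and j: "j \<in> {1..m}" and q: "q \<le> length c"
  shows "cycle_prod G (flatten n m g) (take q (iota_block n \<tau> c j)) =
    fst (cprod (take q c)) (fold \<tau> (take q c) j)"
  using q
proof (induction q)
  case 0
  show ?case unfolding take_0 fold_simps fst_cprod_Nil[OF j] by (rule cycle_prod_Nil)
next
  case (Suc q)
  then have q: "q < length c" "q < length (iota_block n \<tau> c j)" by (simp_all add: length_iota_block)
  have x: "c ! q \<in> {1..n}" using c q(1) nth_mem by blast
  have tc: "set (take q c) \<subseteq> {1..n}" using c set_take_subset[of q c] by blast
  have T: "fold \<tau> (take (Suc q) c) j \<in> {1..m}" by (rule fold_take_mem[OF c j])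
  have nth: "iota_block n \<tau> c j ! q = pair_index n (c ! q, fold \<tau> (take (Suc q) c) j)"
    using q(1) by (simp add: iota_block_def)
  have "cycle_prod G (flatten n m g) (take (Suc q) (iota_block n \<tau> c j)) =
      g (c ! q) (fold \<tau> (take (Suc q) c) j) \<otimes>\<^bsub>G\<^esub> fst (cprod (take q c)) (fold \<tau> (take q c) j)"
    unfolding cycle_prod_take_Suc[OF q(2)] nth flatten_pair_index[OF x T] Suc.IH[OF less_imp_le[OF q(1)]] ..
  also have "\<dots> = fst (cprod (take (Suc q) c)) (fold \<tau> (take (Suc q) c) j)"
    unfolding take_Suc_conv_app_nth[OF q(1)] by (rule fst_cprod_snoc[OF tc x j, symmetric])
  finally show ?case .
qed

lemma set_iota_block:
  assumes c: "set c \<subseteq> {1..n}" and j: "j \<in> {1..m}"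
  shows "set (iota_block n \<tau> c j) \<subseteq> {1..n * m}"
proof
  fix x assume "x \<in> set (iota_block n \<tau> c j)"
  then obtain q where q: "q < length c" "x = pair_index n (c ! q, fold \<tau> (take (Suc q) c) j)"
    unfolding iota_block_def by auto
  have "c ! q \<in> {1..n}" using c q(1) nth_mem by blast
  then show "x \<in> {1..n * m}" unfolding q(2) by (rule pair_index_mem) (rule fold_take_mem[OF c j])
qed

text \<open>
  Each full block contributes the component of the cycle product of \<open>c\<close> at the index to which one
  passage through \<open>c\<close> takes its start.
\<close>

lemma cycle_prod_iota_blocks:
  assumes c: "set c \<subseteq> {1..n}" and js: "set js \<subseteq> {1..m}"
  shows "cycle_prod G (flatten n m g) (concat (map (iota_block n \<tau> c) js)) =
    cycle_prod G (fst (cprod c)) (map (fold \<tau> c) js)"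
  using js
proof (induction js rule: rev_induct)
  case Nil
  show ?case by (simp add: cycle_prod_Nil)
next
  case (snoc j js)
  interpret monoid G by (rule G)
  have j: "j \<in> {1..m}" and js: "set js \<subseteq> {1..m}" using snoc.prems by auto
  let ?bs = "concat (map (iota_block n \<tau> c) js)" and ?b = "iota_block n \<tau> c j"
  have "set ?bs \<union> set ?b \<subseteq> {1..n * m}" using js j set_iota_block[OF c] unfolding set_concat set_map by blast
  then have "cycle_prod G (flatten n m g) (?bs @ ?b) =
      cycle_prod G (flatten n m g) ?b \<otimes>\<^bsub>G\<^esub> cycle_prod G (flatten n m g) ?bs"
    using cycle_prod_append[of ?bs ?b "flatten n m g"] flatten_g_mem by blast
  also have "cycle_prod G (flatten n m g) ?b = fst (cprod c) (fold \<tau> c j)"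
    using cycle_prod_take_iota_block[OF c j, of "length c"] by (simp add: length_iota_block)
  finally show ?case unfolding snoc.IH[OF js] map_append list.map concat_append concat.simps
      append_Nil2 cycle_prod_snoc .
qed

text \<open>
  The blocks start from the entries of \<open>rotate_back d\<close>, which \<open>fold \<tau> c\<close> moves to the entries of
  \<open>d\<close>. So the first \<open>p\<close> blocks account for the first \<open>p\<close> entries of \<open>d\<close>.
\<close>

lemma cycle_prod_take_iota_cycle:
  assumes c: "set c \<subseteq> {1..n}" and d: "is_cycle (fold \<tau> c) d" "set d \<subseteq> {1..m}"
    and pq: "p < length d" "q \<le> length c"
  shows "cycle_prod G (flatten n m g) (take (p * length c + q) (iota_cycle n \<tau> c d)) =
    fst (cprod (take q c)) (fold \<tau> (take q c) (rotate_back d ! p)) \<otimes>\<^bsub>G\<^esub>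
    cycle_prod G (fst (cprod c)) (take p d)"
proof -
  interpret monoid G by (rule G)
  have dne: "d \<noteq> []" and step: "\<And>p. p < length d \<Longrightarrow> fold \<tau> c (rotate_back d ! p) = d ! p"
    using d(1) unfolding is_cycle_iff_rotate_back by blast+
  let ?rd = "rotate_back d"
  have len: "length ?rd = length d" by (rule length_rotate_back[OF dne])
  have rd: "set ?rd \<subseteq> {1..m}" unfolding set_rotate_back[OF dne] by (rule d(2))
  have j: "?rd ! p \<in> {1..m}" using rd nth_mem[of p ?rd] pq(1) len by (metis subsetD)
  have trd: "set (take p ?rd) \<subseteq> {1..m}" using rd set_take_subset[of p ?rd] by blast
  let ?bs = "concat (map (iota_block n \<tau> c) (take p ?rd))" and ?b = "take q (iota_block n \<tau> c (?rd ! p))"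
  have "take (p * length c + q) (iota_cycle n \<tau> c d) =
      concat (take p (map (iota_block n \<tau> c) ?rd)) @ take q (map (iota_block n \<tau> c) ?rd ! p)"
    unfolding iota_cycle_blocks
  proof (rule take_concat_blocks)
    show "length b = length c" if "b \<in> set (map (iota_block n \<tau> c) ?rd)" for b
      using that unfolding set_map by (elim imageE) (simp only: length_iota_block)
    show "p < length (map (iota_block n \<tau> c) ?rd)" unfolding length_map len by (rule pq(1))
  qed (rule pq(2))
  also have "\<dots> = ?bs @ ?b" using pq(1) len by (simp only: take_map nth_map)
  finally have take_eq: "take (p * length c + q) (iota_cycle n \<tau> c d) = ?bs @ ?b" .
  have "set ?b \<subseteq> {1..n * m}" using set_take_subset set_iota_block[OF c j] by (rule order_trans)
  moreover have "set ?bs \<subseteq> {1..n * m}"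
    unfolding set_concat set_map using set_iota_block[OF c] trd by blast
  ultimately have "cycle_prod G (flatten n m g) (?bs @ ?b) =
      cycle_prod G (flatten n m g) ?b \<otimes>\<^bsub>G\<^esub> cycle_prod G (flatten n m g) ?bs"
    using cycle_prod_append[of ?bs ?b "flatten n m g"] flatten_g_mem by blast
  also have "cycle_prod G (flatten n m g) ?b = fst (cprod (take q c)) (fold \<tau> (take q c) (?rd ! p))"
    by (rule cycle_prod_take_iota_block[OF c j pq(2)])
  also have "cycle_prod G (flatten n m g) ?bs = cycle_prod G (fst (cprod c)) (map (fold \<tau> c) (take p ?rd))"
    by (rule cycle_prod_iota_blocks[OF c trd])
  also have "map (fold \<tau> c) (take p ?rd) = take p d"
  proof (rule nth_equalityI)
    show "length (map (fold \<tau> c) (take p ?rd)) = length (take p d)" by (simp only: length_map length_take len)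
    fix i assume "i < length (map (fold \<tau> c) (take p ?rd))"
    then have i: "i < p" "i < length ?rd" by simp_all
    have "map (fold \<tau> c) (take p ?rd) ! i = fold \<tau> c (?rd ! i)"
      using i by (simp del: nth_Cons)
    then show "map (fold \<tau> c) (take p ?rd) ! i = take p d ! i"
      using step[of i] i len by (simp only: nth_take)
  qed
  finally show ?thesis unfolding take_eq .
qed

text \<open>
  In terms of the components in \<open>M\<close>, this condition and the one of the next lemma become the same
  under the bijection of pairs with indices.
\<close>

lemma mem_double_loops:
  "\<gamma> \<in> double_loops \<longleftrightarrow>
     \<gamma> \<in> extensional {0..1} \<and> (\<forall>t\<in>{0..1}. \<gamma> t \<in> extensional {1..n}) \<and>
     (\<forall>t\<in>{0..1}. \<forall>i\<in>{1..n}. \<gamma> t i \<in> extensional {1..m}) \<and>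
     (\<forall>i\<in>{1..n}. \<forall>j\<in>{1..m}. piecewise_smooth_path M 1 (\<lambda>t. \<gamma> t i j)) \<and>
     (\<forall>i\<in>{1..n}. \<forall>j\<in>{1..m}. \<gamma> 1 i j = act (\<gamma> 0 (\<sigma> i) (\<tau> (\<sigma> i) j)) (g (\<sigma> i) (\<tau> (\<sigma> i) j)))"
proof -
  have "\<gamma> 1 i = wreath_act m act (\<gamma> 0 (\<sigma> i)) (g\<tau> (\<sigma> i)) \<longleftrightarrow>
      (\<forall>j\<in>{1..m}. \<gamma> 1 i j = act (\<gamma> 0 (\<sigma> i) (\<tau> (\<sigma> i) j)) (g (\<sigma> i) (\<tau> (\<sigma> i) j)))"
    if i: "i \<in> {1..n}" and ext: "\<gamma> 1 i \<in> extensional {1..m}" for i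
  proof -
    have "g\<tau> (\<sigma> i) = (g (\<sigma> i), \<tau> (\<sigma> i))" using \<sigma>_mem[OF i] by simp
    moreover have "\<gamma> 1 i = wreath_act m act (\<gamma> 0 (\<sigma> i)) (g (\<sigma> i), \<tau> (\<sigma> i)) \<longleftrightarrow>
        (\<forall>j\<in>{1..m}. \<gamma> 1 i j = wreath_act m act (\<gamma> 0 (\<sigma> i)) (g (\<sigma> i), \<tau> (\<sigma> i)) j)"
      using extensionalityI[OF ext wreath_act_extensional] by metis
    ultimately show ?thesis by (simp only: wreath_act_apply cong: ball_cong)
  qed
  moreover have "\<gamma> 1 i \<in> extensional {1..m}"
    if "i \<in> {1..n}" "\<forall>t\<in>{0..1}. \<forall>i\<in>{1..n}. \<gamma> t i \<in> extensional {1..m}" for i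
    by (rule that(2)[THEN bspec, THEN bspec, OF _ that(1)]) simp
  ultimately show ?thesis
    unfolding W.mem_loops_power[OF charts_cover_power[OF M]] piecewise_smooth_path_power[OF M]
      of_nat_1 by blast
qed

lemma mem_flat_loops:
  "\<delta> \<in> flat_loops \<longleftrightarrow>
     \<delta> \<in> extensional {0..1} \<and> (\<forall>t\<in>{0..1}. \<delta> t \<in> extensional {1..n * m}) \<and>
     (\<forall>i\<in>{1..n}. \<forall>j\<in>{1..m}. piecewise_smooth_path M 1 (\<lambda>t. \<delta> t (pair_index n (i, j)))) \<and>
     (\<forall>i\<in>{1..n}. \<forall>j\<in>{1..m}. \<delta> 1 (pair_index n (i, j)) =
        act (\<delta> 0 (pair_index n (\<sigma> i, \<tau> (\<sigma> i) j))) (g (\<sigma> i) (\<tau> (\<sigma> i) j)))"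
  unfolding mem_loops_power[OF M] ball_pair_index of_nat_1
  by (simp only: iota_pair_index flatten_pair_index[OF \<sigma>_mem \<tau>_mem[OF \<sigma>_mem]] cong: ball_cong)

lemma flatten_path_pair_index:
  assumes "t \<in> {0..1}" "i \<in> {1..n}" "j \<in> {1..m}"
  shows "flatten_path 1 n m \<gamma> t (pair_index n (i, j)) = \<gamma> t i j"
  using assms(1) unfolding flatten_path_def of_nat_1
  by (simp only: restrict_apply if_True flatten_pair_index[OF assms(2,3)])

lemma bij_betw_flatten_path: "bij_betw (flatten_path 1 n m) double_loops flat_loops"
proof (rule bij_betwI)
  let ?un = "\<lambda>\<delta>. \<lambda>t\<in>{0..1}. \<lambda>i\<in>{1..n}. \<lambda>j\<in>{1..m}. \<delta> t (pair_index n (i, j))"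
  have zo: "(0::real) \<in> {0..1}" "(1::real) \<in> {0..1}" by auto
  show "flatten_path 1 n m \<in> double_loops \<rightarrow> flat_loops"
  proof
    fix \<gamma> assume \<gamma>: "\<gamma> \<in> double_loops"
    show "flatten_path 1 n m \<gamma> \<in> flat_loops" unfolding mem_flat_loops
    proof (intro conjI ballI)
      show "flatten_path 1 n m \<gamma> \<in> extensional {0..1}" by (simp add: flatten_path_def)
      show "flatten_path 1 n m \<gamma> t \<in> extensional {1..n * m}" if "t \<in> {0..1}" for t
        using that by (simp add: flatten_path_def flatten_def)
      fix i j assume ij: "i \<in> {1..n}" "j \<in> {1..m}"
      show "piecewise_smooth_path M 1 (\<lambda>t. flatten_path 1 n m \<gamma> t (pair_index n (i, j)))"
        using \<gamma>[unfolded mem_double_loops] ij flatten_path_pair_index[OF _ ij, of _ \<gamma>]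
          piecewise_smooth_path_cong[of 1 "\<lambda>t. \<gamma> t i j" "\<lambda>t. flatten_path 1 n m \<gamma> t (pair_index n (i, j))" M]
        by metis
      show "flatten_path 1 n m \<gamma> 1 (pair_index n (i, j)) =
          act (flatten_path 1 n m \<gamma> 0 (pair_index n (\<sigma> i, \<tau> (\<sigma> i) j))) (g (\<sigma> i) (\<tau> (\<sigma> i) j))"
        unfolding flatten_path_pair_index[OF zo(2) ij]
          flatten_path_pair_index[OF zo(1) \<sigma>_mem[OF ij(1)] \<tau>_mem[OF \<sigma>_mem[OF ij(1)] ij(2)]]
        using \<gamma>[unfolded mem_double_loops] ij by blast
    qed
  qed
  show "?un \<in> flat_loops \<rightarrow> double_loops"
  proof
    fix \<delta> assume \<delta>: "\<delta> \<in> flat_loops"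
    have un: "?un \<delta> t i j = \<delta> t (pair_index n (i, j))" if "t \<in> {0..1}" "i \<in> {1..n}" "j \<in> {1..m}" for t i j
      using that by simp
    show "?un \<delta> \<in> double_loops" unfolding mem_double_loops
    proof (intro conjI ballI)
      show "?un \<delta> \<in> extensional {0..1}" by simp
      show "?un \<delta> t \<in> extensional {1..n}" if "t \<in> {0..1}" for t using that by simp
      show "?un \<delta> t i \<in> extensional {1..m}" if "t \<in> {0..1}" "i \<in> {1..n}" for t i using that by simp
      fix i j assume ij: "i \<in> {1..n}" "j \<in> {1..m}"
      show "piecewise_smooth_path M 1 (\<lambda>t. ?un \<delta> t i j)"
        using \<delta>[unfolded mem_flat_loops] ij un[OF _ ij]
          piecewise_smooth_path_cong[of 1 "\<lambda>t. ?un \<delta> t i j" "\<lambda>t. \<delta> t (pair_index n (i, j))" M]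
        by blast
      show "?un \<delta> 1 i j = act (?un \<delta> 0 (\<sigma> i) (\<tau> (\<sigma> i) j)) (g (\<sigma> i) (\<tau> (\<sigma> i) j))"
        unfolding un[OF zo(2) ij] un[OF zo(1) \<sigma>_mem[OF ij(1)] \<tau>_mem[OF \<sigma>_mem[OF ij(1)] ij(2)]]
        using \<delta>[unfolded mem_flat_loops] ij by blast
    qed
  qed
  show "?un (flatten_path 1 n m \<gamma>) = \<gamma>" if \<gamma>: "\<gamma> \<in> double_loops" for \<gamma>
  proof (rule extensionalityI)
    show "?un (flatten_path 1 n m \<gamma>) \<in> extensional {0..1}" by simp
    show "\<gamma> \<in> extensional {0..1}" using \<gamma>[unfolded mem_double_loops] by blast
    fix t :: real assume t: "t \<in> {0..1}"
    show "?un (flatten_path 1 n m \<gamma>) t = \<gamma> t"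
    proof (rule extensionalityI)
      show "?un (flatten_path 1 n m \<gamma>) t \<in> extensional {1..n}" using t by simp
      show "\<gamma> t \<in> extensional {1..n}" using \<gamma>[unfolded mem_double_loops] t by blast
      fix i assume i: "i \<in> {1..n}"
      show "?un (flatten_path 1 n m \<gamma>) t i = \<gamma> t i"
      proof (rule extensionalityI)
        show "?un (flatten_path 1 n m \<gamma>) t i \<in> extensional {1..m}" using t i by simp
        show "\<gamma> t i \<in> extensional {1..m}" using \<gamma>[unfolded mem_double_loops] t i by blast
        show "?un (flatten_path 1 n m \<gamma>) t i j = \<gamma> t i j" if j: "j \<in> {1..m}" for j
          using t i j flatten_path_pair_index[OF t i j, of \<gamma>] by simp
      qed
    qed
  qed
  show "flatten_path 1 n m (?un \<delta>) = \<delta>" if \<delta>: "\<delta> \<in> flat_loops" for \<delta>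
  proof (rule extensionalityI)
    show "flatten_path 1 n m (?un \<delta>) \<in> extensional {0..1}" by (simp add: flatten_path_def)
    show "\<delta> \<in> extensional {0..1}" using \<delta>[unfolded mem_flat_loops] by blast
    fix t :: real assume t: "t \<in> {0..1}"
    show "flatten_path 1 n m (?un \<delta>) t = \<delta> t"
    proof (rule extensionalityI)
      show "flatten_path 1 n m (?un \<delta>) t \<in> extensional {1..n * m}"
        using t by (simp add: flatten_path_def flatten_def)
      show "\<delta> t \<in> extensional {1..n * m}" using \<delta>[unfolded mem_flat_loops] t by blast
      fix q assume "q \<in> {1..n * m}"
      then obtain i j where q: "i \<in> {1..n}" "j \<in> {1..m}" "q = pair_index n (i, j)"
        by (rule pair_index_cases)
      show "flatten_path 1 n m (?un \<delta>) t q = \<delta> t q"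
        unfolding q(3) flatten_path_pair_index[OF t q(1,2)] using t q(1,2) by simp
    qed
  qed
qed

lemma F_cycle_double_loop:
  assumes \<gamma>: "\<gamma> \<in> double_loops" and c: "c \<in> C"
  shows "F_cycle (wreath G m) (wreath_act m act) 1 g\<tau> \<gamma> c \<in>
    loops (length c) (power_manifold m M) (wreath_act m act) (cprod c)"
  using W.F_cycle_loops[OF charts_cover_power[OF M] g\<tau>\<sigma>_closed \<gamma> C_cycle[OF c]]
  by (simp only: mult_1_right)

lemma F_cycle_nested:
  assumes \<Gamma>: "\<Gamma> \<in> loops (length c) (power_manifold m M) (wreath_act m act) (cprod c)"
    and c: "c \<in> C" and d: "d \<in> D c"
  shows "F_cycle G act (length c) (fst (cprod c)) \<Gamma> d \<in>
    loops (length d * length c) M act (cycle_prod G (fst (cprod c)) d)"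
proof (rule F_cycle_loops[OF M _ _ D_cycle[OF c d]])
  show "(fst (cprod c), fold \<tau> c) \<in> carrier (wreath G m)"
    using cprod_closed[OF C_cycle(2)[OF c]] cprod_eq[OF C_cycle(2)[OF c]] by simp
  show "\<Gamma> \<in> loops (length c) (power_manifold m M) (wreath_act m act) (fst (cprod c), fold \<tau> c)"
    using \<Gamma> cprod_eq[OF C_cycle(2)[OF c]] by simp
qed

text \<open>
  Here \<open>Q q\<close> is a piece of the component of the upper map at \<open>c\<close>, \<open>R p q\<close> is what the right map makes
  of it at position \<open>p\<close> of \<open>d\<close>, and \<open>S r\<close> is a piece of the bottom map.
\<close>

lemma F_cycle_iota_cycle:
  assumes \<gamma>: "\<gamma> \<in> double_loops" and c: "c \<in> C" and d: "d \<in> D c"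
  shows "F_cycle G act (length c) (fst (cprod c))
      (F_cycle (wreath G m) (wreath_act m act) 1 g\<tau> \<gamma> c) d =
    F_cycle G act 1 (flatten n m g) (flatten_path 1 n m \<gamma>) (iota_cycle n \<tau> c d)"
proof -
  let ?L = "length c" and ?k = "length d" and ?e = "iota_cycle n \<tau> c d"
  let ?\<delta> = "flatten_path 1 n m \<gamma>" and ?gc = "fst (cprod c)"
  have c': "set c \<subseteq> {1..n}" by (rule C_cycle(2)[OF c])
  have d': "is_cycle (fold \<tau> c) d" "set d \<subseteq> {1..m}" by (rule D_cycle[OF c d])+
  have cne: "c \<noteq> []" and dne: "d \<noteq> []" using C_cycle(1)[OF c] d'(1) unfolding is_cycle_def by blast+
  have lastc: "last c \<in> {1..n}" and lastd: "last d \<in> {1..m}"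
    using c' d'(2) cne dne last_in_set by blast+
  have rc: "rotate_back c ! q \<in> {1..n}" if "q < ?L" for q
    using c' set_rotate_back[OF cne] nth_mem[of q "rotate_back c"] length_rotate_back[OF cne] that by (metis subsetD)
  have rd: "rotate_back d ! p \<in> {1..m}" if "p < ?k" for p
    using d'(2) set_rotate_back[OF dne] nth_mem[of p "rotate_back d"] length_rotate_back[OF dne] that by (metis subsetD)
  have \<gamma>top: "\<gamma> t i j \<in> topspace (mtop M)" if "t \<in> {0..1}" "i \<in> {1..n}" "j \<in> {1..m}" for t i j
  proof -
    have "piecewise_smooth_path M 1 (\<lambda>t. \<gamma> t i j)" using \<gamma> that(2,3) unfolding mem_double_loops by blast
    then show ?thesis using that(1) by (rule piecewise_smooth_path_topspace)
  qed
  define \<Gamma> where "\<Gamma> = F_cycle (wreath G m) (wreath_act m act) 1 g\<tau> \<gamma> c"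
  define Q where "Q q = path_act 1 (wreath_act m act) (\<lambda>t. \<gamma> t (rotate_back c ! q)) (cprod (take q c))" for q
  define h where "h p = cycle_prod G ?gc (take p d)" for p
  define R where "R p q = (\<lambda>t\<in>{0..real 1}. act (Q q t (rotate_back d ! p)) (h p))" for p q
  define S where "S r = path_act 1 act (\<lambda>t. ?\<delta> t (rotate_back ?e ! r)) (cycle_prod G (flatten n m g) (take r ?e))" for r
  have h_closed: "h p \<in> carrier G" for p
    unfolding h_def using d'(2) set_take_subset[of p d]
    by (intro cycle_prod_closed fst_cprod_closed[OF c']) blast
  have \<Gamma>: "\<Gamma> = path_concat 1 (map Q [0..<?L])"
    unfolding \<Gamma>_def Q_def
  proof (rule W.F_cycle_eq[OF cne])
    fix t :: real assume "t \<in> {0..real 1}"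
    then have t: "t \<in> {0..1}" by simp
    have "\<gamma> t (last c) \<in> extensional {1..m}" using \<gamma> t lastc unfolding mem_double_loops by blast
    then show "\<gamma> t (last c) \<in> topspace (mtop (power_manifold m M))"
      unfolding topspace_power_manifold PiE_iff using \<gamma>top[OF t lastc] by blast
  qed
  have "\<Gamma> \<in> loops ?L (power_manifold m M) (wreath_act m act) (cprod c)"
    unfolding \<Gamma>_def by (rule F_cycle_double_loop[OF \<gamma> c])
  then have "piecewise_smooth_path (power_manifold m M) (real ?L) \<Gamma>" unfolding loops_def by blast
  then have "piecewise_smooth_path M (real ?L) (\<lambda>t. \<Gamma> t (last d))"
    unfolding piecewise_smooth_path_power[OF M] using lastd by blast
  from piecewise_smooth_path_topspace[OF this]
  have "F_cycle G act ?L ?gc \<Gamma> d =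
      path_concat ?L (map (\<lambda>p. path_act ?L act (\<lambda>t. \<Gamma> t (rotate_back d ! p)) (h p)) [0..<?k])"
    unfolding h_def by (rule F_cycle_eq[where \<gamma> = \<Gamma>, OF dne])
  also have "(\<lambda>p. path_act ?L act (\<lambda>t. \<Gamma> t (rotate_back d ! p)) (h p)) =
      (\<lambda>p. path_concat 1 (map (R p) [0..<?L]))"
  proof
    fix p
    have "(\<lambda>t\<in>{0..real (length (map Q [0..<?L]) * 1)}.
        act (path_concat 1 (map Q [0..<?L]) t (rotate_back d ! p)) (h p)) =
      path_concat 1 (map (\<lambda>x. \<lambda>t\<in>{0..real 1}. act (x t (rotate_back d ! p)) (h p)) (map Q [0..<?L]))"
      by (rule path_concat_map[where f = "\<lambda>y. act (y (rotate_back d ! p)) (h p)"]) (use cne in simp)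
    then show "path_act ?L act (\<lambda>t. \<Gamma> t (rotate_back d ! p)) (h p) = path_concat 1 (map (R p) [0..<?L])"
      unfolding path_act_def \<Gamma> R_def map_map o_def length_map length_upt mult_1_right diff_zero .
  qed
  also have "path_concat ?L (map (\<lambda>p. path_concat 1 (map (R p) [0..<?L])) [0..<?k]) =
      path_concat (?L * 1) (map (path_concat 1) (map (\<lambda>p. map (R p) [0..<?L]) [0..<?k]))"
    unfolding map_map o_def mult_1_right ..
  also have "\<dots> = path_concat 1 (concat (map (\<lambda>p. map (R p) [0..<?L]) [0..<?k]))"
    by (rule path_concat_concat) (use cne dne in auto)
  also have "concat (map (\<lambda>p. map (R p) [0..<?L]) [0..<?k]) = map S [0..<?k * ?L]"
  proof (rule concat_map_upt_blocks)
    fix p q assume p: "p < ?k" and q: "q < ?L"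
    let ?T = "fold \<tau> (take q c)"
    have tc: "set (take q c) \<subseteq> {1..n}" using c' set_take_subset[of q c] by blast
    have T: "?T (rotate_back d ! p) \<in> {1..m}" by (rule fold_take_mem[OF c' rd[OF p]])
    show "R p q = S (p * ?L + q)"
      unfolding R_def S_def path_act_def
    proof (rule restrict_ext)
      fix t :: real assume "t \<in> {0..real 1}"
      then have t: "t \<in> {0..1}" by simp
      have "Q q t = wreath_act m act (\<gamma> t (rotate_back c ! q)) (fst (cprod (take q c)), ?T)"
        unfolding Q_def path_act_def cprod_eq[OF tc, symmetric] using t by simp
      then have "act (Q q t (rotate_back d ! p)) (h p) =
          act (act (\<gamma> t (rotate_back c ! q) (?T (rotate_back d ! p)))
            (fst (cprod (take q c)) (?T (rotate_back d ! p)))) (h p)"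
        by (simp only: wreath_act_apply[OF rd[OF p]])
      also have "\<dots> = act (\<gamma> t (rotate_back c ! q) (?T (rotate_back d ! p)))
          (fst (cprod (take q c)) (?T (rotate_back d ! p)) \<otimes>\<^bsub>G\<^esub> h p)"
        by (rule act_act[OF \<gamma>top[OF t rc[OF q] T] fst_cprod_closed[OF tc T] h_closed])
      also have "\<dots> = act (?\<delta> t (pair_index n (rotate_back c ! q, ?T (rotate_back d ! p))))
          (cycle_prod G (flatten n m g) (take (p * ?L + q) ?e))"
        unfolding flatten_path_pair_index[OF t rc[OF q] T] h_def
          cycle_prod_take_iota_cycle[OF c' d' p less_imp_le[OF q]] ..
      also have "pair_index n (rotate_back c ! q, ?T (rotate_back d ! p)) = rotate_back ?e ! (p * ?L + q)"
        by (rule nth_rotate_back_iota_cycle[OF cne d'(1) p q, symmetric])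
      finally show "act (Q q t (rotate_back d ! p)) (h p) =
          act (?\<delta> t (rotate_back ?e ! (p * ?L + q))) (cycle_prod G (flatten n m g) (take (p * ?L + q) ?e))" .
    qed
  qed
  also have "?k * ?L = length ?e" by (rule length_iota_cycle[OF dne, symmetric])
  also have "path_concat 1 (map S [0..<length ?e]) = F_cycle G act 1 (flatten n m g) ?\<delta> ?e"
    unfolding S_def
  proof (rule F_cycle_eq[where \<gamma> = ?\<delta>, OF iota_cycle_nonempty[OF c d], symmetric])
    fix t :: real assume "t \<in> {0..real 1}"
    then have t: "t \<in> {0..1}" by simp
    have "last ?e \<in> {1..n * m}"
      using set_iota_cycle_le[OF c d] last_in_set[OF iota_cycle_nonempty[OF c d]] by blast
    then obtain i j where ij: "i \<in> {1..n}" "j \<in> {1..m}" "last ?e = pair_index n (i, j)"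
      by (rule pair_index_cases)
    show "?\<delta> t (last ?e) \<in> topspace (mtop M)"
      unfolding ij(3) flatten_path_pair_index[OF t ij(1,2)] by (rule \<gamma>top[OF t ij(1,2)])
  qed
  finally show ?thesis unfolding \<Gamma>_def .
qed

lemma commuting_square_F_map:
  "commuting_square double_loops
    (\<Pi>\<^sub>E c\<in>C. loops (length c) (power_manifold m M) (wreath_act m act) (cprod c))
    flat_loops
    (\<Pi>\<^sub>E c\<in>C. \<Pi>\<^sub>E d\<in>D c. loops (length d * length c) M act (cycle_prod G (fst (cprod c)) d))
    (F_map (wreath G m) (wreath_act m act) 1 g\<tau> C)
    (\<lambda>\<Gamma>. \<lambda>c\<in>C. F_map G act (length c) (fst (cprod c)) (D c) (\<Gamma> c))
    (flatten_path 1 n m)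
    (\<lambda>\<gamma>. \<lambda>c\<in>C. \<lambda>d\<in>D c. F_map G act 1 (flatten n m g) (\<Union>c\<in>C. iota_cycle n \<tau> c ` D c) \<gamma> (iota_cycle n \<tau> c d))"
  (is "commuting_square ?A ?B ?C ?D ?t ?r ?l ?b")
proof -
  have t: "?t \<in> ?A \<rightarrow> ?B"
  proof
    fix \<gamma> assume "\<gamma> \<in> ?A"
    then show "?t \<gamma> \<in> ?B" unfolding F_map_def by (intro restrict_PiE_iff[THEN iffD2] ballI F_cycle_double_loop)
  qed
  have r: "?r \<in> ?B \<rightarrow> ?D"
  proof
    fix \<Gamma> assume \<Gamma>: "\<Gamma> \<in> ?B"
    show "?r \<Gamma> \<in> ?D"
      unfolding F_map_def
      by (intro restrict_PiE_iff[THEN iffD2] ballI F_cycle_nested PiE_mem[OF \<Gamma>])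
  qed
  have comm: "?r (?t \<gamma>) = ?b (?l \<gamma>)" if \<gamma>: "\<gamma> \<in> ?A" for \<gamma>
  proof (rule restrict_ext)
    fix c assume c: "c \<in> C"
    have tc: "?t \<gamma> c = F_cycle (wreath G m) (wreath_act m act) 1 g\<tau> \<gamma> c"
      unfolding F_map_def using c by (simp only: restrict_apply if_True)
    show "F_map G act (length c) (fst (cprod c)) (D c) (?t \<gamma> c) =
      (\<lambda>d\<in>D c. F_map G act 1 (flatten n m g) (\<Union>c\<in>C. iota_cycle n \<tau> c ` D c) (?l \<gamma>) (iota_cycle n \<tau> c d))"
      unfolding tc F_map_def[of G act "length c"]
    proof (rule restrict_ext)
      fix d assume d: "d \<in> D c"
      have "iota_cycle n \<tau> c d \<in> (\<Union>c\<in>C. iota_cycle n \<tau> c ` D c)" using c d by blast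
      then have "F_map G act 1 (flatten n m g) (\<Union>c\<in>C. iota_cycle n \<tau> c ` D c) (?l \<gamma>) (iota_cycle n \<tau> c d) =
          F_cycle G act 1 (flatten n m g) (?l \<gamma>) (iota_cycle n \<tau> c d)"
        unfolding F_map_def by (simp only: restrict_apply if_True)
      then show "F_cycle G act (length c) (fst (cprod c)) (F_cycle (wreath G m) (wreath_act m act) 1 g\<tau> \<gamma> c) d =
          F_map G act 1 (flatten n m g) (\<Union>c\<in>C. iota_cycle n \<tau> c ` D c) (?l \<gamma>) (iota_cycle n \<tau> c d)"
        using F_cycle_iota_cycle[OF \<gamma> c d] by (simp only:)
    qed
  qed
  have l: "?l \<in> ?A \<rightarrow> ?C" by (rule bij_betw_imp_funcset[OF bij_betw_flatten_path])
  \<comment> \<open>Every loop of the lower left corner comes from the upper left one.\<close>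
  have b: "?b \<in> ?C \<rightarrow> ?D"
  proof
    fix \<delta> assume "\<delta> \<in> ?C"
    then obtain \<gamma> where \<gamma>: "\<gamma> \<in> ?A" "\<delta> = ?l \<gamma>"
      using bij_betw_imp_surj_on[OF bij_betw_flatten_path] by blast
    have "?r (?t \<gamma>) \<in> ?D" by (rule funcset_mem[OF r funcset_mem[OF t \<gamma>(1)]])
    then show "?b \<delta> \<in> ?D" unfolding comm[OF \<gamma>(1)] \<gamma>(2) .
  qed
  show ?thesis unfolding commuting_square_def by (intro conjI t r l b ballI comm)
qed

end

theorem proposition4p11:
  fixes G :: "('g, 'r) monoid_scheme"
    and M :: "'a manifold"
    and act :: "'a \<Rightarrow> 'g \<Rightarrow> 'a"
    and n m :: nat
    and g :: "nat \<Rightarrow> nat \<Rightarrow> 'g"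
    and \<tau> :: "nat \<Rightarrow> nat \<Rightarrow> nat"
    and \<sigma> :: "nat \<Rightarrow> nat"
    and C :: "nat list set"
    and D :: "nat list \<Rightarrow> nat list set"
  defines "g\<tau> \<equiv> \<lambda>i\<in>{1..n}. (g i, \<tau> i)"
    and "gc \<equiv> \<lambda>c. fst (cycle_prod (wreath G m) (\<lambda>i\<in>{1..n}. (g i, \<tau> i)) c)"
    and "\<tau>c \<equiv> \<lambda>c. snd (cycle_prod (wreath G m) (\<lambda>i\<in>{1..n}. (g i, \<tau> i)) c)"
    and "E \<equiv> (\<Union>c\<in>C. iota_cycle n \<tau> c ` D c)"
  assumes "group G" and "finite (carrier G)"
    and "smooth_manifold M" and "smooth_right_action G M act"
    and "(g\<tau>, \<sigma>) \<in> carrier (wreath (wreath G m) n)"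
    and "cycle_system n \<sigma> C"
    and "\<And>c. c \<in> C \<Longrightarrow> cycle_system m (\<tau>c c) (D c)"
  shows "(flatten n m g, iota n m \<tau> \<sigma>) \<in> carrier (wreath G (n * m))
    \<and> cycle_system (n * m) (iota n m \<tau> \<sigma>) E
    \<and> bij_betw (\<lambda>(c, d). iota_cycle n \<tau> c d) (Sigma C D) E
    \<and> bij_betw (flatten_path 1 n m)
        (loops 1 (power_manifold n (power_manifold m M))
           (wreath_act n (wreath_act m act)) (g\<tau>, \<sigma>))
        (loops 1 (power_manifold (n * m) M)
           (wreath_act (n * m) act) (flatten n m g, iota n m \<tau> \<sigma>))
    \<and> commuting_square
        (loops 1 (power_manifold n (power_manifold m M))
           (wreath_act n (wreath_act m act)) (g\<tau>, \<sigma>))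
        (\<Pi>\<^sub>E c\<in>C. loops (length c) (power_manifold m M) (wreath_act m act) (gc c, \<tau>c c))
        (loops 1 (power_manifold (n * m) M)
           (wreath_act (n * m) act) (flatten n m g, iota n m \<tau> \<sigma>))
        (\<Pi>\<^sub>E c\<in>C. \<Pi>\<^sub>E d\<in>D c. loops (length d * length c) M act (cycle_prod G (gc c) d))
        (F_map (wreath G m) (wreath_act m act) 1 g\<tau> C)
        (\<lambda>\<Gamma>. \<lambda>c\<in>C. F_map G act (length c) (gc c) (D c) (\<Gamma> c))
        (flatten_path 1 n m)
        (\<lambda>\<gamma>. \<lambda>c\<in>C. \<lambda>d\<in>D c. F_map G act 1 (flatten n m g) E \<gamma> (iota_cycle n \<tau> c d))"
proof -
  have mem: "g\<tau> i \<in> carrier (wreath G m)" if "i \<in> {1..n}" for i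
    using \<open>(g\<tau>, \<sigma>) \<in> carrier (wreath (wreath G m) n)\<close> that unfolding mem_carrier_wreath by blast
  have g: "g i \<in> {1..m} \<rightarrow>\<^sub>E carrier G" and \<tau>: "\<tau> i permutes {1..m}" if "i \<in> {1..n}" for i
    using mem[OF that] that unfolding g\<tau>_def by (simp_all add: mem_carrier_wreath)
  have \<sigma>: "\<sigma> permutes {1..n}"
    using \<open>(g\<tau>, \<sigma>) \<in> carrier (wreath (wreath G m) n)\<close> unfolding mem_carrier_wreath ..
  have \<tau>c: "\<tau>c c = fold \<tau> c" if "c \<in> C" for c
  proof -
    have "set c \<subseteq> {1..n}" using \<open>cycle_system n \<sigma> C\<close> that unfolding cycle_system_def by blast
    then show ?thesis unfolding \<tau>c_def snd_cycle_prod_wreath by (intro ext fold_cong) auto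
  qed
  interpret monoid G using \<open>group G\<close> by (rule group.is_monoid)
  interpret path_action G M act
    by (rule path_action_smooth_right_action[OF monoid_axioms \<open>smooth_manifold M\<close> \<open>smooth_right_action G M act\<close>])
  interpret wreath_loops n m \<tau> \<sigma> C D G M act g
  proof
    show "cycle_system m (fold \<tau> c) (D c)" if "c \<in> C" for c
      using assms(11)[OF that] unfolding \<tau>c[OF that] .
  qed (fact \<sigma> \<tau> \<open>cycle_system n \<sigma> C\<close> g smooth_manifold_charts_cover[OF \<open>smooth_manifold M\<close>])+
  have "cprod c = (gc c, \<tau>c c)" for c unfolding gc_def \<tau>c_def by simp
  then show ?thesis
    using flatten_g_closed cycle_system_iota bij_betw_iota_cycle bij_betw_flatten_path commuting_square_F_map
    unfolding g\<tau>_def E_def gc_def by simp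
qed

end
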